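(* Let $s\in(0,1)$, $n>2s$, and let $\Omega$ be an open bounded subset of $\mathbb{R}^n$ with Lipschitz boundary. Let $f:\mathbb{R}\to\mathbb{R}$ be a continuous function which is not identically zero and has subcritical growth, i.e. there is $q\in[1,2^* )$, where $2^*:=2n/(n-2s)$, such that $\sup_{t\in\mathbb{R}}\frac{|f(t)|}{1+|t|^{q-1}}<+\infty$. Put $F(\xi):=\int_0^\xi f(t)\,dt$ for $\xi\in\mathbb{R}$ and assume that $$\sup_{\xi\in\mathbb{R}}|F(\xi)|<+\infty .$$ Let $$h:\left(-|\Omega|\operatorname{osc}_{\xi\in\mathbb{R}}F(\xi),\ |\Omega|\operatorname{osc}_{\xi\in\mathbb{R}}F(\xi)\right)\to\mathbb{R}$$ be a continuous and non-decreasing function such that $h^{-1}(0)=\{0\}$, and let $a,b>0$. Then for every sufficiently large $\mu$ (i.e. there exists $\mu_0\in\mathbb{R}$ such that for every $\mu>\mu_0$) there exist a non-empty open interval $$\Lambda\subseteq\left(|\Omega|\inf_{\xi\in\mathbb{R}}F(\xi),\ |\Omega|\sup_{\xi\in\mathbb{R}}F(\xi)\right)$$ and a number $\rho>0$ such that, for every $\lambda\in\Lambda$, there are at least three distinct functions $u_1,u_2,u_3\in H^s(\mathbb{R}^n)$ such that, for every $j\in\{1,2,3\}$, $u_j=0$ a.e. in $\mathbb{R}^n\setminus\Omega$, $$\int_{\mathbb{R}^n\times\mathbb{R}^n}\frac{|u_j(x)-u_j(y)|^2}{|x-y|^{n+2s}}\,dx\,dy<\rho^2,$$ and $u=u_j$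 satisfies $$\left(a+b\int_{\mathbb{R}^{2n}}\frac{|u(x)-u(y)|^2}{|x-y|^{n+2s}}\,dx\,dy\right)\int_{\mathbb{R}^{2n}}\frac{(u(x)-u(y))(\varphi(x)-\varphi(y))}{|x-y|^{n+2s}}\,dx\,dy=\mu\, h\left(\int_\Omega F(u(x))\,dx-\lambda\right)\int_\Omega f(u(x))\varphi(x)\,dx$$ for every $\varphi\in H^s(\mathbb{R}^n)$ such that $\varphi=0$ a.e. in $\mathbb{R}^n\setminus\Omega$.
   Context: $|\Omega|$ denotes the Lebesgue measure of $\Omega$. For a function $F$ on $\mathbb{R}$, $\operatorname{osc}_{\xi\in\mathbb{R}}F(\xi):=\sup_{\xi\in\mathbb{R}}F(\xi)-\inf_{\xi\in\mathbb{R}}F(\xi)$. $H^s(\mathbb{R}^n)$ is the usual fractional Sobolev space of real-valued functions, with norm $\|g\|_{L^2(\mathbb{R}^n)}+\left(\int_{\mathbb{R}^n\times\mathbb{R}^n}\frac{|g(x)-g(y)|^2}{|x-y|^{n+2s}}\,dx\,dy\right)^{1/2}$. Functions are identified when equal a.e. *)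

theory Defs
  imports "HOL-Analysis.Analysis"
begin

(* Near each boundary point the set is, in suitable orthogonal coordinates, the strict epigraph
   of a Lipschitz function. The unit vector e is the "vertical" direction and
   x - (x \<bullet> e) *\<^sub>R e ranges over the hyperplane orthogonal to e. In dimension 1 this
   hyperplane is {0}. *)
definition lipschitz_boundary :: "(real ^ 'n) set \<Rightarrow> bool" where
  "lipschitz_boundary \<Omega> \<longleftrightarrow>
     (\<forall>p \<in> frontier \<Omega>. \<exists>e r L g. norm e = 1 \<and> 0 < r \<and> L-lipschitz_on {z. z \<bullet> e = 0} g \<and>
        \<Omega> \<inter> ball p r = {x \<in> ball p r. g (x - (x \<bullet> e) *\<^sub>R e) < x \<bullet> e})"

definition gagliardo_kernel :: "real \<Rightarrow> real ^ 'n \<Rightarrow> real ^ 'n \<Rightarrow> real" where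
  "gagliardo_kernel s x y = norm (x - y) powr (real CARD('n) + 2 * s)"

definition gagliardo_sq :: "real \<Rightarrow> (real ^ 'n \<Rightarrow> real) \<Rightarrow> real" where
  "gagliardo_sq s u = (LINT (x, y)|lebesgue. \<bar>u x - u y\<bar>\<^sup>2 / gagliardo_kernel s x y)"

definition gagliardo_form :: "real \<Rightarrow> (real ^ 'n \<Rightarrow> real) \<Rightarrow> (real ^ 'n \<Rightarrow> real) \<Rightarrow> real" where
  "gagliardo_form s u v =
     (LINT (x, y)|lebesgue. (u x - u y) * (v x - v y) / gagliardo_kernel s x y)"

(* Elements are representatives, not classes modulo a.e. equality. The second integrability
   condition is with respect to Lebesgue measure on the product R^n x R^n. *)
definition frac_sobolev :: "real \<Rightarrow> (real ^ 'n \<Rightarrow> real) set" where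
  "frac_sobolev s =
     {u \<in> borel_measurable lebesgue.
        integrable lebesgue (\<lambda>x. (u x)\<^sup>2) \<and>
        integrable lebesgue (\<lambda>(x, y). \<bar>u x - u y\<bar>\<^sup>2 / gagliardo_kernel s x y)}"

definition frac_sobolev0 :: "real \<Rightarrow> (real ^ 'n) set \<Rightarrow> (real ^ 'n \<Rightarrow> real) set" where
  "frac_sobolev0 s \<Omega> = {u \<in> frac_sobolev s. AE x in lebesgue. x \<notin> \<Omega> \<longrightarrow> u x = 0}"

definition primitive :: "(real \<Rightarrow> real) \<Rightarrow> real \<Rightarrow> real" where
  "primitive f \<xi> = (LBINT t=ereal 0..ereal \<xi>. f t)"

definition osc :: "(real \<Rightarrow> real) \<Rightarrow> real" where
  "osc F = (SUP \<xi>. F \<xi>) - (INF \<xi>. F \<xi>)"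

definition kirchhoff_weak_solution ::
  "real \<Rightarrow> (real ^ 'n) set \<Rightarrow> (real \<Rightarrow> real) \<Rightarrow> (real \<Rightarrow> real) \<Rightarrow> real \<Rightarrow> real \<Rightarrow> real \<Rightarrow> real \<Rightarrow>
     (real ^ 'n \<Rightarrow> real) \<Rightarrow> bool" where
  "kirchhoff_weak_solution s \<Omega> f h a b \<mu> lam u \<longleftrightarrow>
     (\<forall>\<phi> \<in> frac_sobolev0 s \<Omega>.
        (a + b * gagliardo_sq s u) * gagliardo_form s u \<phi> =
        \<mu> * h ((LINT x:\<Omega>|lebesgue. primitive f (u x)) - lam) *
          (LINT x:\<Omega>|lebesgue. f (u x) * \<phi> x))"

end

theory Submission
  imports Defs "HOL-Library.Function_Algebras" "HOL-Library.Diagonal_Subsequence"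
begin

text \<open>
  The problem is variational: weak solutions are the critical points of
  E(u) = a/2 N(u) + b/4 N(u)^2 - \<mu> H(\<Psi>(u) - \<lambda>), where N is the squared Gagliardo seminorm,
  \<Psi>(u) is the integral of F(u) over \<Omega>, and H is the primitive of h. As H vanishes only at 0 and
  is positive elsewhere, E is nonnegative on the level set \<Psi> = \<lambda>. Choose v with \<Psi>(v) \<noteq> 0 and
  let \<lambda> range over the middle third of the interval between 0 = \<Psi>(0) and \<Psi>(v): for large \<mu> the
  energy is negative at both 0 and v, which lie on different sides of the level set. Minimizing E on either
  side gives two solutions of negative energy, and the mountain pass level between 0 and v gives
  a third one of nonnegative energy. All bounds are uniform in \<lambda>, whence \<rho>.

  Subcritical growth makes the gradient of E uniformly continuous on bounded sets, so that
  one explicit Euler step suffices as a deformation in the mountain pass argument.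
\<close>

section \<open>Mountain pass theorem\<close>

text \<open>Functions are representatives and not classes, so \<open>B\<close> is only positive
  semidefinite and no completeness is available beforehand. Weak convergence is avoided: existence
  rests on two properties of \<open>Q\<close>, namely that \<open>B\<close>-bounded sequences have
  \<open>Q\<close>-convergent subsequences and that \<open>B u u\<close> is lower semicontinuous
  along \<open>B\<close>-bounded, \<open>Q\<close>-convergent sequences. They yield the minimizers,
  and also completeness, from which Riesz representation supplies the gradient needed for the Euler
  step. Continuity of \<open>D\<close> in \<open>Q\<close> on bounded sets makes the nonlinear part
  of the gradient compact; the linear part carries a factor of at least \<open>a > 0\<close>, and
  together they give convergence of almost critical sequences. The other obstacle is that
  \<open>h\<close> is given only on an open interval and may be unbounded near its ends. Keeping
  \<lambda> away from the extreme values of \<Psi> confines \<Psi>(u) - \<lambda> to a compact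
  subinterval, uniformly in u. Boundedness of F makes \<Psi>, and with it the part of E involving H,
  bounded, which is why E is coercive.\<close>

locale semi_inner_space =
  fixes V :: "'v::real_vector set" and B :: "'v \<Rightarrow> 'v \<Rightarrow> real"
  assumes subspace_V: "subspace V"
    and B_add: "\<lbrakk>u \<in> V; v \<in> V; w \<in> V\<rbrakk> \<Longrightarrow> B (u + v) w = B u w + B v w"
    and B_scale: "\<lbrakk>u \<in> V; w \<in> V\<rbrakk> \<Longrightarrow> B (c *\<^sub>R u) w = c * B u w"
    and B_sym: "B u w = B w u"
    and B_nonneg: "0 \<le> B u u"
begin

definition nm :: "'v \<Rightarrow> real" where "nm u = sqrt (B u u)"

lemma V_intros [simp, intro]:
  shows "0 \<in> V" "u \<in> V \<Longrightarrow> v \<in> V \<Longrightarrow> u + v \<in> V" "u \<in> V \<Longrightarrow> v \<in> V \<Longrightarrow> u - v \<in> V"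
    "u \<in> V \<Longrightarrow> c *\<^sub>R u \<in> V" "u \<in> V \<Longrightarrow> - u \<in> V"
  using subspace_V by (auto intro: subspace_0 subspace_add subspace_diff subspace_scale subspace_neg)

lemma B_minus: "u \<in> V \<Longrightarrow> w \<in> V \<Longrightarrow> B (- u) w = - B u w"
  using B_scale[of u w "-1"] by simp

lemma B_diff: "\<lbrakk>u \<in> V; v \<in> V; w \<in> V\<rbrakk> \<Longrightarrow> B (u - v) w = B u w - B v w"
  using B_add[of u "- v" w] B_minus[of v w] by simp

lemma B_add2: "\<lbrakk>u \<in> V; v \<in> V; w \<in> V\<rbrakk> \<Longrightarrow> B w (u + v) = B w u + B w v"
  using B_add by (simp add: B_sym[of w])

lemma B_diff2: "\<lbrakk>u \<in> V; v \<in> V; w \<in> V\<rbrakk> \<Longrightarrow> B w (u - v) = B w u - B w v"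
  using B_diff by (simp add: B_sym[of w])

lemma B_scale2: "\<lbrakk>u \<in> V; w \<in> V\<rbrakk> \<Longrightarrow> B w (c *\<^sub>R u) = c * B w u"
  using B_scale by (simp add: B_sym[of w])

lemma B_minus2: "u \<in> V \<Longrightarrow> w \<in> V \<Longrightarrow> B w (- u) = - B w u"
  using B_minus by (simp add: B_sym[of w])

lemmas B_bilinear = B_add B_diff B_scale B_minus B_add2 B_diff2 B_scale2 B_minus2

lemma B_add_scale_self:
  "u \<in> V \<Longrightarrow> w \<in> V \<Longrightarrow> B (u + t *\<^sub>R w) (u + t *\<^sub>R w) = B u u + 2 * t * B u w + t\<^sup>2 * B w w"
  using B_sym[of u w] by (simp add: B_bilinear algebra_simps power2_eq_square)

lemma nm_nonneg [simp]: "0 \<le> nm u"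
  by (simp add: nm_def B_nonneg)

lemma nm_sq: "(nm u)\<^sup>2 = B u u"
  by (simp add: nm_def B_nonneg)

lemma cauchy_schwarz:
  assumes "u \<in> V" "w \<in> V"
  shows "\<bar>B u w\<bar> \<le> nm u * nm w"
proof -
  have quad: "0 \<le> B u u + 2 * t * B u w + t\<^sup>2 * B w w" for t
    using B_nonneg[of "u + t *\<^sub>R w"] B_add_scale_self[OF assms] by simp
  have "(B u w)\<^sup>2 \<le> B u u * B w w"
  proof (cases "B w w = 0")
    case True
    have "B u w = 0"
    proof (rule ccontr)
      \<comment> \<open>With \<open>B w w = 0\<close> the quadratic is affine in \<open>t\<close>;
        the chosen \<open>t\<close> gives it the value -1.\<close>
      assume ne: "B u w \<noteq> 0"
      have "2 * (- (B u u + 1) / (2 * B u w)) * B u w = - (B u u + 1)"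
        using ne by (simp add: field_simps)
      then show False using quad[of "- (B u u + 1) / (2 * B u w)"] True by simp
    qed
    then show ?thesis using True by simp
  next
    case False
    then have pos: "B w w > 0" using B_nonneg[of w] by simp
    have "B u u + 2 * (- B u w / B w w) * B u w + (- B u w / B w w)\<^sup>2 * B w w = B u u - (B u w)\<^sup>2 / B w w"
      using False by (simp add: power2_eq_square)
    then have "0 \<le> B u u - (B u w)\<^sup>2 / B w w" using quad[of "- B u w / B w w"] by simp
    then show ?thesis using pos by (simp add: field_simps)
  qed
  then have "(B u w)\<^sup>2 \<le> (nm u * nm w)\<^sup>2" by (simp add: power_mult_distrib nm_sq)
  then show ?thesis by (metis abs_le_square_iff abs_of_nonneg mult_nonneg_nonneg nm_nonneg)
qed

lemma nm_scale: "u \<in> V \<Longrightarrow> nm (c *\<^sub>R u) = \<bar>c\<bar> * nm u"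
  by (simp add: nm_def B_bilinear real_sqrt_mult flip: mult.assoc)

lemma nm_minus: "u \<in> V \<Longrightarrow> nm (- u) = nm u"
  using nm_scale[of u "-1"] by simp

lemma nm_minus_commute: "u \<in> V \<Longrightarrow> v \<in> V \<Longrightarrow> nm (u - v) = nm (v - u)"
  using nm_minus[of "u - v"] by simp

lemma nm_zero [simp]: "nm 0 = 0"
  using nm_scale[of 0 0] by simp

lemma nm_triangle:
  assumes "u \<in> V" "v \<in> V"
  shows "nm (u + v) \<le> nm u + nm v"
proof -
  have "(nm (u + v))\<^sup>2 = B u u + 2 * B u v + B v v"
    using B_add_scale_self[OF assms, of 1] by (simp add: nm_sq)
  also have "\<dots> \<le> (nm u)\<^sup>2 + 2 * (nm u * nm v) + (nm v)\<^sup>2"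
    using cauchy_schwarz[OF assms] by (simp add: nm_sq)
  also have "\<dots> = (nm u + nm v)\<^sup>2" by (simp add: power2_eq_square algebra_simps)
  finally show ?thesis by (rule power2_le_imp_le) simp
qed

lemma nm_triangle_diff:
  assumes "u \<in> V" "v \<in> V"
  shows "nm (u - v) \<le> nm u + nm v"
  using nm_triangle[of u "- v"] assms by (simp add: nm_minus)

lemma nm_triangle_rev:
  assumes "u \<in> V" "v \<in> V"
  shows "\<bar>nm u - nm v\<bar> \<le> nm (u - v)"
  using nm_triangle[of "u - v" v] nm_triangle[of "v - u" u] nm_minus_commute[of u v] assms by simp

text \<open>Vectors of seminorm zero cannot be normalized; all their multiples lie in the unit ball,
  so boundedness there forces \<open>L u = 0\<close>. All other vectors are rescaled.\<close>

lemma linear_bound: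
  assumes add: "\<And>c u. u \<in> V \<Longrightarrow> L (c *\<^sub>R u) = c * L u"
    and bound: "\<And>u. u \<in> V \<Longrightarrow> B u u \<le> 1 \<Longrightarrow> \<bar>L u\<bar> \<le> C" and "u \<in> V"
  shows "\<bar>L u\<bar> \<le> C * nm u"
proof (cases "nm u = 0")
  case True
  then have z: "B u u = 0" using nm_sq[of u] by simp
  have *: "\<bar>t\<bar> * \<bar>L u\<bar> \<le> C" for t
    using bound[of "t *\<^sub>R u"] add[of u t] \<open>u \<in> V\<close> z by (simp add: B_bilinear abs_mult)
  have "L u = 0"
  proof (rule ccontr)
    assume "L u \<noteq> 0"
    then show False using *[of "(\<bar>C\<bar> + 1) / \<bar>L u\<bar>"] by (simp add: abs_mult)
  qed
  then show ?thesis using True by simp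
next
  case False
  then have pos: "nm u > 0" using nm_nonneg[of u] by linarith
  have "B ((1 / nm u) *\<^sub>R u) ((1 / nm u) *\<^sub>R u) = (1 / nm u)\<^sup>2 * (nm u)\<^sup>2"
    unfolding nm_sq using \<open>u \<in> V\<close> by (simp add: B_bilinear power2_eq_square)
  also have "\<dots> = 1" using pos by (simp add: power_divide)
  finally have "\<bar>L ((1 / nm u) *\<^sub>R u)\<bar> \<le> C"
    using bound[of "(1 / nm u) *\<^sub>R u"] pos \<open>u \<in> V\<close> by simp
  then show ?thesis using add[of u "1 / nm u"] pos \<open>u \<in> V\<close> by (simp add: abs_mult field_simps)
qed

text \<open>Continuity is spelled out through \<open>nm\<close> because the type \<open>'v\<close>
  carries no topology.\<close>

definition nm_path :: "(real \<Rightarrow> 'v) \<Rightarrow> 'v \<Rightarrow> 'v \<Rightarrow> bool" where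
  "nm_path \<gamma> p q \<longleftrightarrow> \<gamma> 0 = p \<and> \<gamma> 1 = q \<and>
     (\<forall>t\<in>{0..1}. \<gamma> t \<in> V \<and> ((\<lambda>x. nm (\<gamma> x - \<gamma> t)) \<longlongrightarrow> 0) (at t within {0..1}))"

lemma nm_path_line:
  assumes "p \<in> V" "q \<in> V"
  shows "nm_path (\<lambda>t. p + t *\<^sub>R (q - p)) p q"
proof -
  have "((\<lambda>x. nm (p + x *\<^sub>R (q - p) - (p + t *\<^sub>R (q - p)))) \<longlongrightarrow> 0) (at t within {0..1})" for t
  proof -
    have "nm (p + x *\<^sub>R (q - p) - (p + t *\<^sub>R (q - p))) = \<bar>x - t\<bar> * nm (q - p)" for x
      using nm_scale[of "q - p" "x - t"] assms by (simp add: scaleR_left_diff_distrib)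
    moreover have "((\<lambda>x. \<bar>x - t\<bar> * nm (q - p)) \<longlongrightarrow> \<bar>t - t\<bar> * nm (q - p)) (at t within {0..1})"
      by (intro tendsto_intros)
    ultimately show ?thesis by simp
  qed
  then show ?thesis using assms by (auto simp: nm_path_def)
qed

end

section \<open>Functionals whose gradient is uniformly continuous on bounded sets\<close>

locale differentiable_functional = semi_inner_space V B
  for V :: "'v::real_vector set" and B +
  fixes J :: "'v \<Rightarrow> real" and G :: "'v \<Rightarrow> 'v"
  assumes G_in [simp, intro]: "u \<in> V \<Longrightarrow> G u \<in> V"
    and J_deriv: "u \<in> V \<Longrightarrow> w \<in> V \<Longrightarrow>
      ((\<lambda>t. J (u + t *\<^sub>R w)) has_real_derivative B (G u) w) (at 0)"
    and G_uc: "e > 0 \<Longrightarrow> \<exists>d>0. \<forall>u\<in>V. \<forall>v\<in>V. nm u \<le> R \<longrightarrow> nm v \<le> R \<longrightarrow> nm (u - v) \<le> d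
      \<longrightarrow> nm (G u - G v) \<le> e"
    and G_bdd: "\<exists>C. \<forall>u\<in>V. nm u \<le> R \<longrightarrow> nm (G u) \<le> C"
begin

lemma J_mvt:
  assumes "u \<in> V" "w \<in> V"
  obtains \<theta> where "0 < \<theta>" "\<theta> < 1" "J (u + w) - J u = B (G (u + \<theta> *\<^sub>R w)) w"
proof -
  have "((\<lambda>t. J (u + t *\<^sub>R w)) has_real_derivative B (G (u + t *\<^sub>R w)) w) (at t)" for t
  proof -
    have "((\<lambda>s. J ((u + t *\<^sub>R w) + s *\<^sub>R w)) has_real_derivative B (G (u + t *\<^sub>R w)) w) (at 0)"
      using assms by (intro J_deriv) auto
    then have "((\<lambda>s. J (u + (s + t) *\<^sub>R w)) has_real_derivative B (G (u + t *\<^sub>R w)) w) (at 0)"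
      by (simp add: scaleR_add_left add_ac)
    then show ?thesis
      using DERIV_shift[of "\<lambda>t. J (u + t *\<^sub>R w)" _ 0 t] by simp
  qed
  then obtain z where "0 < z" "z < 1"
    "J (u + 1 *\<^sub>R w) - J (u + 0 *\<^sub>R w) = (1 - 0) * B (G (u + z *\<^sub>R w)) w"
    using MVT2[of 0 1 "\<lambda>t. J (u + t *\<^sub>R w)" "\<lambda>t. B (G (u + t *\<^sub>R w)) w"] by auto
  then show ?thesis using that by simp
qed

lemma J_lipschitz:
  "\<exists>C. \<forall>u\<in>V. \<forall>v\<in>V. nm u \<le> R \<longrightarrow> nm v \<le> R \<longrightarrow> \<bar>J u - J v\<bar> \<le> C * nm (u - v)"
proof -
  \<comment> \<open>The radius \<open>3 * R\<close> covers the whole segment: \<open>v\<close> has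
    norm at most \<open>R\<close> and \<open>u - v\<close> at most \<open>2 * R\<close>.\<close>
  obtain C where C: "\<And>u. u \<in> V \<Longrightarrow> nm u \<le> 3 * R \<Longrightarrow> nm (G u) \<le> C" using G_bdd[of "3*R"] by blast
  have "\<bar>J u - J v\<bar> \<le> C * nm (u - v)" if "u \<in> V" "v \<in> V" "nm u \<le> R" "nm v \<le> R" for u v
  proof -
    have "v \<in> V" "u - v \<in> V" using that by auto
    then obtain \<theta> where th: "0 < \<theta>" "\<theta> < 1" "J (v + (u - v)) - J v = B (G (v + \<theta> *\<^sub>R (u - v))) (u - v)"
      by (rule J_mvt)
    have "nm (\<theta> *\<^sub>R (u - v)) \<le> nm (u - v)"
      using th(1,2) that by (simp add: nm_scale mult_left_le_one_le)
    also have "\<dots> \<le> 2 * R" using nm_triangle_diff[of u v] that by simp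
    finally have "nm (v + \<theta> *\<^sub>R (u - v)) \<le> 3 * R"
      using nm_triangle[of v "\<theta> *\<^sub>R (u - v)"] that by simp
    then have "nm (G (v + \<theta> *\<^sub>R (u - v))) \<le> C" using C that by simp
    moreover have "\<bar>J u - J v\<bar> \<le> nm (G (v + \<theta> *\<^sub>R (u - v))) * nm (u - v)"
      using cauchy_schwarz[of "G (v + \<theta> *\<^sub>R (u - v))" "u - v"] that th(3)
      by (metis G_in V_intros(2-4) diff_add_cancel add.commute)
    ultimately show ?thesis by (meson mult_right_mono nm_nonneg order_trans)
  qed
  then show ?thesis by blast
qed

lemma nm_path_eventually_bounded:
  assumes "((\<lambda>x. nm (\<gamma> x - \<gamma> t)) \<longlongrightarrow> 0) (at t within S)" "\<forall>x\<in>S. \<gamma> x \<in> V" "t \<in> S"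
  shows "eventually (\<lambda>x. \<gamma> x \<in> V \<and> nm (\<gamma> x) \<le> nm (\<gamma> t) + 1) (at t within S)"
proof -
  have "eventually (\<lambda>x. nm (\<gamma> x - \<gamma> t) < 1) (at t within S)"
    using assms(1) by (rule order_tendstoD) simp
  moreover have "eventually (\<lambda>x. x \<in> S) (at t within S)" by (simp add: eventually_at_filter)
  ultimately show ?thesis
  proof eventually_elim
    case (elim x)
    then have "\<gamma> x \<in> V" "\<gamma> t \<in> V" using assms(2,3) by blast+
    with elim nm_triangle_rev[of "\<gamma> x" "\<gamma> t"] show ?case by linarith
  qed
qed

lemma J_continuous_path:
  assumes "((\<lambda>x. nm (\<gamma> x - \<gamma> t)) \<longlongrightarrow> 0) (at t within S)" "\<forall>x\<in>S. \<gamma> x \<in> V" "t \<in> S"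
  shows "((\<lambda>x. J (\<gamma> x)) \<longlongrightarrow> J (\<gamma> t)) (at t within S)"
proof -
  obtain C where C: "\<And>u v. u \<in> V \<Longrightarrow> v \<in> V \<Longrightarrow> nm u \<le> nm (\<gamma> t) + 1 \<Longrightarrow> nm v \<le> nm (\<gamma> t) + 1 \<Longrightarrow>
      \<bar>J u - J v\<bar> \<le> C * nm (u - v)"
    using J_lipschitz[of "nm (\<gamma> t) + 1"] by blast
  have "eventually (\<lambda>x. norm (J (\<gamma> x) - J (\<gamma> t)) \<le> C * nm (\<gamma> x - \<gamma> t)) (at t within S)"
    using nm_path_eventually_bounded[OF assms]
    unfolding real_norm_def
  proof eventually_elim
    case (elim x)
    then show ?case using assms(2,3) by (intro C) auto
  qed
  moreover have "((\<lambda>x. C * nm (\<gamma> x - \<gamma> t)) \<longlongrightarrow> C * 0) (at t within S)"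
    by (intro tendsto_intros assms(1))
  then have "((\<lambda>x. C * nm (\<gamma> x - \<gamma> t)) \<longlongrightarrow> 0) (at t within S)" by simp
  ultimately have "((\<lambda>x. J (\<gamma> x) - J (\<gamma> t)) \<longlongrightarrow> 0) (at t within S)"
    by (rule Lim_null_comparison)
  then show ?thesis by (simp add: LIM_zero_iff)
qed

lemma G_continuous_path:
  assumes "((\<lambda>x. nm (\<gamma> x - \<gamma> t)) \<longlongrightarrow> 0) (at t within S)" "\<forall>x\<in>S. \<gamma> x \<in> V" "t \<in> S"
  shows "((\<lambda>x. nm (G (\<gamma> x) - G (\<gamma> t))) \<longlongrightarrow> 0) (at t within S)"
proof (rule tendstoI)
  fix e :: real assume "e > 0"
  then obtain d where d: "d > 0" "\<And>u v. u \<in> V \<Longrightarrow> v \<in> V \<Longrightarrow> nm u \<le> nm (\<gamma> t) + 1 \<Longrightarrow>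
      nm v \<le> nm (\<gamma> t) + 1 \<Longrightarrow> nm (u - v) \<le> d \<Longrightarrow> nm (G u - G v) \<le> e / 2"
    using G_uc[of "e/2" "nm (\<gamma> t) + 1"] by auto
  have "eventually (\<lambda>x. nm (\<gamma> x - \<gamma> t) < d) (at t within S)"
    using assms(1) d(1) by (rule order_tendstoD)
  with nm_path_eventually_bounded[OF assms]
  show "eventually (\<lambda>x. dist (nm (G (\<gamma> x) - G (\<gamma> t))) 0 < e) (at t within S)"
  proof eventually_elim
    case (elim x)
    then have "nm (G (\<gamma> x) - G (\<gamma> t)) \<le> e / 2" using assms(2,3) by (intro d(2)) auto
    then show ?case using \<open>e > 0\<close> by (simp add: dist_real_def)
  qed
qed

text \<open>The step length depends on the point only through its energy, so it is continuous along
  the path; that it vanishes at the energies of \<open>p\<close> and \<open>q\<close> keeps the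
  endpoints fixed.\<close>

lemma nm_path_euler_step:
  assumes "nm_path \<gamma> p q" "continuous_on UNIV \<theta>" "\<theta> (J p) = 0" "\<theta> (J q) = 0"
  shows "nm_path (\<lambda>t. \<gamma> t - \<theta> (J (\<gamma> t)) *\<^sub>R G (\<gamma> t)) p q"
proof -
  have \<gamma>: "\<gamma> 0 = p" "\<gamma> 1 = q" "\<And>t. t \<in> {0..1} \<Longrightarrow> \<gamma> t \<in> V"
    "\<And>t. t \<in> {0..1} \<Longrightarrow> ((\<lambda>x. nm (\<gamma> x - \<gamma> t)) \<longlongrightarrow> 0) (at t within {0..1})"
    using assms(1) by (auto simp: nm_path_def)
  have "((\<lambda>x. nm ((\<gamma> x - \<theta> (J (\<gamma> x)) *\<^sub>R G (\<gamma> x)) - (\<gamma> t - \<theta> (J (\<gamma> t)) *\<^sub>R G (\<gamma> t)))) \<longlongrightarrow> 0) (at t within {0..1})"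
    if t: "t \<in> {0..1}" for t
  proof (rule Lim_null_comparison)
    let ?r = "\<lambda>x. \<theta> (J (\<gamma> x))"
    let ?F = "at t within {0..1::real}"
    have "eventually (\<lambda>x. x \<in> {0..1}) ?F" by (simp add: eventually_at_filter)
    then show "eventually (\<lambda>x. norm (nm ((\<gamma> x - ?r x *\<^sub>R G (\<gamma> x)) - (\<gamma> t - ?r t *\<^sub>R G (\<gamma> t))))
        \<le> nm (\<gamma> x - \<gamma> t) + \<bar>?r x\<bar> * nm (G (\<gamma> x) - G (\<gamma> t)) + \<bar>?r x - ?r t\<bar> * nm (G (\<gamma> t))) ?F"
    proof eventually_elim
      case (elim x)
      have in_V: "\<gamma> x \<in> V" "\<gamma> t \<in> V" using \<gamma> elim t by auto
      have "(\<gamma> x - ?r x *\<^sub>R G (\<gamma> x)) - (\<gamma> t - ?r t *\<^sub>R G (\<gamma> t)) =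
          (\<gamma> x - \<gamma> t) - (?r x *\<^sub>R (G (\<gamma> x) - G (\<gamma> t)) + (?r x - ?r t) *\<^sub>R G (\<gamma> t))"
        by (simp add: algebra_simps)
      also have "nm \<dots> \<le> nm (\<gamma> x - \<gamma> t) + nm (?r x *\<^sub>R (G (\<gamma> x) - G (\<gamma> t)) + (?r x - ?r t) *\<^sub>R G (\<gamma> t))"
        using in_V by (intro nm_triangle_diff) auto
      also have "nm (?r x *\<^sub>R (G (\<gamma> x) - G (\<gamma> t)) + (?r x - ?r t) *\<^sub>R G (\<gamma> t)) \<le>
         nm (?r x *\<^sub>R (G (\<gamma> x) - G (\<gamma> t))) + nm ((?r x - ?r t) *\<^sub>R G (\<gamma> t))"
        using in_V by (intro nm_triangle) auto
      finally show ?case using in_V by (simp add: nm_scale)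
    qed
    have "isCont \<theta> (J (\<gamma> t))" using assms(2) by (simp add: continuous_on_eq_continuous_at)
    then have r: "(?r \<longlongrightarrow> ?r t) ?F"
      by (rule isCont_tendsto_compose) (rule J_continuous_path[OF \<gamma>(4)[OF t] _ t], use \<gamma>(3) in blast)
    have Gc: "((\<lambda>x. nm (G (\<gamma> x) - G (\<gamma> t))) \<longlongrightarrow> 0) ?F"
      by (rule G_continuous_path[OF \<gamma>(4)[OF t] _ t]) (use \<gamma>(3) in blast)
    have "((\<lambda>x. nm (\<gamma> x - \<gamma> t) + \<bar>?r x\<bar> * nm (G (\<gamma> x) - G (\<gamma> t)) + \<bar>?r x - ?r t\<bar> * nm (G (\<gamma> t)))
       \<longlongrightarrow> 0 + \<bar>?r t\<bar> * 0 + \<bar>?r t - ?r t\<bar> * nm (G (\<gamma> t))) ?F"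
      by (intro tendsto_intros r \<gamma>(4)[OF t] Gc)
    then show "((\<lambda>x. nm (\<gamma> x - \<gamma> t) + \<bar>?r x\<bar> * nm (G (\<gamma> x) - G (\<gamma> t)) + \<bar>?r x - ?r t\<bar> * nm (G (\<gamma> t)))
       \<longlongrightarrow> 0) ?F" by simp
  qed
  then show ?thesis using \<gamma> assms by (auto simp: nm_path_def)
qed

text \<open>By the mean value theorem the change of \<open>J\<close> is governed by the gradient at
  an intermediate point. The step moves by at most \<open>min 1 d\<close>: the 1 keeps that point in
  the ball of radius \<open>R + 1\<close>, and \<open>d\<close> keeps its gradient within
  \<open>\<eta> / 2\<close> of \<open>G u\<close>, so that half of the expected decrease
  survives.\<close>

lemma euler_step_descent:
  assumes "\<eta> > 0"
  obtains \<epsilon> where "\<epsilon> > 0" "\<And>u \<tau>. u \<in> V \<Longrightarrow> nm u \<le> R \<Longrightarrow> \<eta> \<le> nm (G u) \<Longrightarrow> 0 \<le> \<tau> \<Longrightarrow> \<tau> \<le> \<epsilon> \<Longrightarrow>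
    J (u - \<tau> *\<^sub>R G u) \<le> J u - \<tau> * \<eta>\<^sup>2 / 2"
proof -
  obtain C0 where "\<And>u. u \<in> V \<Longrightarrow> nm u \<le> R \<Longrightarrow> nm (G u) \<le> C0" using G_bdd[of R] by blast
  then obtain C where C: "C > 0" "\<And>u. u \<in> V \<Longrightarrow> nm u \<le> R \<Longrightarrow> nm (G u) \<le> C"
    by (metis less_max_iff_disj max.coboundedI1 zero_less_one)
  obtain d where d: "d > 0" "\<And>u v. u \<in> V \<Longrightarrow> v \<in> V \<Longrightarrow> nm u \<le> R + 1 \<Longrightarrow> nm v \<le> R + 1 \<Longrightarrow>
      nm (u - v) \<le> d \<Longrightarrow> nm (G u - G v) \<le> \<eta> / 2"
    using G_uc[of "\<eta>/2" "R + 1"] assms by auto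
  define \<epsilon> where "\<epsilon> = min 1 d / C"
  have \<epsilon>: "\<epsilon> > 0" "\<epsilon> * C \<le> 1" "\<epsilon> * C \<le> d" using C d by (auto simp: \<epsilon>_def)
  have "J (u - \<tau> *\<^sub>R G u) \<le> J u - \<tau> * \<eta>\<^sup>2 / 2"
    if u: "u \<in> V" "nm u \<le> R" "\<eta> \<le> nm (G u)" and \<tau>: "0 \<le> \<tau>" "\<tau> \<le> \<epsilon>" for u \<tau>
  proof -
    obtain \<theta> where th: "0 < \<theta>" "\<theta> < 1"
      "J (u + (- \<tau>) *\<^sub>R G u) - J u = B (G (u + \<theta> *\<^sub>R (- \<tau>) *\<^sub>R G u)) ((- \<tau>) *\<^sub>R G u)"
      using J_mvt[of u "(- \<tau>) *\<^sub>R G u"] u by auto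
    define v where "v = u + \<theta> *\<^sub>R (- \<tau>) *\<^sub>R G u"
    have v: "v \<in> V" using u by (auto simp: v_def)
    have "nm (v - u) = (\<theta> * \<tau>) * nm (G u)" using th \<tau> u by (simp add: v_def nm_minus nm_scale)
    also have "\<dots> \<le> (1 * \<epsilon>) * C"
      using th \<tau> u C \<epsilon>(1) by (intro mult_mono) auto
    finally have vu: "nm (v - u) \<le> \<epsilon> * C" by simp
    then have "nm (v - u) \<le> d" "nm v \<le> R + 1"
      using \<epsilon> nm_triangle[of "v - u" u] u v by auto
    then have close: "nm (G v - G u) \<le> \<eta> / 2" using d(2)[of v u] u v by simp
    have "- B (G v) (G u) = - B (G u) (G u) + B (G u - G v) (G u)"
      using u v by (simp add: B_bilinear)
    also have "\<dots> \<le> - (nm (G u))\<^sup>2 + nm (G v - G u) * nm (G u)"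
      using cauchy_schwarz[of "G u - G v" "G u"] nm_minus_commute[of "G u" "G v"] u v by (simp add: nm_sq)
    also have "\<dots> \<le> - (nm (G u))\<^sup>2 + \<eta> / 2 * nm (G u)"
      using close by (intro add_left_mono mult_right_mono) auto
    also have "\<dots> = - (nm (G u) * (nm (G u) - \<eta> / 2))" by (simp add: power2_eq_square algebra_simps)
    also have "\<dots> \<le> - (\<eta> * (\<eta> / 2))"
      using u assms by (intro le_imp_neg_le mult_mono) auto
    finally have "\<tau> * (- B (G v) (G u)) \<le> \<tau> * (- (\<eta> * (\<eta> / 2)))"
      using \<tau> by (intro mult_left_mono)
    moreover have "J (u - \<tau> *\<^sub>R G u) - J u = \<tau> * (- B (G v) (G u))"
      using th(3)[folded v_def] u v by (simp add: B_bilinear)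
    ultimately show ?thesis by (simp add: power2_eq_square)
  qed
  then show ?thesis using that \<epsilon> by blast
qed

text \<open>Uniform continuity of the gradient replaces the pseudo-gradient flow of the usual deformation
  lemma by a single Euler step.\<close>

theorem mountain_pass:
  assumes coercive: "\<And>c. \<exists>R. \<forall>u\<in>V. J u \<le> c \<longrightarrow> nm u \<le> R"
    and pq: "p \<in> V" "q \<in> V" "J p < \<alpha>" "J q < \<alpha>"
    and line: "\<And>t. 0 \<le> t \<Longrightarrow> t \<le> 1 \<Longrightarrow> J (p + t *\<^sub>R (q - p)) \<le> M"
    and sep: "\<And>\<gamma>. nm_path \<gamma> p q \<Longrightarrow> \<exists>t\<in>{0..1}. \<alpha> \<le> J (\<gamma> t)"
  obtains c where "\<alpha> \<le> c" "c \<le> M" "\<And>\<eta>. \<eta> > 0 \<Longrightarrow> \<exists>w\<in>V. \<bar>J w - c\<bar> \<le> \<eta> \<and> nm (G w) \<le> \<eta>"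
proof -
  \<comment> \<open>\<open>S\<close> collects upper bounds of the energy along admissible paths; its
    infimum is the minimax level, without maxima along single paths having to be formed.\<close>
  define S where "S = {c. \<exists>\<gamma>. nm_path \<gamma> p q \<and> (\<forall>t\<in>{0..1}. J (\<gamma> t) \<le> c)}"
  define c where "c = Inf S"
  have M: "M \<in> S" using nm_path_line[OF pq(1,2)] line by (auto simp: S_def)
  have lower: "\<alpha> \<le> x" if "x \<in> S" for x using that sep by (force simp: S_def)
  then have bdd: "bdd_below S" by (auto simp: bdd_below_def)
  have "\<exists>w\<in>V. \<bar>J w - c\<bar> \<le> \<eta>0 \<and> nm (G w) \<le> \<eta>0" if "\<eta>0 > 0" for \<eta>0
  proof (rule ccontr)
    assume contra: "\<not> (\<exists>w\<in>V. \<bar>J w - c\<bar> \<le> \<eta>0 \<and> nm (G w) \<le> \<eta>0)"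
    have "\<alpha> \<le> c" unfolding c_def using M lower by (intro cInf_greatest) auto
    then have cpos: "c - max (J p) (J q) > 0" using pq by auto
    \<comment> \<open>Capped by the gap between \<open>c\<close> and the energies of the endpoints,
      so that a cut-off vanishing below \<open>c - \<eta>\<close> does not move the
      endpoints.\<close>
    define \<eta> where "\<eta> = min \<eta>0 (c - max (J p) (J q))"
    have \<eta>: "\<eta> > 0" "\<eta> \<le> \<eta>0" "J p \<le> c - \<eta>" "J q \<le> c - \<eta>" using that cpos by (auto simp: \<eta>_def)
    have no: "\<eta> \<le> nm (G w)" if "w \<in> V" "\<bar>J w - c\<bar> \<le> \<eta>" for w
      using contra that \<eta> by force
    obtain R where R: "\<And>u. u \<in> V \<Longrightarrow> J u \<le> c + \<eta> \<Longrightarrow> nm u \<le> R" using coercive by blast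
    obtain \<epsilon> where \<epsilon>: "\<epsilon> > 0" "\<And>u \<tau>. u \<in> V \<Longrightarrow> nm u \<le> R \<Longrightarrow> \<eta> \<le> nm (G u) \<Longrightarrow> 0 \<le> \<tau> \<Longrightarrow> \<tau> \<le> \<epsilon> \<Longrightarrow>
       J (u - \<tau> *\<^sub>R G u) \<le> J u - \<tau> * \<eta>\<^sup>2 / 2"
      using euler_step_descent[OF \<eta>(1), of R] by metis
    \<comment> \<open>A full step gains \<open>\<epsilon> * \<eta>\<^sup>2 / 2\<close>; starting
      with an excess of at most half of this over \<open>c\<close> leaves a net decrease below
      \<open>c\<close>.\<close>
    define \<kappa> where "\<kappa> = min \<eta> (\<epsilon> * \<eta>\<^sup>2 / 4)"
    have \<kappa>: "\<kappa> > 0" using \<eta> \<epsilon> by (simp add: \<kappa>_def)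
    then obtain x where x: "x \<in> S" "x < c + \<kappa>" unfolding c_def
      using cInf_lessD[of S "Inf S + \<kappa>"] M by auto
    then obtain \<gamma> where \<gamma>: "nm_path \<gamma> p q" "\<And>t. t \<in> {0..1} \<Longrightarrow> J (\<gamma> t) \<le> c + \<kappa>"
      by (force simp: S_def)
    \<comment> \<open>No step below the energy \<open>c - \<eta>\<close>, a full step of length
      \<open>\<epsilon>\<close> above \<open>c - \<eta> / 2\<close>, linear in between.\<close>
    define \<theta> where "\<theta> y = \<epsilon> * max 0 (min 1 ((y - (c - \<eta>)) / (\<eta> / 2)))" for y
    have \<theta>: "0 \<le> \<theta> y" "\<theta> y \<le> \<epsilon>" for y using \<epsilon>(1) by (auto simp: \<theta>_def mult_left_le)
    have \<theta>0: "\<theta> y = 0" if "y \<le> c - \<eta>" for y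
      using that \<eta> by (auto simp: \<theta>_def max_def min_def divide_simps)
    have \<theta>1: "\<theta> y = \<epsilon>" if "c - \<eta> / 2 \<le> y" for y
      using that \<eta> by (auto simp: \<theta>_def max_def min_def divide_simps)
    have "continuous_on UNIV \<theta>" unfolding \<theta>_def by (intro continuous_intros) (use \<eta> in auto)
    then have path: "nm_path (\<lambda>t. \<gamma> t - \<theta> (J (\<gamma> t)) *\<^sub>R G (\<gamma> t)) p q"
      using \<gamma>(1) \<eta> \<theta>0 by (intro nm_path_euler_step) auto
    \<comment> \<open>The two terms of the minimum belong to points that are already below
      \<open>c - \<eta> / 2\<close> and to points that make a full step.\<close>
    define c' where "c' = c - min (\<eta> / 2) (\<epsilon> * \<eta>\<^sup>2 / 4)"
    have "J (\<gamma> t - \<theta> (J (\<gamma> t)) *\<^sub>R G (\<gamma> t)) \<le> c'" if t: "t \<in> {0..1}" for t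
    proof (cases "J (\<gamma> t) \<le> c - \<eta>")
      case True
      then show ?thesis using \<theta>0[OF True] \<eta>(1) by (simp add: c'_def)
    next
      case False
      have in_V: "\<gamma> t \<in> V" using \<gamma>(1) t by (auto simp: nm_path_def)
      have "\<bar>J (\<gamma> t) - c\<bar> \<le> \<eta>" "J (\<gamma> t) \<le> c + \<eta>" using False \<gamma>(2)[OF t] by (auto simp: \<kappa>_def)
      then have le: "J (\<gamma> t - \<theta> (J (\<gamma> t)) *\<^sub>R G (\<gamma> t)) \<le> J (\<gamma> t) - \<theta> (J (\<gamma> t)) * \<eta>\<^sup>2 / 2"
        using in_V R no \<theta> by (intro \<epsilon>) auto
      show ?thesis
      proof (cases "c - \<eta> / 2 \<le> J (\<gamma> t)")
        case True
        have "J (\<gamma> t) - \<theta> (J (\<gamma> t)) * \<eta>\<^sup>2 / 2 \<le> c + \<epsilon> * \<eta>\<^sup>2 / 4 - \<epsilon> * \<eta>\<^sup>2 / 2"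
          using \<gamma>(2)[OF t] \<theta>1[OF True] by (simp add: \<kappa>_def)
        then show ?thesis using le unfolding c'_def by linarith
      next
        case False
        have "0 \<le> \<theta> (J (\<gamma> t)) * \<eta>\<^sup>2 / 2" using \<theta> by simp
        then show ?thesis using le False by (simp add: c'_def)
      qed
    qed
    then have "c' \<in> S" using path by (auto simp: S_def)
    then have "c \<le> c'" unfolding c_def using bdd by (intro cInf_lower)
    moreover have "0 < \<epsilon> * \<eta>\<^sup>2 / 4" using \<eta> \<epsilon> by simp
    ultimately show False using \<eta> by (auto simp: c'_def)
  qed
  moreover have "\<alpha> \<le> c" unfolding c_def using M lower by (intro cInf_greatest) auto
  moreover have "c \<le> M" unfolding c_def using M bdd by (intro cInf_lower)
  ultimately show ?thesis using that by blast
qed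

end

section \<open>Critical points of Kirchhoff energies\<close>

text \<open>
  Here \<open>Q\<close> stands for the squared norm of \<open>L\<^sup>2\<close>, \<open>D u\<close> for the derivative of
  \<open>\<Psi>\<close> at \<open>u\<close>, and the last two assumptions for the compact embedding.
\<close>

locale energy_space = semi_inner_space V B
  for V :: "'v::real_vector set" and B +
  fixes Q :: "'v \<Rightarrow> real" and \<Psi> :: "'v \<Rightarrow> real" and D :: "'v \<Rightarrow> 'v \<Rightarrow> real"
  assumes Q_nonneg: "0 \<le> Q u"
    and Q_le: "\<exists>C. \<forall>u\<in>V. Q u \<le> C * B u u"
    and D_add: "u \<in> V \<Longrightarrow> \<phi> \<in> V \<Longrightarrow> \<psi> \<in> V \<Longrightarrow> D u (\<phi> + \<psi>) = D u \<phi> + D u \<psi>"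
    and D_scale: "u \<in> V \<Longrightarrow> \<phi> \<in> V \<Longrightarrow> D u (c *\<^sub>R \<phi>) = c * D u \<phi>"
    and D_bdd: "\<exists>C. \<forall>u\<in>V. B u u \<le> R \<longrightarrow> (\<forall>\<phi>\<in>V. B \<phi> \<phi> \<le> 1 \<longrightarrow> \<bar>D u \<phi>\<bar> \<le> C)"
    and D_uc: "e > 0 \<Longrightarrow> \<exists>d>0. \<forall>u\<in>V. \<forall>v\<in>V. B u u \<le> R \<longrightarrow> B v v \<le> R \<longrightarrow> Q (u - v) \<le> d
      \<longrightarrow> (\<forall>\<phi>\<in>V. B \<phi> \<phi> \<le> 1 \<longrightarrow> \<bar>D u \<phi> - D v \<phi>\<bar> \<le> e)"
    and \<Psi>_uc: "e > 0 \<Longrightarrow> \<exists>d>0. \<forall>u\<in>V. \<forall>v\<in>V. B u u \<le> R \<longrightarrow> B v v \<le> R \<longrightarrow> Q (u - v) \<le> d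
      \<longrightarrow> \<bar>\<Psi> u - \<Psi> v\<bar> \<le> e"
    and \<Psi>_deriv: "u \<in> V \<Longrightarrow> w \<in> V \<Longrightarrow> ((\<lambda>t. \<Psi> (u + t *\<^sub>R w)) has_real_derivative D u w) (at 0)"
    and compact: "(\<And>k. x k \<in> V) \<Longrightarrow> (\<And>k. B (x k) (x k) \<le> R) \<Longrightarrow>
      \<exists>r u. strict_mono r \<and> u \<in> V \<and> (\<lambda>k. Q (x (r k) - u)) \<longlonglongrightarrow> 0"
    and lsc: "(\<And>k. x k \<in> V) \<Longrightarrow> (\<And>k. B (x k) (x k) \<le> c) \<Longrightarrow> u \<in> V \<Longrightarrow>
      (\<lambda>k. Q (x k - u)) \<longlonglongrightarrow> 0 \<Longrightarrow> B u u \<le> c"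
begin

section \<open>Completeness, Riesz representation and the gradient of \<Psi>\<close>

lemma B_le_if_nm_le: "nm u \<le> R \<Longrightarrow> B u u \<le> R\<^sup>2"
  unfolding nm_sq[symmetric] by (intro power_mono) auto

lemma Q_tendsto_0:
  assumes "\<And>n. u n \<in> V" "(\<lambda>n. nm (u n)) \<longlonglongrightarrow> 0"
  shows "(\<lambda>n. Q (u n)) \<longlonglongrightarrow> 0"
proof -
  obtain C where C: "\<And>u. u \<in> V \<Longrightarrow> Q u \<le> C * B u u" using Q_le by blast
  have "(\<lambda>n. C * (nm (u n))\<^sup>2) \<longlonglongrightarrow> C * 0\<^sup>2" by (intro tendsto_intros assms)
  then have "(\<lambda>n. C * (nm (u n))\<^sup>2) \<longlonglongrightarrow> 0" by simp
  then show ?thesis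
    by (rule Lim_null_comparison[rotated]) (use C assms in \<open>simp add: Q_nonneg nm_sq\<close>)
qed

text \<open>A subsequence has a \<open>Q\<close>-limit \<open>u\<close> by compactness. For fixed
  \<open>n\<close>, lower semicontinuity applied to the differences with \<open>w n\<close> carries
  the Cauchy bound over to \<open>u - w n\<close>, which upgrades \<open>Q\<close>-convergence to
  convergence in \<open>nm\<close>.\<close>

lemma nm_complete:
  assumes w: "\<And>n. w n \<in> V" and cauchy: "\<And>e. e > 0 \<Longrightarrow> \<exists>N. \<forall>m\<ge>N. \<forall>n\<ge>N. nm (w m - w n) \<le> e"
  obtains u where "u \<in> V" "(\<lambda>n. nm (w n - u)) \<longlonglongrightarrow> 0"
proof -
  obtain N where N: "\<And>m n. m \<ge> N \<Longrightarrow> n \<ge> N \<Longrightarrow> nm (w m - w n) \<le> 1"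
    using cauchy[of 1] by auto
  have "nm (w (N + k)) \<le> nm (w N) + 1" for k
    using nm_triangle_rev[of "w (N + k)" "w N"] N[of "N + k" N] w by simp
  then have "B (w (N + k)) (w (N + k)) \<le> (nm (w N) + 1)\<^sup>2" for k
    using B_le_if_nm_le by blast
  then obtain r u where r: "strict_mono r" and u: "u \<in> V"
    and lim: "(\<lambda>k. Q (w (N + r k) - u)) \<longlonglongrightarrow> 0"
    using compact[of "\<lambda>k. w (N + k)" "(nm (w N) + 1)\<^sup>2"] w by blast
  have "(\<lambda>n. nm (w n - u)) \<longlonglongrightarrow> 0"
  proof (rule LIMSEQ_I)
    fix e :: real assume e: "e > 0"
    then obtain N' where N': "\<And>m n. m \<ge> N' \<Longrightarrow> n \<ge> N' \<Longrightarrow> nm (w m - w n) \<le> e / 2"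
      using cauchy[of "e / 2"] by auto
    have "norm (nm (w n - u) - 0) < e" if n: "n \<ge> N'" for n
    proof -
      have "N + r (k + N') \<ge> N'" for k using seq_suble[OF r, of "k + N'"] by simp
      then have "B (w (N + r (k + N')) - w n) (w (N + r (k + N')) - w n) \<le> (e/2)\<^sup>2" for k
        using N' n B_le_if_nm_le by blast
      moreover have "(\<lambda>k. Q ((w (N + r (k + N')) - w n) - (u - w n))) \<longlonglongrightarrow> 0"
        using LIMSEQ_ignore_initial_segment[OF lim, of N'] by simp
      ultimately have "B (u - w n) (u - w n) \<le> (e/2)\<^sup>2"
        using lsc[of "\<lambda>k. w (N + r (k + N')) - w n" "(e/2)\<^sup>2" "u - w n"] w u by auto
      then have "nm (u - w n) \<le> e / 2"
        unfolding nm_sq[symmetric] by (rule power2_le_imp_le) (use e in simp)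
      then show ?thesis using nm_minus_commute[OF u w[of n]] e by simp
    qed
    then show "\<exists>N. \<forall>n\<ge>N. norm (nm (w n - u) - 0) < e" by blast
  qed
  with u show ?thesis using that by blast
qed

text \<open>The representing vector is a minimizer of \<open>B v v / 2 - L v\<close>; the
  parallelogram law makes minimizing sequences Cauchy, and \<open>nm_complete\<close> provides their
  limit.\<close>

lemma riesz:
  assumes add: "\<And>\<phi> \<psi>. \<phi> \<in> V \<Longrightarrow> \<psi> \<in> V \<Longrightarrow> L (\<phi> + \<psi>) = L \<phi> + L \<psi>"
    and scale: "\<And>\<phi> c. \<phi> \<in> V \<Longrightarrow> L (c *\<^sub>R \<phi>) = c * L \<phi>"
    and bound: "\<And>\<phi>. \<phi> \<in> V \<Longrightarrow> \<bar>L \<phi>\<bar> \<le> C * nm \<phi>"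
  obtains v where "v \<in> V" "\<And>\<phi>. \<phi> \<in> V \<Longrightarrow> B v \<phi> = L \<phi>"
proof -
  define I where "I v = B v v / 2 - L v" for v
  have lower: "- C\<^sup>2 / 2 \<le> I v" if "v \<in> V" for v
  proof -
    have "0 \<le> (nm v - C)\<^sup>2" by simp
    then have "C * nm v \<le> B v v / 2 + C\<^sup>2 / 2" by (simp add: power2_diff nm_sq mult.commute)
    then show ?thesis using bound[OF that] by (simp add: I_def)
  qed
  then have bdd: "bdd_below (I ` V)" by (auto simp: bdd_below_def)
  define m where "m = Inf (I ` V)"
  have m: "m \<le> I v" if "v \<in> V" for v unfolding m_def using bdd that by (intro cInf_lower) auto
  have "\<exists>v\<in>V. I v < m + 1 / real (Suc n)" for n
    using cInf_lessD[of "I ` V" "m + 1 / real (Suc n)"] V_intros(1) unfolding m_def by fastforce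
  then obtain w where w: "\<And>n. w n \<in> V" "\<And>n. I (w n) < m + 1 / real (Suc n)" by metis
  \<comment> \<open>Parallelogram law: the linear parts cancel against twice the value of
    \<open>I\<close> at the midpoint, and that value is at least \<open>m\<close>.\<close>
  have close: "(nm (u - v))\<^sup>2 \<le> 4 * I u + 4 * I v - 8 * m" if "u \<in> V" "v \<in> V" for u v
  proof -
    have "I ((1/2) *\<^sub>R (u + v)) = (B u u + 2 * B u v + B v v) / 8 - (L u + L v) / 2"
      using that B_sym[of u v] by (simp add: I_def B_bilinear scale add field_simps)
    moreover have "(nm (u - v))\<^sup>2 = B u u - 2 * B u v + B v v"
      using that B_sym[of u v] by (simp add: nm_sq B_bilinear)
    ultimately have "(nm (u - v))\<^sup>2 = 4 * (I u + I v - 2 * I ((1/2) *\<^sub>R (u + v)))"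
      by (simp add: I_def[of u] I_def[of v] field_simps)
    also have "\<dots> \<le> 4 * I u + 4 * I v - 8 * m" using m[of "(1/2) *\<^sub>R (u + v)"] that by simp
    finally show ?thesis .
  qed
  have "\<exists>N. \<forall>i\<ge>N. \<forall>j\<ge>N. nm (w i - w j) \<le> e" if e: "e > 0" for e
  proof -
    obtain N where N: "1 / real (Suc N) < e\<^sup>2 / 8" using nat_approx_posE[of "e\<^sup>2 / 8"] e by auto
    have "nm (w i - w j) \<le> e" if "i \<ge> N" "j \<ge> N" for i j
    proof -
      define \<delta> where "\<delta> k = 1 / real (Suc k)" for k
      have "\<delta> i \<le> \<delta> N" "\<delta> j \<le> \<delta> N"
        using that unfolding \<delta>_def by (auto intro!: divide_left_mono)
      moreover have "I (w i) < m + \<delta> i" "I (w j) < m + \<delta> j" "\<delta> N < e\<^sup>2 / 8"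
        using w(2) N by (auto simp: \<delta>_def)
      ultimately have "(nm (w i - w j))\<^sup>2 \<le> e\<^sup>2"
        using close[OF w(1)[of i] w(1)[of j]] by linarith
      then show ?thesis by (rule power2_le_imp_le) (use e in simp)
    qed
    then show ?thesis by blast
  qed
  then obtain v where v: "v \<in> V" "(\<lambda>n. nm (w n - v)) \<longlonglongrightarrow> 0"
    by (rule nm_complete[OF w(1)])
  have "I v \<le> m + ((nm v + C) * nm (w n - v) + 1 / real (Suc n))" for n
  proof -
    have "L (w n) = L v + L (w n - v)" using add[of v "w n - v"] v w by simp
    moreover have "B (w n) (w n) = B v v + 2 * B v (w n - v) + (nm (w n - v))\<^sup>2"
      using B_add_scale_self[of v "w n - v" 1] v w by (simp add: nm_sq)
    moreover have "0 \<le> (nm (w n - v))\<^sup>2" by simp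
    ultimately have "I v \<le> I (w n) - B v (w n - v) + L (w n - v)"
      unfolding I_def by linarith
    also have "\<dots> \<le> I (w n) + nm v * nm (w n - v) + C * nm (w n - v)"
      using cauchy_schwarz[of v "w n - v"] bound[of "w n - v"] v w by (auto simp: abs_le_iff)
    also have "\<dots> \<le> m + 1 / real (Suc n) + nm v * nm (w n - v) + C * nm (w n - v)"
      using w(2)[of n] by (intro add_right_mono less_imp_le)
    finally show ?thesis by (simp add: distrib_right)
  qed
  moreover have "(\<lambda>n. m + ((nm v + C) * nm (w n - v) + 1 / real (Suc n))) \<longlonglongrightarrow> m + ((nm v + C) * 0 + 0)"
    by (intro tendsto_intros v LIMSEQ_Suc[OF lim_1_over_n])
  ultimately have "I v \<le> m + ((nm v + C) * 0 + 0)"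
    by (intro LIMSEQ_le_const) auto
  then have min: "I v \<le> I u" if "u \<in> V" for u using m[OF that] by simp
  \<comment> \<open>Euler-Lagrange equation: along each line through \<open>v\<close> the functional
    \<open>I\<close> is a quadratic polynomial with its minimum at 0.\<close>
  have "B v \<phi> = L \<phi>" if \<phi>: "\<phi> \<in> V" for \<phi>
  proof -
    have deriv: "((\<lambda>t. B v v / 2 + t * B v \<phi> + t\<^sup>2 * B \<phi> \<phi> / 2 - (L v + t * L \<phi>)) has_real_derivative (B v \<phi> - L \<phi>)) (at 0)"
      by (auto intro!: derivative_eq_intros)
    have "I (v + t *\<^sub>R \<phi>) = B v v / 2 + t * B v \<phi> + t\<^sup>2 * B \<phi> \<phi> / 2 - (L v + t * L \<phi>)" for t
      using v \<phi> by (simp add: I_def B_add_scale_self add scale)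
    then have "B v v / 2 + 0 * B v \<phi> + 0\<^sup>2 * B \<phi> \<phi> / 2 - (L v + 0 * L \<phi>)
      \<le> B v v / 2 + t * B v \<phi> + t\<^sup>2 * B \<phi> \<phi> / 2 - (L v + t * L \<phi>)" for t
      using min[of "v + t *\<^sub>R \<phi>"] v \<phi> by (simp add: I_def)
    then have "B v \<phi> - L \<phi> = 0" using DERIV_local_min[OF deriv, of 1] by simp
    then show ?thesis by simp
  qed
  with v that show ?thesis by blast
qed

lemma D_bound:
  assumes "R \<ge> 0"
  obtains C where "C \<ge> 0" "\<And>u \<phi>. u \<in> V \<Longrightarrow> nm u \<le> R \<Longrightarrow> \<phi> \<in> V \<Longrightarrow> \<bar>D u \<phi>\<bar> \<le> C * nm \<phi>"
proof -
  obtain C where C: "\<And>u \<phi>. u \<in> V \<Longrightarrow> B u u \<le> R\<^sup>2 \<Longrightarrow> \<phi> \<in> V \<Longrightarrow> B \<phi> \<phi> \<le> 1 \<Longrightarrow> \<bar>D u \<phi>\<bar> \<le> C"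
    using D_bdd[of "R\<^sup>2"] by blast
  have "\<bar>D u \<phi>\<bar> \<le> max 0 C * nm \<phi>" if u: "u \<in> V" "nm u \<le> R" and \<phi>: "\<phi> \<in> V" for u \<phi>
  proof -
    have "\<bar>D u \<phi>\<bar> \<le> C * nm \<phi>"
      using D_scale[OF u(1)] C[OF u(1) B_le_if_nm_le[OF u(2)]] \<phi> by (rule linear_bound)
    also have "\<dots> \<le> max 0 C * nm \<phi>" by (intro mult_right_mono) auto
    finally show ?thesis .
  qed
  then show ?thesis by (intro that[of "max 0 C"]; simp)
qed

text \<open>A choice is necessary because a representative is determined only up to vectors of
  seminorm zero.\<close>

definition grad :: "'v \<Rightarrow> 'v" where
  "grad u = (SOME v. v \<in> V \<and> (\<forall>\<phi>\<in>V. B v \<phi> = D u \<phi>))"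

lemma grad:
  assumes "u \<in> V"
  shows grad_in: "grad u \<in> V" and B_grad: "\<phi> \<in> V \<Longrightarrow> B (grad u) \<phi> = D u \<phi>"
proof -
  obtain C where C: "\<And>\<phi>. \<phi> \<in> V \<Longrightarrow> \<bar>D u \<phi>\<bar> \<le> C * nm \<phi>"
    by (rule D_bound[OF nm_nonneg[of u]]) (use assms in auto)
  have "\<exists>v. v \<in> V \<and> (\<forall>\<phi>\<in>V. B v \<phi> = D u \<phi>)"
    by (rule riesz[of "D u" C]) (use D_add[OF assms] D_scale[OF assms] C in blast)+
  then have "grad u \<in> V \<and> (\<forall>\<phi>\<in>V. B (grad u) \<phi> = D u \<phi>)"
    unfolding grad_def by (rule someI_ex)
  then show "grad u \<in> V" "\<phi> \<in> V \<Longrightarrow> B (grad u) \<phi> = D u \<phi>" by auto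
qed

text \<open>Testing the derivative with \<open>grad u\<close> itself bounds the square of
  \<open>nm (grad u)\<close> by \<open>C * nm (grad u)\<close>.\<close>

lemma grad_bound:
  obtains C where "C \<ge> 0" "\<And>u. u \<in> V \<Longrightarrow> nm u \<le> R \<Longrightarrow> nm (grad u) \<le> C"
proof -
  obtain C where C: "C \<ge> 0" "\<And>u \<phi>. u \<in> V \<Longrightarrow> nm u \<le> max 0 R \<Longrightarrow> \<phi> \<in> V \<Longrightarrow> \<bar>D u \<phi>\<bar> \<le> C * nm \<phi>"
    using D_bound[of "max 0 R"] by auto
  have "nm (grad u) \<le> C" if "u \<in> V" "nm u \<le> R" for u
  proof -
    have "nm (grad u) * nm (grad u) \<le> C * nm (grad u)"
      using C(2)[of u "grad u"] B_grad[of u "grad u"] nm_sq[of "grad u"] that grad_in[of u]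
      by (simp add: power2_eq_square le_max_iff_disj)
    then show ?thesis using C(1) nm_nonneg[of "grad u"] by (cases "nm (grad u) = 0") (auto simp: mult_le_cancel_right)
  qed
  then show ?thesis by (rule that[OF C(1)])
qed

text \<open>The difference of the gradients is tested with itself. Closeness is measured in
  \<open>Q\<close> and not in \<open>nm\<close>, so this expresses compactness of the gradient
  map.\<close>

lemma grad_uc:
  assumes "e > 0"
  obtains d where "d > 0" "\<And>u v. u \<in> V \<Longrightarrow> v \<in> V \<Longrightarrow> nm u \<le> R \<Longrightarrow> nm v \<le> R \<Longrightarrow> Q (u - v) \<le> d \<Longrightarrow>
    nm (grad u - grad v) \<le> e"
proof -
  obtain d where d: "d > 0" "\<And>u v \<phi>. u \<in> V \<Longrightarrow> v \<in> V \<Longrightarrow> B u u \<le> R\<^sup>2 \<Longrightarrow> B v v \<le> R\<^sup>2 \<Longrightarrow> Q (u - v) \<le> d \<Longrightarrow>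
    \<phi> \<in> V \<Longrightarrow> B \<phi> \<phi> \<le> 1 \<Longrightarrow> \<bar>D u \<phi> - D v \<phi>\<bar> \<le> e"
    using D_uc[OF assms, of "R\<^sup>2"] by blast
  have "nm (grad u - grad v) \<le> e" if "u \<in> V" "v \<in> V" "nm u \<le> R" "nm v \<le> R" "Q (u - v) \<le> d" for u v
  proof -
    let ?z = "grad u - grad v"
    have z: "?z \<in> V" using grad_in that by auto
    have "\<bar>D u \<phi> - D v \<phi>\<bar> \<le> e" if "\<phi> \<in> V" "B \<phi> \<phi> \<le> 1" for \<phi>
      by (rule d(2)) (use that \<open>u \<in> V\<close> \<open>v \<in> V\<close> \<open>nm u \<le> R\<close> \<open>nm v \<le> R\<close> \<open>Q (u - v) \<le> d\<close> B_le_if_nm_le in blast)+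
    then have "\<bar>D u ?z - D v ?z\<bar> \<le> e * nm ?z"
      using z by (intro linear_bound[where L = "\<lambda>\<phi>. D u \<phi> - D v \<phi>"])
        (simp_all add: D_scale \<open>u \<in> V\<close> \<open>v \<in> V\<close> right_diff_distrib)
    moreover have "B ?z ?z = D u ?z - D v ?z"
      using z that by (simp add: B_diff grad_in B_grad)
    ultimately have "nm ?z * nm ?z \<le> e * nm ?z"
      using nm_sq[of ?z] by (simp add: power2_eq_square)
    then show ?thesis using assms nm_nonneg[of ?z] by (cases "nm ?z = 0") (auto simp: mult_le_cancel_right)
  qed
  then show ?thesis by (rule that[OF d(1)])
qed

lemma grad_seq:
  assumes "\<And>n. u n \<in> V" "\<And>n. v n \<in> V" "\<And>n. nm (u n) \<le> R" "\<And>n. nm (v n) \<le> R" "(\<lambda>n. Q (u n - v n)) \<longlonglongrightarrow> 0"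
  shows "(\<lambda>n. nm (grad (u n) - grad (v n))) \<longlonglongrightarrow> 0"
proof (rule tendstoI)
  fix e :: real assume e: "e > 0"
  obtain d where d: "d > 0" "\<And>u v. u \<in> V \<Longrightarrow> v \<in> V \<Longrightarrow> nm u \<le> R \<Longrightarrow> nm v \<le> R \<Longrightarrow> Q (u - v) \<le> d \<Longrightarrow>
    nm (grad u - grad v) \<le> e / 2"
    using grad_uc[of "e / 2" R] e by auto
  have "\<forall>\<^sub>F n in sequentially. Q (u n - v n) < d" using assms(5) d(1) by (rule order_tendstoD)
  then show "\<forall>\<^sub>F n in sequentially. dist (nm (grad (u n) - grad (v n))) 0 < e"
  proof eventually_elim
    case (elim n)
    then have "nm (grad (u n) - grad (v n)) \<le> e / 2" using assms by (intro d(2)) auto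
    then show ?case using e by (simp add: dist_real_def)
  qed
qed

lemma \<Psi>_seq:
  assumes "\<And>n. u n \<in> V" "\<And>n. v n \<in> V" "\<And>n. nm (u n) \<le> R" "\<And>n. nm (v n) \<le> R" "(\<lambda>n. Q (u n - v n)) \<longlonglongrightarrow> 0"
  shows "(\<lambda>n. \<Psi> (u n) - \<Psi> (v n)) \<longlonglongrightarrow> 0"
proof (rule tendstoI)
  fix e :: real assume e: "e > 0"
  obtain d where d: "d > 0" "\<And>u v. u \<in> V \<Longrightarrow> v \<in> V \<Longrightarrow> B u u \<le> R\<^sup>2 \<Longrightarrow> B v v \<le> R\<^sup>2 \<Longrightarrow> Q (u - v) \<le> d \<Longrightarrow>
    \<bar>\<Psi> u - \<Psi> v\<bar> \<le> e / 2"
    using \<Psi>_uc[of "e / 2" "R\<^sup>2"] e by auto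
  have "\<forall>\<^sub>F n in sequentially. Q (u n - v n) < d" using assms(5) d(1) by (rule order_tendstoD)
  then show "\<forall>\<^sub>F n in sequentially. dist (\<Psi> (u n) - \<Psi> (v n)) 0 < e"
  proof eventually_elim
    case (elim n)
    then have "\<bar>\<Psi> (u n) - \<Psi> (v n)\<bar> \<le> e / 2" using assms B_le_if_nm_le by (intro d(2)) auto
    then show ?case using e by (simp add: dist_real_def)
  qed
qed

end

text \<open>Reduces uniform continuity to sequences, so that the products occurring in the gradient
  of the energy can be handled by limit rules instead of explicit moduli.\<close>

lemma (in semi_inner_space) nm_uc_if_seq:
  assumes "\<And>u v. (\<And>n::nat. u n \<in> V) \<Longrightarrow> (\<And>n. v n \<in> V) \<Longrightarrow> (\<And>n. nm (u n) \<le> R) \<Longrightarrow> (\<And>n. nm (v n) \<le> R) \<Longrightarrow>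
      (\<lambda>n. nm (u n - v n)) \<longlonglongrightarrow> 0 \<Longrightarrow> (\<lambda>n. nm (G (u n) - G (v n))) \<longlonglongrightarrow> 0"
    and "e > 0"
  shows "\<exists>d>0. \<forall>u\<in>V. \<forall>v\<in>V. nm u \<le> R \<longrightarrow> nm v \<le> R \<longrightarrow> nm (u - v) \<le> d \<longrightarrow> nm (G u - G v) \<le> e"
proof (rule ccontr)
  assume "\<not> ?thesis"
  then have "\<exists>u v. u \<in> V \<and> v \<in> V \<and> nm u \<le> R \<and> nm v \<le> R \<and> nm (u - v) \<le> 1 / real (Suc n) \<and> e < nm (G u - G v)" for n
    by (metis not_le of_nat_0_less_iff zero_less_Suc zero_less_divide_1_iff)
  then obtain u v where uv: "\<And>n. u n \<in> V" "\<And>n. v n \<in> V" "\<And>n. nm (u n) \<le> R" "\<And>n. nm (v n) \<le> R"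
    "\<And>n. nm (u n - v n) \<le> 1 / real (Suc n)" "\<And>n. e < nm (G (u n) - G (v n))" by metis
  have "(\<lambda>n. nm (u n - v n)) \<longlonglongrightarrow> 0"
    by (rule Lim_null_comparison[OF _ LIMSEQ_Suc[OF lim_1_over_n]]) (use uv(5) in simp)
  then have "(\<lambda>n. nm (G (u n) - G (v n))) \<longlonglongrightarrow> 0" using uv assms(1) by blast
  then have "\<forall>\<^sub>F n in sequentially. nm (G (u n) - G (v n)) < e" using assms(2) by (rule order_tendstoD)
  then obtain n where "nm (G (u n) - G (v n)) < e" by (auto simp: eventually_sequentially)
  then show False using uv(6)[of n] by simp
qed

section \<open>The Kirchhoff energy and its critical points\<close>

locale kirchhoff_energy = energy_space V B Q \<Psi> D
  for V :: "'v::real_vector set" and B Q \<Psi> D +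
  fixes h H :: "real \<Rightarrow> real" and a b \<mu> lam c\<^sub>H :: real
  assumes h_uc: "uniformly_continuous_on UNIV h" and h_bdd: "\<exists>C. \<forall>t. \<bar>h t\<bar> \<le> C"
    and H_deriv: "(H has_real_derivative h t) (at t)"
    and H_nonneg: "0 \<le> H t" and H_0: "H 0 = 0"
    and H_le: "u \<in> V \<Longrightarrow> H (\<Psi> u - lam) \<le> c\<^sub>H"
    and a: "0 < a" and b: "0 \<le> b" and mu: "0 \<le> \<mu>"
begin

definition E :: "'v \<Rightarrow> real" where
  "E u = a / 2 * B u u + b / 4 * (B u u)\<^sup>2 - \<mu> * H (\<Psi> u - lam)"

text \<open>The compact part of the gradient: by \<open>K_seq\<close> it turns
  \<open>Q\<close>-convergence into convergence in \<open>nm\<close>. What remains of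
  \<open>G\<close> is a multiple of the identity by a factor of at least \<open>a\<close>.\<close>

definition K :: "'v \<Rightarrow> 'v" where "K u = (\<mu> * h (\<Psi> u - lam)) *\<^sub>R grad u"

definition G :: "'v \<Rightarrow> 'v" where "G u = (a + b * B u u) *\<^sub>R u - K u"

lemma K_mem [simp]: "u \<in> V \<Longrightarrow> K u \<in> V" by (simp add: K_def grad_in)

lemma G_mem [simp]: "u \<in> V \<Longrightarrow> G u \<in> V" by (simp add: G_def)

lemma B_G:
  "u \<in> V \<Longrightarrow> \<phi> \<in> V \<Longrightarrow> B (G u) \<phi> = (a + b * B u u) * B u \<phi> - \<mu> * h (\<Psi> u - lam) * D u \<phi>"
  by (simp add: G_def K_def B_bilinear grad_in B_grad)

lemma E_deriv:
  assumes "u \<in> V" "w \<in> V"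
  shows "((\<lambda>t. E (u + t *\<^sub>R w)) has_real_derivative B (G u) w) (at 0)"
proof -
  have "((\<lambda>t. H (\<Psi> (u + t *\<^sub>R w) - lam)) has_real_derivative h (\<Psi> (u + 0 *\<^sub>R w) - lam) * D u w) (at 0)"
    by (rule DERIV_chain2[where f = H], rule H_deriv)
      (use DERIV_diff[OF \<Psi>_deriv[OF assms] DERIV_const] in simp)
  then have H': "((\<lambda>t. H (\<Psi> (u + t *\<^sub>R w) - lam)) has_real_derivative h (\<Psi> u - lam) * D u w) (at 0)"
    by simp
  have "((\<lambda>t. a / 2 * (B u u + 2 * t * B u w + t\<^sup>2 * B w w) + b / 4 * (B u u + 2 * t * B u w + t\<^sup>2 * B w w)\<^sup>2
      - \<mu> * H (\<Psi> (u + t *\<^sub>R w) - lam)) has_real_derivative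
      a / 2 * (2 * B u w) + b / 4 * (2 * B u u * (2 * B u w)) - \<mu> * (h (\<Psi> u - lam) * D u w)) (at 0)"
    by (rule derivative_eq_intros H' refl)+ (simp add: field_simps)
  then show ?thesis using assms by (simp add: E_def B_add_scale_self B_G algebra_simps)
qed

lemma h_seq:
  assumes "(\<lambda>n. x n - y n) \<longlonglongrightarrow> 0"
  shows "(\<lambda>n. h (x n) - h (y n)) \<longlonglongrightarrow> 0"
proof -
  have "(\<lambda>n. dist (h (x n)) (h (y n))) \<longlonglongrightarrow> 0"
    using h_uc assms unfolding uniformly_continuous_on_sequentially
    by (auto simp: dist_real_def tendsto_rabs_zero_iff)
  then show ?thesis by (simp add: dist_real_def tendsto_rabs_zero_iff)
qed

lemma K_bound:
  obtains C where "C \<ge> 0" "\<And>u. u \<in> V \<Longrightarrow> nm u \<le> R \<Longrightarrow> nm (K u) \<le> C"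
proof -
  obtain C where C: "C \<ge> 0" "\<And>u. u \<in> V \<Longrightarrow> nm u \<le> R \<Longrightarrow> nm (grad u) \<le> C" using grad_bound[of R] by metis
  obtain C' where C': "\<And>t. \<bar>h t\<bar> \<le> C'" using h_bdd by blast
  then have C'0: "0 \<le> C'" using abs_ge_zero order_trans by blast
  have "nm (K u) \<le> \<mu> * C' * C" if "u \<in> V" "nm u \<le> R" for u
    unfolding K_def using that C C' C'0 mu
    by (auto simp: nm_scale grad_in abs_mult intro!: mult_mono)
  moreover have "0 \<le> \<mu> * C' * C" using mu C C'0 by simp
  ultimately show ?thesis by (rule that[rotated])
qed

lemma K_seq:
  assumes "\<And>n. u n \<in> V" "\<And>n. v n \<in> V" "\<And>n. nm (u n) \<le> R" "\<And>n. nm (v n) \<le> R" "(\<lambda>n. Q (u n - v n)) \<longlonglongrightarrow> 0"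
  shows "(\<lambda>n. nm (K (u n) - K (v n))) \<longlonglongrightarrow> 0"
proof -
  obtain C where C: "\<And>u. u \<in> V \<Longrightarrow> nm u \<le> R \<Longrightarrow> nm (grad u) \<le> C" using grad_bound[of R] by metis
  obtain C' where C': "\<And>t. \<bar>h t\<bar> \<le> C'" using h_bdd by blast
  define dh where "dh n = h (\<Psi> (u n) - lam) - h (\<Psi> (v n) - lam)" for n
  define dg where "dg n = nm (grad (u n) - grad (v n))" for n
  have "nm (K (u n) - K (v n)) \<le> \<mu> * \<bar>dh n\<bar> * C + \<mu> * C' * dg n" for n
  proof -
    have "K (u n) - K (v n) = (\<mu> * dh n) *\<^sub>R grad (u n) + (\<mu> * h (\<Psi> (v n) - lam)) *\<^sub>R (grad (u n) - grad (v n))"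
      by (simp add: K_def dh_def algebra_simps)
    also have "nm \<dots> \<le> nm ((\<mu> * dh n) *\<^sub>R grad (u n)) + nm ((\<mu> * h (\<Psi> (v n) - lam)) *\<^sub>R (grad (u n) - grad (v n)))"
      using assms(1,2) by (intro nm_triangle) (simp_all add: grad_in)
    also have "\<dots> = \<mu> * \<bar>dh n\<bar> * nm (grad (u n)) + \<mu> * \<bar>h (\<Psi> (v n) - lam)\<bar> * dg n"
      using assms(1,2) mu by (simp add: nm_scale grad_in abs_mult dg_def)
    also have "\<dots> \<le> \<mu> * \<bar>dh n\<bar> * C + \<mu> * C' * dg n"
      using mu by (intro add_mono mult_left_mono mult_right_mono C C' assms(1,3)) (simp_all add: dg_def)
    finally show ?thesis .
  qed
  moreover have "dh \<longlonglongrightarrow> 0"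
    unfolding dh_def using \<Psi>_seq[OF assms] by (intro h_seq) simp
  then have "(\<lambda>n. \<mu> * \<bar>dh n\<bar> * C + \<mu> * C' * dg n) \<longlonglongrightarrow> \<mu> * \<bar>0\<bar> * C + \<mu> * C' * 0"
    unfolding dg_def by (intro tendsto_intros grad_seq[OF assms])
  then have "(\<lambda>n. \<mu> * \<bar>dh n\<bar> * C + \<mu> * C' * dg n) \<longlonglongrightarrow> 0" by simp
  ultimately show ?thesis
    by (intro Lim_null_comparison[of "\<lambda>n. nm (K (u n) - K (v n))"]) simp_all
qed

lemma G_seq:
  assumes "\<And>n. u n \<in> V" "\<And>n. v n \<in> V" "\<And>n. nm (u n) \<le> R" "\<And>n. nm (v n) \<le> R" "(\<lambda>n. nm (u n - v n)) \<longlonglongrightarrow> 0"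
  shows "(\<lambda>n. nm (G (u n) - G (v n))) \<longlonglongrightarrow> 0"
proof (rule Lim_null_comparison)
  let ?t = "\<lambda>u. a + b * B u u"
  \<comment> \<open>The first summand bounds the factor \<open>?t\<close>; the second combines its
    Lipschitz bound \<open>b * (2 * R)\<close> with \<open>nm (v n) \<le> R\<close>.\<close>
  let ?c = "(a + b * R\<^sup>2) + b * (2 * R) * R"
  have "nm (G (u n) - G (v n)) \<le> ?c * nm (u n - v n) + nm (K (u n) - K (v n))" for n
  proof -
    have R: "0 \<le> R" using assms(3)[of 0] nm_nonneg order_trans by blast
    have "\<bar>?t (u n) - ?t (v n)\<bar> = b * (\<bar>nm (u n) - nm (v n)\<bar> * (nm (u n) + nm (v n)))"
    proof -
      have "?t (u n) - ?t (v n) = b * ((nm (u n) - nm (v n)) * (nm (u n) + nm (v n)))"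
        by (simp add: nm_sq[symmetric] power2_eq_square algebra_simps)
      then show ?thesis using b by (simp add: abs_mult)
    qed
    also have "\<dots> \<le> b * (nm (u n - v n) * (2 * R))"
      using b nm_triangle_rev[OF assms(1,2)] assms(3,4)[of n] by (intro mult_left_mono mult_mono) auto
    finally have t: "\<bar>?t (u n) - ?t (v n)\<bar> \<le> b * (2 * R) * nm (u n - v n)" by (simp add: mult_ac)
    have "?t (u n) \<le> a + b * R\<^sup>2" using b assms(3)[of n] B_le_if_nm_le by (simp add: mult_left_mono)
    moreover have "0 \<le> ?t (u n)" using a b B_nonneg[of "u n"] by simp
    ultimately have t': "\<bar>?t (u n)\<bar> \<le> a + b * R\<^sup>2" by simp
    have eq: "G (u n) - G (v n) = (?t (u n) *\<^sub>R (u n - v n) + (?t (u n) - ?t (v n)) *\<^sub>R v n) - (K (u n) - K (v n))"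
      by (simp add: G_def algebra_simps)
    have "nm (G (u n) - G (v n)) \<le> nm (?t (u n) *\<^sub>R (u n - v n) + (?t (u n) - ?t (v n)) *\<^sub>R v n) + nm (K (u n) - K (v n))"
      unfolding eq using assms(1,2) by (intro nm_triangle_diff) simp_all
    also have "nm (?t (u n) *\<^sub>R (u n - v n) + (?t (u n) - ?t (v n)) *\<^sub>R v n) \<le>
       nm (?t (u n) *\<^sub>R (u n - v n)) + nm ((?t (u n) - ?t (v n)) *\<^sub>R v n)"
      using assms(1,2) by (intro nm_triangle) simp_all
    also have "\<dots> = \<bar>?t (u n)\<bar> * nm (u n - v n) + \<bar>?t (u n) - ?t (v n)\<bar> * nm (v n)"
      using assms by (simp add: nm_scale)
    also have "\<dots> \<le> (a + b * R\<^sup>2) * nm (u n - v n) + (b * (2 * R) * nm (u n - v n)) * R"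
      using t t' assms(4)[of n] b R by (intro add_mono mult_mono) auto
    finally show ?thesis by (simp add: algebra_simps)
  qed
  then show "\<forall>\<^sub>F n in sequentially. norm (nm (G (u n) - G (v n))) \<le> ?c * nm (u n - v n) + nm (K (u n) - K (v n))"
    by simp
  have "(\<lambda>n. Q (u n - v n)) \<longlonglongrightarrow> 0" using assms by (intro Q_tendsto_0) auto
  then have "(\<lambda>n. ?c * nm (u n - v n) + nm (K (u n) - K (v n))) \<longlonglongrightarrow> ?c * 0 + 0"
    by (intro tendsto_intros assms K_seq[OF assms(1-4)])
  then show "(\<lambda>n. ?c * nm (u n - v n) + nm (K (u n) - K (v n))) \<longlonglongrightarrow> 0" by simp
qed

sublocale energy: differentiable_functional V B E G
proof
  show "\<exists>C. \<forall>u\<in>V. nm u \<le> R \<longrightarrow> nm (G u) \<le> C" for R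
  proof -
    obtain C where C: "C \<ge> 0" "\<And>u. u \<in> V \<Longrightarrow> nm u \<le> R \<Longrightarrow> nm (K u) \<le> C" using K_bound[of R] by metis
    have "nm (G u) \<le> (a + b * R\<^sup>2) * R + C" if "u \<in> V" "nm u \<le> R" for u
    proof -
      have "nm (G u) \<le> nm ((a + b * B u u) *\<^sub>R u) + nm (K u)"
        unfolding G_def using that by (intro nm_triangle_diff) auto
      also have "nm ((a + b * B u u) *\<^sub>R u) = (a + b * B u u) * nm u"
        using that a b B_nonneg[of u] by (simp add: nm_scale)
      also have "\<dots> \<le> (a + b * R\<^sup>2) * R"
        using that a b B_le_if_nm_le by (intro mult_mono add_mono mult_left_mono) auto
      finally show ?thesis using C that by force
    qed
    then show ?thesis by blast
  qed
next
  fix e R :: real assume "e > 0"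
  show "\<exists>d>0. \<forall>u\<in>V. \<forall>v\<in>V. nm u \<le> R \<longrightarrow> nm v \<le> R \<longrightarrow> nm (u - v) \<le> d \<longrightarrow> nm (G u - G v) \<le> e"
    by (rule nm_uc_if_seq[OF G_seq \<open>e > 0\<close>])
qed (simp_all add: E_deriv)

text \<open>Supplies continuity of \<open>\<Psi>\<close> along paths, for the intermediate value
  argument by which every path from \<open>p\<close> to \<open>q\<close> crosses the level
  set.\<close>

sublocale psi: differentiable_functional V B \<Psi> grad
proof
  show "\<exists>C. \<forall>u\<in>V. nm u \<le> R \<longrightarrow> nm (grad u) \<le> C" for R
    using grad_bound[of R] by metis
next
  fix e R :: real assume e: "e > 0"
  show "\<exists>d>0. \<forall>u\<in>V. \<forall>v\<in>V. nm u \<le> R \<longrightarrow> nm v \<le> R \<longrightarrow> nm (u - v) \<le> d \<longrightarrow> nm (grad u - grad v) \<le> e"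
    by (rule nm_uc_if_seq[OF grad_seq e]) (auto intro!: Q_tendsto_0)
qed (simp_all add: grad_in B_grad \<Psi>_deriv)

text \<open>The source of coercivity. In the application \<open>H\<close> grows linearly at
  infinity, so its bound \<open>c\<^sub>H\<close> concerns only the values that
  \<open>\<Psi> u - lam\<close> takes.\<close>

lemma B_le_of_E_le:
  assumes "u \<in> V" "E u \<le> c"
  shows "a / 2 * B u u \<le> c + \<mu> * c\<^sub>H"
proof -
  have "0 \<le> b / 4 * (B u u)\<^sup>2" using b by simp
  then show ?thesis using assms mult_left_mono[OF H_le[OF assms(1)] mu] by (simp add: E_def)
qed

lemma E_nonneg_on_level: "\<Psi> u = lam \<Longrightarrow> 0 \<le> E u"
  using a b B_nonneg[of u] by (simp add: E_def H_0)

text \<open>Along a subsequence \<open>K (x n)\<close> converges to \<open>K u\<close>, and the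
  scalars \<open>t n = a + b * B (x n) (x n)\<close> converge to a positive \<open>t0\<close>. As
  \<open>t n *\<^sub>R x n\<close> is \<open>G (x n) + K (x n)\<close> and the first term tends to
  0, the limit of \<open>x n\<close> is \<open>(1 / t0) *\<^sub>R K u\<close>.\<close>

lemma palais_smale:
  assumes w: "\<And>n. w n \<in> V" "\<And>n. nm (w n) \<le> R" and lim: "(\<lambda>n. nm (G (w n))) \<longlonglongrightarrow> 0"
  obtains r z where "strict_mono r" "z \<in> V" "(\<lambda>n. nm (w (r n) - z)) \<longlonglongrightarrow> 0"
proof -
  have "B (w n) (w n) \<le> R\<^sup>2" for n using w B_le_if_nm_le by blast
  then obtain r1 u where r1: "strict_mono r1" and u: "u \<in> V" and Qu: "(\<lambda>k. Q (w (r1 k) - u)) \<longlonglongrightarrow> 0"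
    using compact[of w "R\<^sup>2"] w by blast
  have "bounded (range (\<lambda>n. B (w (r1 n)) (w (r1 n))))"
    unfolding bounded_iff using w B_le_if_nm_le B_nonneg by (intro exI[of _ "R\<^sup>2"]) auto
  then obtain l r2 where r2: "strict_mono r2" and "((\<lambda>n. B (w (r1 n)) (w (r1 n))) \<circ> r2) \<longlonglongrightarrow> l"
    using bounded_imp_convergent_subsequence by blast
  define x where "x n = w (r1 (r2 n))" for n
  have x: "x n \<in> V" "nm (x n) \<le> R" for n using w by (auto simp: x_def)
  have l: "(\<lambda>n. B (x n) (x n)) \<longlonglongrightarrow> l"
    using \<open>((\<lambda>n. B (w (r1 n)) (w (r1 n))) \<circ> r2) \<longlonglongrightarrow> l\<close> by (simp add: x_def o_def)
  then have l0: "0 \<le> l" by (rule LIMSEQ_le_const) (use B_nonneg in auto)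
  have "(\<lambda>n. Q (x n - u)) \<longlonglongrightarrow> 0"
    using LIMSEQ_subseq_LIMSEQ[OF Qu r2] by (simp add: x_def o_def)
  then have Ku: "(\<lambda>n. nm (K (x n) - K u)) \<longlonglongrightarrow> 0"
    using x u by (intro K_seq[of _ _ "max R (nm u)"]) (auto simp: le_max_iff_disj)
  have Gx: "(\<lambda>n. nm (G (x n))) \<longlonglongrightarrow> 0"
    using LIMSEQ_subseq_LIMSEQ[OF lim strict_mono_o[OF r1 r2]] by (simp add: x_def o_def)
  define t where "t n = a + b * B (x n) (x n)" for n
  define t0 where "t0 = a + b * l"
  have t0: "t0 > 0" using a b l0 by (simp add: t0_def add_pos_nonneg)
  have tn: "t n \<ge> a" "t n > 0" for n
    using a b B_nonneg[of "x n"] by (auto simp: t_def add_pos_nonneg)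
  have t: "t \<longlonglongrightarrow> t0" unfolding t_def[abs_def] t0_def by (intro tendsto_intros l)
  define z where "z = (1 / t0) *\<^sub>R K u"
  have z: "z \<in> V" using u by (simp add: z_def)
  have "nm (x n - z) \<le> 1 / t n * (nm (G (x n)) + nm (K (x n) - K u)) + \<bar>1 / t n - 1 / t0\<bar> * nm (K u)" for n
  proof -
    have "G (x n) + (K (x n) - K u) = t n *\<^sub>R x n - K u" by (simp add: G_def t_def)
    then have eq: "x n - z = (1 / t n) *\<^sub>R (G (x n) + (K (x n) - K u)) + (1 / t n - 1 / t0) *\<^sub>R K u"
      using tn(2)[of n] by (simp add: z_def algebra_simps)
    have "nm (x n - z) \<le> nm ((1 / t n) *\<^sub>R (G (x n) + (K (x n) - K u))) + nm ((1 / t n - 1 / t0) *\<^sub>R K u)"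
      unfolding eq using x u by (intro nm_triangle) simp_all
    also have "\<dots> = 1 / t n * nm (G (x n) + (K (x n) - K u)) + \<bar>1 / t n - 1 / t0\<bar> * nm (K u)"
      using x u tn[of n] by (simp add: nm_scale)
    also have "\<dots> \<le> 1 / t n * (nm (G (x n)) + nm (K (x n) - K u)) + \<bar>1 / t n - 1 / t0\<bar> * nm (K u)"
      using x u tn[of n] nm_triangle[of "G (x n)" "K (x n) - K u"] by (intro add_right_mono mult_left_mono) auto
    finally show ?thesis .
  qed
  moreover have "(\<lambda>n. 1 / t n * (nm (G (x n)) + nm (K (x n) - K u)) + \<bar>1 / t n - 1 / t0\<bar> * nm (K u)) \<longlonglongrightarrow>
     1 / t0 * (0 + 0) + \<bar>1 / t0 - 1 / t0\<bar> * nm (K u)"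
    by (intro tendsto_intros t Gx Ku) (use t0 in auto)
  then have "(\<lambda>n. 1 / t n * (nm (G (x n)) + nm (K (x n) - K u)) + \<bar>1 / t n - 1 / t0\<bar> * nm (K u)) \<longlonglongrightarrow> 0" by simp
  ultimately have "(\<lambda>n. nm (x n - z)) \<longlonglongrightarrow> 0"
    by (intro Lim_null_comparison[of "\<lambda>n. nm (x n - z)"]) auto
  then show ?thesis using that[OF strict_mono_o[OF r1 r2] z] by (simp add: x_def o_def)
qed

text \<open>
  The sign \<open>sg\<close> selects a side of the level set. A negative minimum over the closed side is not
  attained on the level set itself, where the energy is nonnegative, hence it is a local minimum.
\<close>

lemma one_sided_minimizer:
  assumes sg: "sg = 1 \<or> sg = - 1" and v0: "v0 \<in> V" "0 \<le> sg * (\<Psi> v0 - lam)" "E v0 < 0"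
  obtains u where "u \<in> V" "0 < sg * (\<Psi> u - lam)" "E u < 0" "\<And>\<phi>. \<phi> \<in> V \<Longrightarrow> B (G u) \<phi> = 0"
proof -
  define S where "S = {v \<in> V. 0 \<le> sg * (\<Psi> v - lam)}"
  define m where "m = Inf (E ` S)"
  have "- \<mu> * c\<^sub>H \<le> E v" if "v \<in> S" for v
  proof -
    have "0 \<le> a / 2 * B v v" using a B_nonneg[of v] by simp
    then show ?thesis using B_le_of_E_le[of v "E v"] that by (simp add: S_def)
  qed
  then have bdd: "bdd_below (E ` S)" by (auto simp: bdd_below_def)
  have m: "m \<le> E v" if "v \<in> S" for v unfolding m_def using bdd that by (intro cInf_lower) auto
  have v0S: "v0 \<in> S" using v0 by (simp add: S_def)
  have "\<exists>v\<in>S. E v < m + 1 / real (Suc n)" for n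
    using cInf_lessD[of "E ` S" "m + 1 / real (Suc n)"] v0S unfolding m_def by fastforce
  then obtain w where w: "\<And>n. w n \<in> S" "\<And>n. E (w n) < m + 1 / real (Suc n)" by metis
  have wV: "w n \<in> V" for n using w(1)[of n] by (simp add: S_def)
  define c where "c = (m + 1 + \<mu> * c\<^sub>H) * 2 / a"
  have le_one: "1 / real (Suc n) \<le> 1" for n by simp
  have Bw: "B (w n) (w n) \<le> c" for n
  proof -
    have "E (w n) \<le> m + 1" using w(2)[of n] le_one[of n] by linarith
    from B_le_of_E_le[OF wV this] show ?thesis using a unfolding c_def by (simp add: field_simps)
  qed
  then obtain r1 u where r1: "strict_mono r1" and u: "u \<in> V" and Qu: "(\<lambda>k. Q (w (r1 k) - u)) \<longlonglongrightarrow> 0"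
    using compact[of w c] wV by blast
  have "bounded (range (\<lambda>n. B (w (r1 n)) (w (r1 n))))"
    unfolding bounded_iff using Bw B_nonneg by (intro exI[of _ c]) auto
  then obtain l r2 where r2: "strict_mono r2" and l0: "((\<lambda>n. B (w (r1 n)) (w (r1 n))) \<circ> r2) \<longlonglongrightarrow> l"
    using bounded_imp_convergent_subsequence by blast
  define x where "x n = w (r1 (r2 n))" for n
  have x: "x n \<in> V" "B (x n) (x n) \<le> c" for n using wV Bw by (auto simp: x_def)
  have l: "(\<lambda>n. B (x n) (x n)) \<longlonglongrightarrow> l" using l0 by (simp add: x_def o_def)
  have Qx: "(\<lambda>n. Q (x n - u)) \<longlonglongrightarrow> 0"
    using LIMSEQ_subseq_LIMSEQ[OF Qu r2] by (simp add: x_def o_def)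
  \<comment> \<open>The locale assumption \<open>lsc\<close> asks for a bound valid for all indices,
    hence the passage to a tail with the bound \<open>l + e\<close>.\<close>
  have Bul: "B u u \<le> l"
  proof (rule field_le_epsilon)
    fix e :: real assume "e > 0"
    then have "\<forall>\<^sub>F n in sequentially. B (x n) (x n) < l + e" using l by (intro order_tendstoD(2)) auto
    then obtain N where N: "\<And>n. n \<ge> N \<Longrightarrow> B (x n) (x n) < l + e" by (auto simp: eventually_sequentially)
    show "B u u \<le> l + e"
      by (rule lsc[of "\<lambda>n. x (n + N)"])
        (use x u N LIMSEQ_ignore_initial_segment[OF Qx, of N] in \<open>auto intro: less_imp_le\<close>)
  qed
  have "nm (x n) \<le> sqrt c" for n using x(2)[of n] by (simp add: nm_def)
  then have "(\<lambda>n. \<Psi> (x n) - \<Psi> u) \<longlonglongrightarrow> 0"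
    using Qx x u by (intro \<Psi>_seq[of _ _ "max (sqrt c) (nm u)"]) (auto simp: le_max_iff_disj)
  then have \<Psi>x: "(\<lambda>n. \<Psi> (x n)) \<longlonglongrightarrow> \<Psi> u" by (simp add: LIM_zero_iff)
  have "isCont H t" for t using H_deriv DERIV_isCont by blast
  then have "(\<lambda>n. H (\<Psi> (x n) - lam)) \<longlonglongrightarrow> H (\<Psi> u - lam)"
    by (rule isCont_tendsto_compose) (intro tendsto_intros \<Psi>x)
  then have Elim: "(\<lambda>n. E (x n)) \<longlonglongrightarrow> a / 2 * l + b / 4 * l\<^sup>2 - \<mu> * H (\<Psi> u - lam)"
    unfolding E_def by (intro tendsto_intros l)
  have "(\<lambda>n. m + 1 / real (Suc n)) \<longlonglongrightarrow> m + 0"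
    by (intro tendsto_intros LIMSEQ_Suc[OF lim_1_over_n])
  then have "(\<lambda>n. m + 1 / real (Suc (r1 (r2 n)))) \<longlonglongrightarrow> m"
    using LIMSEQ_subseq_LIMSEQ[OF _ strict_mono_o[OF r1 r2], of "\<lambda>n. m + 1 / real (Suc n)" m] by (simp add: o_def)
  then have "a / 2 * l + b / 4 * l\<^sup>2 - \<mu> * H (\<Psi> u - lam) \<le> m"
    using Elim w(2) by (intro LIMSEQ_le[OF Elim]) (auto simp: x_def intro: less_imp_le)
  moreover have "a / 2 * B u u \<le> a / 2 * l" "b / 4 * (B u u)\<^sup>2 \<le> b / 4 * l\<^sup>2"
    using a b Bul B_nonneg[of u] by (auto intro!: mult_left_mono power_mono)
  ultimately have Eu: "E u \<le> m" unfolding E_def by linarith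
  then have Eneg: "E u < 0" using m[OF v0S] v0 by simp
  have "0 \<le> sg * (\<Psi> u - lam)"
  proof (rule LIMSEQ_le_const)
    show "(\<lambda>n. sg * (\<Psi> (x n) - lam)) \<longlonglongrightarrow> sg * (\<Psi> u - lam)" by (intro tendsto_intros \<Psi>x)
    show "\<exists>N. \<forall>n\<ge>N. 0 \<le> sg * (\<Psi> (x n) - lam)" using w(1) by (auto simp: x_def S_def)
  qed
  moreover have "\<Psi> u \<noteq> lam" using E_nonneg_on_level Eneg by force
  ultimately have pos: "0 < sg * (\<Psi> u - lam)" using sg by auto
  have "B (G u) \<phi> = 0" if \<phi>: "\<phi> \<in> V" for \<phi>
  proof -
    have "isCont (\<lambda>t. \<Psi> (u + t *\<^sub>R \<phi>)) 0" using \<Psi>_deriv[OF u \<phi>] by (rule DERIV_isCont)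
    then have "(\<lambda>t. sg * (\<Psi> (u + t *\<^sub>R \<phi>) - lam)) \<midarrow>0\<rightarrow> sg * (\<Psi> (u + 0 *\<^sub>R \<phi>) - lam)"
      unfolding isCont_def by (intro tendsto_intros)
    then have "\<forall>\<^sub>F t in at 0. 0 < sg * (\<Psi> (u + t *\<^sub>R \<phi>) - lam)"
      using pos by (intro order_tendstoD(1)) auto
    then obtain d where d: "d > 0" "\<And>t. t \<noteq> 0 \<Longrightarrow> \<bar>t\<bar> < d \<Longrightarrow> 0 < sg * (\<Psi> (u + t *\<^sub>R \<phi>) - lam)"
      unfolding eventually_at by (auto simp: dist_real_def)
    have "E (u + 0 *\<^sub>R \<phi>) \<le> E (u + t *\<^sub>R \<phi>)" if "\<bar>0 - t\<bar> < d" for t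
    proof (cases "t = 0")
      case False
      then have "u + t *\<^sub>R \<phi> \<in> S" using d(2)[of t] that u \<phi> by (simp add: S_def)
      then show ?thesis using m Eu by force
    qed simp
    then show ?thesis using DERIV_local_min[OF E_deriv[OF u \<phi>] d(1)] by blast
  qed
  then show ?thesis using that u pos Eneg by blast
qed

text \<open>The last line of the conclusion encodes distinctness: the side of the level set
  separates \<open>u1\<close> from \<open>u2\<close>, and the sign of the energy separates
  \<open>u3\<close> from both. In this form it survives identification of functions a.e.\<close>

theorem three_critical_points:
  assumes p: "p \<in> V" "\<Psi> p < lam" "E p < 0" and q: "q \<in> V" "lam < \<Psi> q" "E q < 0"
    and R: "nm p + nm (q - p) \<le> R"
  obtains u1 u2 u3 where
    "\<And>u \<phi>. u \<in> {u1, u2, u3} \<Longrightarrow> \<phi> \<in> V \<Longrightarrow> B (G u) \<phi> = 0"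
    "\<And>u. u \<in> {u1, u2, u3} \<Longrightarrow> u \<in> V \<and> a / 2 * B u u \<le> a / 2 * R\<^sup>2 + b / 4 * R^4 + \<mu> * c\<^sub>H"
    "\<Psi> u1 < lam" "lam < \<Psi> u2" "E u1 < 0" "E u2 < 0" "0 \<le> E u3"
proof -
  \<comment> \<open>The term with \<open>H\<close> only lowers the energy, so \<open>M\<close>
    bounds it on the segment from \<open>p\<close> to \<open>q\<close> independently of
    \<open>lam\<close>. The mountain pass level lies below \<open>M\<close> as well, and so do the
    two negative minima.\<close>
  define M where "M = a / 2 * R\<^sup>2 + b / 4 * R^4"
  have M0: "0 \<le> M" using a b by (simp add: M_def)
  obtain u1 where u1: "u1 \<in> V" "\<Psi> u1 < lam" "E u1 < 0" "\<And>\<phi>. \<phi> \<in> V \<Longrightarrow> B (G u1) \<phi> = 0"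
    by (rule one_sided_minimizer[of "- 1" p]) (use p in auto)
  obtain u2 where u2: "u2 \<in> V" "lam < \<Psi> u2" "E u2 < 0" "\<And>\<phi>. \<phi> \<in> V \<Longrightarrow> B (G u2) \<phi> = 0"
    by (rule one_sided_minimizer[of 1 q]) (use q in auto)
  have coercive: "\<exists>R. \<forall>u\<in>V. E u \<le> c \<longrightarrow> nm u \<le> R" for c
  proof -
    have "nm u \<le> sqrt ((c + \<mu> * c\<^sub>H) * 2 / a)" if "u \<in> V" "E u \<le> c" for u
      using B_le_of_E_le[OF that] a by (simp add: nm_def field_simps)
    then show ?thesis by blast
  qed
  have line: "E (p + t *\<^sub>R (q - p)) \<le> M" if t: "0 \<le> t" "t \<le> 1" for t
  proof -
    let ?u = "p + t *\<^sub>R (q - p)"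
    have "nm ?u \<le> nm p + t * nm (q - p)"
      using nm_triangle[of p "t *\<^sub>R (q - p)"] p q t by (simp add: nm_scale)
    also have "\<dots> \<le> R" using R t mult_right_mono[of t 1 "nm (q - p)"] by simp
    finally have "B ?u ?u \<le> R\<^sup>2" by (rule B_le_if_nm_le)
    then have "a / 2 * B ?u ?u \<le> a / 2 * R\<^sup>2" "b / 4 * (B ?u ?u)\<^sup>2 \<le> b / 4 * (R\<^sup>2)\<^sup>2"
      using a b B_nonneg by (intro mult_left_mono power_mono; simp)+
    moreover have "0 \<le> \<mu> * H (\<Psi> ?u - lam)" using mu H_nonneg by simp
    ultimately show ?thesis unfolding E_def M_def by simp
  qed
  have sep: "\<exists>t\<in>{0..1}. 0 \<le> E (\<gamma> t)" if \<gamma>: "nm_path \<gamma> p q" for \<gamma>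
  proof -
    have "continuous_on {0..1} (\<lambda>t. \<Psi> (\<gamma> t))"
      unfolding continuous_on_def
      using \<gamma> by (intro ballI psi.J_continuous_path) (auto simp: nm_path_def)
    then obtain t where "0 \<le> t" "t \<le> 1" "\<Psi> (\<gamma> t) = lam"
      using IVT'[of "\<lambda>t. \<Psi> (\<gamma> t)" 0 lam 1] p q \<gamma> by (auto simp: nm_path_def)
    then show ?thesis using E_nonneg_on_level[of "\<gamma> t"] by (intro bexI[of _ t]) simp_all
  qed
  obtain c where c: "0 \<le> c" "c \<le> M" "\<And>\<eta>. \<eta> > 0 \<Longrightarrow> \<exists>w\<in>V. \<bar>E w - c\<bar> \<le> \<eta> \<and> nm (G w) \<le> \<eta>"
    using energy.mountain_pass[OF coercive p(1) q(1) p(3) q(3) line sep] by metis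
  have "\<exists>w. w \<in> V \<and> \<bar>E w - c\<bar> \<le> 1 / real (Suc n) \<and> nm (G w) \<le> 1 / real (Suc n)" for n
    using c(3)[of "1 / real (Suc n)"] by auto
  then obtain w where w: "\<And>n. w n \<in> V" "\<And>n. \<bar>E (w n) - c\<bar> \<le> 1 / real (Suc n)"
    "\<And>n. nm (G (w n)) \<le> 1 / real (Suc n)" by metis
  have Gw: "(\<lambda>n. nm (G (w n))) \<longlonglongrightarrow> 0"
    by (rule Lim_null_comparison[OF _ LIMSEQ_Suc[OF lim_1_over_n]]) (use w(3) in simp)
  have "(\<lambda>n. E (w n) - c) \<longlonglongrightarrow> 0"
    by (rule Lim_null_comparison[OF _ LIMSEQ_Suc[OF lim_1_over_n]]) (use w(2) in simp)
  then have Ew: "(\<lambda>n. E (w n)) \<longlonglongrightarrow> c" by (simp add: LIM_zero_iff)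
  obtain R' where R': "\<And>u. u \<in> V \<Longrightarrow> E u \<le> c + 1 \<Longrightarrow> nm u \<le> R'" using coercive by blast
  have "E (w n) \<le> c + 1" for n
  proof -
    have "1 / real (Suc n) \<le> 1" by simp
    then show ?thesis using w(2)[of n] by linarith
  qed
  then have wR: "nm (w n) \<le> R'" for n using R' w by blast
  obtain r u3 where r: "strict_mono r" and u3: "u3 \<in> V" and lim: "(\<lambda>n. nm (w (r n) - u3)) \<longlonglongrightarrow> 0"
    by (rule palais_smale[OF w(1) wR Gw]) (use that in blast)
  have bds: "nm (w (r n)) \<le> max R' (nm u3)" "nm u3 \<le> max R' (nm u3)" for n
    using wR[of "r n"] by auto
  have "(\<lambda>n. nm (G (w (r n)) - G u3)) \<longlonglongrightarrow> 0"
    using w u3 bds lim by (intro G_seq) auto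
  then have "(\<lambda>n. nm (G (w (r n)) - G u3) + nm (G (w (r n)))) \<longlonglongrightarrow> 0 + 0"
    using LIMSEQ_subseq_LIMSEQ[OF Gw r] by (intro tendsto_add) (auto simp: o_def)
  then have "nm (G u3) \<le> 0 + 0"
  proof (rule LIMSEQ_le_const)
    have "nm (G u3) \<le> nm (G (w (r n)) - G u3) + nm (G (w (r n)))" for n
      using nm_triangle_rev[of "G (w (r n))" "G u3"] w u3 by auto
    then show "\<exists>N. \<forall>n\<ge>N. nm (G u3) \<le> nm (G (w (r n)) - G u3) + nm (G (w (r n)))" by blast
  qed
  then have crit: "B (G u3) \<phi> = 0" if "\<phi> \<in> V" for \<phi>
    using cauchy_schwarz[of "G u3" \<phi>] nm_nonneg[of "G u3"] u3 that by auto
  obtain C where C: "\<And>u v. u \<in> V \<Longrightarrow> v \<in> V \<Longrightarrow> nm u \<le> max R' (nm u3) \<Longrightarrow> nm v \<le> max R' (nm u3) \<Longrightarrow>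
      \<bar>E u - E v\<bar> \<le> C * nm (u - v)" using energy.J_lipschitz by meson
  have "\<bar>E (w (r n)) - E u3\<bar> \<le> C * nm (w (r n) - u3)" for n
    by (intro C w u3 bds)
  then have ev: "\<forall>\<^sub>F n in sequentially. norm (E (w (r n)) - E u3) \<le> C * nm (w (r n) - u3)" by simp
  have "(\<lambda>n. E (w (r n)) - E u3) \<longlonglongrightarrow> 0"
    by (rule Lim_null_comparison[OF ev tendsto_mult_right_zero[OF lim]])
  then have "(\<lambda>n. E (w (r n))) \<longlonglongrightarrow> E u3" by (simp add: LIM_zero_iff)
  moreover have "(\<lambda>n. E (w (r n))) \<longlonglongrightarrow> c" using LIMSEQ_subseq_LIMSEQ[OF Ew r] by (simp add: o_def)
  ultimately have "E u3 = c" by (rule LIMSEQ_unique)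
  then have "E u3 \<le> M" "0 \<le> E u3" using c by auto
  moreover have "E u1 \<le> M" "E u2 \<le> M" using u1 u2 M0 by auto
  ultimately show ?thesis
    using u1 u2 u3 crit B_le_of_E_le[of _ M] unfolding M_def by (intro that[of u1 u2 u3]) auto
qed

end

section \<open>Fractional Sobolev and Poincare inequalities\<close>

lemma unit_ball_vol_of_nat_nonzero [simp]: "unit_ball_vol (real k) \<noteq> 0"
  using unit_ball_vol_pos[of "real k"] by linarith

lemma gagliardo_kernel_nonneg [simp]: "0 \<le> gagliardo_kernel s x y"
  by (simp add: gagliardo_kernel_def)

lemma gagliardo_kernel_measurable [measurable]:
  fixes f g :: "'a \<Rightarrow> real ^ 'n"
  assumes [measurable]: "f \<in> borel_measurable M" "g \<in> borel_measurable M"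
  shows "(\<lambda>z. gagliardo_kernel s (f z) (g z)) \<in> borel_measurable M"
  unfolding gagliardo_kernel_def by measurable

text \<open>The inner integral of the Gagliardo double integral, kept as a function of
  \<open>x\<close> because the Sobolev and the Poincare inequality both come from integrating a
  pointwise lower bound for it.\<close>

definition gagliardo_density :: "real \<Rightarrow> (real ^ 'n \<Rightarrow> real) \<Rightarrow> real ^ 'n \<Rightarrow> ennreal" where
  "gagliardo_density s u x = (\<integral>\<^sup>+ y. ennreal (\<bar>u x - u y\<bar>\<^sup>2 / gagliardo_kernel s x y) \<partial>lborel)"

lemma gagliardo_density_measurable [measurable]:
  assumes [measurable]: "u \<in> borel_measurable borel"
  shows "gagliardo_density s u \<in> borel_measurable borel"
proof -
  have "gagliardo_density s u \<in> borel_measurable lborel"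
    unfolding gagliardo_density_def by measurable
  then show ?thesis by simp
qed

text \<open>\<open>T\<close> fills at most half of the ball of radius \<open>r\<close> about
  \<open>x\<close>. On the rest the numerator is at least \<open>m\<^sup>2\<close> and the kernel at
  most \<open>r powr (n + 2 * s)\<close>; multiplying by half the volume of the ball leaves the
  power \<open>- 2 * s\<close> of \<open>r\<close>.\<close>

lemma gagliardo_density_lower_bound:
  fixes u :: "real ^ 'n \<Rightarrow> real"
  assumes [measurable]: "u \<in> borel_measurable borel" "T \<in> sets borel"
    and "0 < r" "0 < m" "0 < s"
    and T: "emeasure lborel T \<le> ennreal (unit_ball_vol CARD('n) * r ^ CARD('n) / 2)"
    and far: "\<And>y. y \<notin> T \<Longrightarrow> m \<le> \<bar>u x - u y\<bar>"
  shows "ennreal (m\<^sup>2 * unit_ball_vol CARD('n) / 2 * r powr (- 2 * s)) \<le> gagliardo_density s u x"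
proof -
  let ?n = "CARD('n)"
  define v where "v = unit_ball_vol ?n * r ^ ?n"
  have v: "v > 0" using \<open>0 < r\<close> by (simp add: v_def)
  define c where "c = m\<^sup>2 / r powr (real ?n + 2 * s)"
  have c: "c > 0" using assms by (simp add: c_def)
  have "ennreal v = emeasure lborel (ball x r)"
    using \<open>0 < r\<close> by (simp add: emeasure_ball v_def)
  also have "\<dots> \<le> emeasure lborel ((ball x r - T) \<union> T)"
    by (intro emeasure_mono) auto
  also have "\<dots> \<le> emeasure lborel (ball x r - T) + emeasure lborel T"
    by (intro emeasure_subadditive) auto
  also have "\<dots> \<le> emeasure lborel (ball x r - T) + ennreal (v / 2)"
    using T by (intro add_left_mono) (simp add: v_def)
  finally have "ennreal v - ennreal (v / 2) \<le> emeasure lborel (ball x r - T)"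
    by (simp add: ennreal_minus_le_iff add.commute)
  then have "ennreal (v / 2) \<le> emeasure lborel (ball x r - T)"
    using v by (simp add: ennreal_minus)
  then have "ennreal c * ennreal (v / 2) \<le> ennreal c * emeasure lborel (ball x r - T)"
    by (intro mult_left_mono) auto
  also have "\<dots> = (\<integral>\<^sup>+ y. ennreal c * indicator (ball x r - T) y \<partial>lborel)"
    by (subst nn_integral_cmult_indicator) auto
  also have "\<dots> \<le> gagliardo_density s u x"
    unfolding gagliardo_density_def
  proof (intro nn_integral_mono)
    fix y
    show "ennreal c * indicator (ball x r - T) y \<le> ennreal (\<bar>u x - u y\<bar>\<^sup>2 / gagliardo_kernel s x y)"
    proof (cases "y \<in> ball x r - T")
      case True
      then have far_y: "m \<le> \<bar>u x - u y\<bar>" using far by blast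
      then have "x \<noteq> y" using \<open>0 < m\<close> by auto
      then have "0 < norm (x - y)" "norm (x - y) < r" using True by (auto simp: dist_norm)
      then have "0 < gagliardo_kernel s x y" "gagliardo_kernel s x y \<le> r powr (real ?n + 2 * s)"
        unfolding gagliardo_kernel_def using \<open>0 < s\<close> by (auto intro!: powr_mono2)
      then have "c \<le> \<bar>u x - u y\<bar>\<^sup>2 / gagliardo_kernel s x y"
        unfolding c_def using far_y \<open>0 < m\<close> by (intro frac_le power_mono) auto
      then show ?thesis using True by (simp add: ennreal_leI)
    qed simp
  qed
  also have "ennreal c * ennreal (v / 2) = ennreal (m\<^sup>2 * unit_ball_vol ?n / 2 * r powr (- 2 * s))"
  proof -
    have "r powr (- 2 * s) = r ^ ?n / r powr (real ?n + 2 * s)"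
      using \<open>0 < r\<close> by (simp add: powr_realpow[symmetric] powr_diff[symmetric])
    then have "c * (v / 2) = m\<^sup>2 * unit_ball_vol ?n / 2 * r powr (- 2 * s)"
      by (simp add: c_def v_def)
    then show ?thesis using c v by (simp flip: ennreal_mult)
  qed
  finally show ?thesis .
qed

text \<open>A pointwise Sobolev inequality. The lower bound for the density is of order
  \<open>\<bar>u x\<bar>\<^sup>2 * r powr (- 2 * s)\<close> with \<open>r ^ n\<close> proportional
  to \<open>A / \<bar>u x\<bar> powr p\<close>, so the exponent of \<open>\<bar>u x\<bar>\<close>
  becomes \<open>2 + 2 * s * p / n\<close>. That this equals \<open>p\<close> is precisely the
  criticality of \<open>p\<close>.\<close>

lemma powr_le_gagliardo_density:
  fixes u :: "real ^ 'n \<Rightarrow> real"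
  assumes s: "0 < s" "2 * s < real CARD('n)" and [measurable]: "u \<in> borel_measurable borel"
    and p: "p = 2 * real CARD('n) / (real CARD('n) - 2 * s)"
    and A: "0 < A" "(\<integral>\<^sup>+ y. ennreal (\<bar>u y\<bar> powr p) \<partial>lborel) \<le> ennreal A"
    and C: "C = 8 / unit_ball_vol CARD('n) * (2 powr (p + 1) / unit_ball_vol CARD('n)) powr (2 * s / real CARD('n))"
  shows "ennreal (\<bar>u x\<bar> powr p) \<le> ennreal (C * A powr (2 * s / real CARD('n))) * gagliardo_density s u x"
proof (cases "u x = 0")
  case True
  then show ?thesis by simp
next
  case False
  let ?n = "CARD('n)" and ?w = "unit_ball_vol (real CARD('n))"
  define t where "t = \<bar>u x\<bar>"
  have t: "t > 0" using False by (simp add: t_def)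
  have w: "?w > 0" by simp
  have p0: "p > 0" using s by (simp add: p)
  \<comment> \<open>The radius is such that, by Markov's inequality, \<open>\<bar>u y\<bar> \<le> \<bar>u x\<bar> / 2\<close> on at least half of the ball.\<close>
  define \<rho> where "\<rho> = 2 powr (p + 1) * A / (?w * t powr p)"
  have \<rho>: "\<rho> > 0" using A t by (simp add: \<rho>_def)
  define r where "r = \<rho> powr (1 / real ?n)"
  have r: "r > 0" "r ^ ?n = \<rho>"
    using \<rho> by (auto simp: r_def powr_powr simp flip: powr_realpow)
  define T where "T = {y. t / 2 < \<bar>u y\<bar>}"
  have [measurable]: "T \<in> sets borel" unfolding T_def by measurable
  have "ennreal ((t / 2) powr p) * emeasure lborel T = (\<integral>\<^sup>+ y. ennreal ((t / 2) powr p) * indicator T y \<partial>lborel)"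
    by (subst nn_integral_cmult_indicator) auto
  also have "\<dots> \<le> (\<integral>\<^sup>+ y. ennreal (\<bar>u y\<bar> powr p) \<partial>lborel)"
    using t p0 by (intro nn_integral_mono) (auto simp: T_def indicator_def intro!: ennreal_leI powr_mono2)
  finally have le: "ennreal ((t / 2) powr p) * emeasure lborel T \<le> ennreal A" using A(2) by (rule order_trans)
  have tp: "(t / 2) powr p > 0" using t by simp
  have "emeasure lborel T \<le> ennreal (A / (t / 2) powr p)"
  proof (cases "emeasure lborel T")
    case (real e)
    then have "(t / 2) powr p * e \<le> A" using le A by (simp flip: ennreal_mult)
    then have "e \<le> A / (t / 2) powr p" using tp by (simp add: pos_le_divide_eq mult.commute)
    then show ?thesis using real by (simp add: ennreal_leI)
  next
    case top
    then show ?thesis using le tp by (simp add: ennreal_mult_top top_unique)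
  qed
  also have "A / (t / 2) powr p = ?w * r ^ ?n / 2"
    unfolding r using t w by (simp add: \<rho>_def powr_divide powr_add field_simps)
  finally have T: "emeasure lborel T \<le> ennreal (?w * r ^ ?n / 2)" .
  have far: "t / 2 \<le> \<bar>u x - u y\<bar>" if "y \<notin> T" for y
    using that abs_triangle_ineq2[of "u x" "u y"] by (simp add: T_def t_def)
  have "ennreal ((t / 2)\<^sup>2 * ?w / 2 * r powr (- 2 * s)) \<le> gagliardo_density s u x"
    using r t s T far by (intro gagliardo_density_lower_bound[where T = T]) auto
  then have "ennreal (C * A powr (2 * s / real ?n)) * ennreal ((t / 2)\<^sup>2 * ?w / 2 * r powr (- 2 * s))
      \<le> ennreal (C * A powr (2 * s / real ?n)) * gagliardo_density s u x"
    by (intro mult_left_mono) auto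
  also have "ennreal (C * A powr (2 * s / real ?n)) * ennreal ((t / 2)\<^sup>2 * ?w / 2 * r powr (- 2 * s)) = ennreal (t powr p)"
  proof -
    let ?k = "2 * s / real ?n"
    have "r powr (- 2 * s) = \<rho> powr (- ?k)" by (simp add: r_def powr_powr)
    also have "\<dots> = inverse ((2 powr (p + 1) / ?w) powr ?k * A powr ?k / t powr (p * ?k))"
      unfolding powr_minus \<rho>_def by (simp add: powr_mult powr_divide powr_powr)
    finally have "(C * A powr ?k) * ((t / 2)\<^sup>2 * ?w / 2 * r powr (- 2 * s)) = t\<^sup>2 * t powr (p * ?k)"
      using A w t unfolding C by (simp add: field_simps power2_eq_square)
    also have "\<dots> = t powr (2 + p * ?k)" using t by (simp add: powr_add)
    also have "2 + p * ?k = p" using s by (simp add: p field_simps)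
    finally show ?thesis
      using C w by (subst ennreal_mult[symmetric]) auto
  qed
  finally show ?thesis by (simp add: t_def)
qed

text \<open>Integrating the pointwise inequality gives
  \<open>A \<le> C * A powr (2 * s / n) * N\<close> for the integral \<open>A\<close>. Dividing by
  the power of \<open>A\<close> is where finiteness enters; the remaining exponent
  \<open>1 - 2 * s / n\<close> is \<open>2 / p\<close>.\<close>

lemma sobolev_finite:
  fixes u :: "real ^ 'n \<Rightarrow> real"
  assumes s: "0 < s" "2 * s < real CARD('n)" and [measurable]: "u \<in> borel_measurable borel"
    and p: "p = 2 * real CARD('n) / (real CARD('n) - 2 * s)"
    and fin: "(\<integral>\<^sup>+ y. ennreal (\<bar>u y\<bar> powr p) \<partial>lborel) < \<infinity>"
    and N: "0 \<le> N" "(\<integral>\<^sup>+ x. gagliardo_density s u x \<partial>lborel) \<le> ennreal N"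
    and C: "C = 8 / unit_ball_vol CARD('n) * (2 powr (p + 1) / unit_ball_vol CARD('n)) powr (2 * s / real CARD('n))"
  shows "(\<integral>\<^sup>+ y. ennreal (\<bar>u y\<bar> powr p) \<partial>lborel) \<le> ennreal ((C * N) powr (p / 2))"
proof -
  let ?n = "real CARD('n)" and ?k = "2 * s / real CARD('n)"
  obtain A where A: "(\<integral>\<^sup>+ y. ennreal (\<bar>u y\<bar> powr p) \<partial>lborel) = ennreal A" "0 \<le> A"
    using fin by (cases "(\<integral>\<^sup>+ y. ennreal (\<bar>u y\<bar> powr p) \<partial>lborel)") auto
  have "unit_ball_vol ?n > 0" by simp
  then have C0: "C > 0" unfolding C by (intro mult_pos_pos divide_pos_pos) auto
  have "A \<le> (C * N) powr (p / 2)"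
  proof (cases "A = 0")
    case False
    then have A0: "A > 0" using A by simp
    have "ennreal A \<le> (\<integral>\<^sup>+ x. ennreal (C * A powr ?k) * gagliardo_density s u x \<partial>lborel)"
      unfolding A(1)[symmetric] using A A0 s p C
      by (intro nn_integral_mono powr_le_gagliardo_density) auto
    also have "\<dots> = ennreal (C * A powr ?k) * (\<integral>\<^sup>+ x. gagliardo_density s u x \<partial>lborel)"
      by (rule nn_integral_cmult) simp
    also have "\<dots> \<le> ennreal (C * A powr ?k) * ennreal N"
      using N by (intro mult_left_mono) auto
    also have "\<dots> = ennreal (C * A powr ?k * N)"
      using C0 N by (subst ennreal_mult) auto
    finally have "A \<le> C * A powr ?k * N"
      using C0 N by (simp add: ennreal_le_iff)
    then have "A * A powr (- ?k) \<le> C * N"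
      using A0 by (simp add: powr_minus field_simps)
    then have "A powr (1 - ?k) \<le> C * N"
      using powr_add[of A 1 "- ?k"] A0 by simp
    moreover have "0 \<le> p / 2" using s by (simp add: p)
    ultimately have "(A powr (1 - ?k)) powr (p / 2) \<le> (C * N) powr (p / 2)"
      by (intro powr_mono2) auto
    moreover have "(1 - ?k) * (p / 2) = 1" using s by (simp add: p field_simps)
    ultimately show ?thesis using A0 by (simp add: powr_powr)
  qed (use C0 N in auto)
  then show ?thesis using A by (simp add: ennreal_leI)
qed

text \<open>Truncation at height \<open>k\<close> makes the integral of the p-th power finite, since
  \<open>p > 2\<close> and \<open>u\<close> is square integrable, and it does not increase the
  Gagliardo density. Fatou's lemma removes the truncation.\<close>

lemma sobolev_borel:
  fixes u :: "real ^ 'n \<Rightarrow> real"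
  assumes s: "0 < s" "2 * s < real CARD('n)" and [measurable]: "u \<in> borel_measurable borel"
    and p: "p = 2 * real CARD('n) / (real CARD('n) - 2 * s)"
    and fin: "(\<integral>\<^sup>+ y. ennreal ((u y)\<^sup>2) \<partial>lborel) < \<infinity>"
    and N: "0 \<le> N" "(\<integral>\<^sup>+ x. gagliardo_density s u x \<partial>lborel) \<le> ennreal N"
    and C: "C = 8 / unit_ball_vol CARD('n) * (2 powr (p + 1) / unit_ball_vol CARD('n)) powr (2 * s / real CARD('n))"
  shows "(\<integral>\<^sup>+ y. ennreal (\<bar>u y\<bar> powr p) \<partial>lborel) \<le> ennreal ((C * N) powr (p / 2))"
proof -
  have p2: "p > 2" using s by (simp add: p field_simps)
  define c where "c k y = max (- real k) (min (real k) (u y))" for k y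
  have [measurable]: "c k \<in> borel_measurable borel" for k unfolding c_def by measurable
  have bound: "(\<integral>\<^sup>+ y. ennreal (\<bar>c k y\<bar> powr p) \<partial>lborel) \<le> ennreal ((C * N) powr (p / 2))" for k
  proof (rule sobolev_finite[OF s _ p _ N(1) _ C])
    have "\<bar>c k y\<bar> powr p \<le> real k powr (p - 2) * (u y)\<^sup>2" for y
    proof (cases "c k y = 0")
      case False
      have "\<bar>c k y\<bar> powr p = \<bar>c k y\<bar> powr (p - 2) * \<bar>c k y\<bar> powr 2"
        using powr_add[of "\<bar>c k y\<bar>" "p - 2" 2] by simp
      also have "\<dots> \<le> real k powr (p - 2) * \<bar>u y\<bar> powr 2"
        using p2 by (intro mult_mono powr_mono2) (auto simp: c_def)
      finally show ?thesis by simp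
    qed simp
    then have "(\<integral>\<^sup>+ y. ennreal (\<bar>c k y\<bar> powr p) \<partial>lborel) \<le> (\<integral>\<^sup>+ y. ennreal (real k powr (p - 2)) * ennreal ((u y)\<^sup>2) \<partial>lborel)"
      by (intro nn_integral_mono) (simp add: ennreal_leI flip: ennreal_mult)
    also have "\<dots> < \<infinity>"
      using fin by (subst nn_integral_cmult) (auto simp: ennreal_mult_less_top)
    finally show "(\<integral>\<^sup>+ y. ennreal (\<bar>c k y\<bar> powr p) \<partial>lborel) < \<infinity>" .
    have "\<bar>c k x - c k y\<bar> \<le> \<bar>u x - u y\<bar>" for x y by (auto simp: c_def)
    then have "gagliardo_density s (c k) x \<le> gagliardo_density s u x" for x
      unfolding gagliardo_density_def
      by (intro nn_integral_mono ennreal_leI divide_right_mono power_mono) auto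
    then show "(\<integral>\<^sup>+ x. gagliardo_density s (c k) x \<partial>lborel) \<le> ennreal N"
      using N(2) by (meson nn_integral_mono order_trans)
  qed simp
  have "liminf (\<lambda>k. ennreal (\<bar>c k y\<bar> powr p)) = ennreal (\<bar>u y\<bar> powr p)" for y
  proof -
    obtain k0 where k0: "\<bar>u y\<bar> \<le> real k0" using real_arch_simple by blast
    have "\<forall>\<^sub>F k in sequentially. ennreal (\<bar>u y\<bar> powr p) = ennreal (\<bar>c k y\<bar> powr p)"
      using eventually_ge_at_top[of k0]
    proof eventually_elim
      case (elim k)
      then have "\<bar>u y\<bar> \<le> real k" using k0 by linarith
      then have "c k y = u y" by (auto simp: c_def)
      then show ?case by simp
    qed
    then show ?thesis
      by (intro lim_imp_Liminf tendsto_eventually) (auto elim: eventually_mono)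
  qed
  then have "(\<integral>\<^sup>+ y. ennreal (\<bar>u y\<bar> powr p) \<partial>lborel) = (\<integral>\<^sup>+ y. liminf (\<lambda>k. ennreal (\<bar>c k y\<bar> powr p)) \<partial>lborel)"
    by simp
  also have "\<dots> \<le> liminf (\<lambda>k. \<integral>\<^sup>+ y. ennreal (\<bar>c k y\<bar> powr p) \<partial>lborel)"
    by (rule nn_integral_liminf) measurable
  also have "\<dots> \<le> ennreal ((C * N) powr (p / 2))"
    using bound by (intro Liminf_le) auto
  finally show ?thesis .
qed

text \<open>The lower bound for the density is applied with \<open>T = \<Omega>\<close>: outside
  \<Omega> the function vanishes, so the difference to \<open>u x\<close> is
  \<open>\<bar>u x\<bar>\<close>, and one radius serves all points.\<close>

lemma poincare_borel:
  fixes \<Omega> :: "(real ^ 'n) set"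
  assumes s: "0 < s" and \<Omega>: "open \<Omega>" "bounded \<Omega>"
  obtains C where "C > 0" "\<And>u. u \<in> borel_measurable borel \<Longrightarrow> (\<And>x. x \<notin> \<Omega> \<Longrightarrow> u x = 0) \<Longrightarrow>
    (\<integral>\<^sup>+ x. ennreal ((u x)\<^sup>2) \<partial>lborel) \<le> ennreal C * (\<integral>\<^sup>+ x. gagliardo_density s u x \<partial>lborel)"
proof -
  let ?n = "CARD('n)" and ?w = "unit_ball_vol (real CARD('n))"
  have w: "?w > 0" by simp
  have [measurable]: "\<Omega> \<in> sets borel" using \<Omega> by simp
  obtain v where v: "emeasure lborel \<Omega> = ennreal v" "0 \<le> v"
    using emeasure_bounded_finite[OF \<Omega>(2)] by (cases "emeasure lborel \<Omega>") auto
  \<comment> \<open>A ball of this radius has at least twice the volume of \<Omega>; the added 1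
    keeps the radius positive when \<Omega> is empty.\<close>
  define \<rho> where "\<rho> = 2 * v / ?w + 1"
  have \<rho>: "\<rho> > 0" using v by (simp add: \<rho>_def add_nonneg_pos)
  define r where "r = \<rho> powr (1 / real ?n)"
  have r: "r > 0" "r ^ ?n = \<rho>"
    using \<rho> by (auto simp: r_def powr_powr simp flip: powr_realpow)
  have "v \<le> ?w * r ^ ?n / 2" unfolding r \<rho>_def using v w by (simp add: field_simps del: unit_ball_vol_pos)
  then have T: "emeasure lborel \<Omega> \<le> ennreal (?w * r ^ ?n / 2)"
    unfolding v by (rule ennreal_leI)
  define D where "D = ?w / 2 * r powr (- 2 * s)"
  have D: "D > 0" using r by (simp add: D_def)
  have "(\<integral>\<^sup>+ x. ennreal ((u x)\<^sup>2) \<partial>lborel) \<le> ennreal (1 / D) * (\<integral>\<^sup>+ x. gagliardo_density s u x \<partial>lborel)"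
    if [measurable]: "u \<in> borel_measurable borel" and z: "\<And>x. x \<notin> \<Omega> \<Longrightarrow> u x = 0" for u
  proof -
    have "ennreal ((u x)\<^sup>2) \<le> ennreal (1 / D) * gagliardo_density s u x" for x
    proof (cases "u x = 0")
      case False
      have "ennreal (\<bar>u x\<bar>\<^sup>2 * ?w / 2 * r powr (- 2 * s)) \<le> gagliardo_density s u x"
        using r False s T z by (intro gagliardo_density_lower_bound[where T = \<Omega>]) auto
      then have "ennreal (1 / D) * ennreal (\<bar>u x\<bar>\<^sup>2 * ?w / 2 * r powr (- 2 * s)) \<le> ennreal (1 / D) * gagliardo_density s u x"
        by (intro mult_left_mono) auto
      also have "ennreal (1 / D) * ennreal (\<bar>u x\<bar>\<^sup>2 * ?w / 2 * r powr (- 2 * s)) = ennreal (1 / D * (\<bar>u x\<bar>\<^sup>2 * ?w / 2 * r powr (- 2 * s)))"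
        using D by (subst ennreal_mult[symmetric]) auto
      also have "1 / D * (\<bar>u x\<bar>\<^sup>2 * ?w / 2 * r powr (- 2 * s)) = (u x)\<^sup>2"
        using r by (simp add: D_def field_simps)
      finally show ?thesis .
    qed simp
    then have "(\<integral>\<^sup>+ x. ennreal ((u x)\<^sup>2) \<partial>lborel) \<le> (\<integral>\<^sup>+ x. ennreal (1 / D) * gagliardo_density s u x \<partial>lborel)"
      by (rule nn_integral_mono)
    also have "\<dots> = ennreal (1 / D) * (\<integral>\<^sup>+ x. gagliardo_density s u x \<partial>lborel)"
      by (rule nn_integral_cmult) simp
    finally show ?thesis .
  qed
  with that[of "1 / D"] D show ?thesis by simp
qed

section \<open>The space of functions vanishing outside the domain\<close>

lemma null_sets_lborel_Times:
  fixes N :: "'a::euclidean_space set" and N' :: "'b::euclidean_space set"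
  shows "N \<in> null_sets lborel \<Longrightarrow> N \<times> (UNIV :: 'b set) \<in> null_sets lborel"
    and "N' \<in> null_sets lborel \<Longrightarrow> (UNIV :: 'a set) \<times> N' \<in> null_sets lborel"
  unfolding lborel_prod[symmetric] null_sets_def
  by (auto simp: lborel.emeasure_pair_measure_Times)

lemma AE_lebesgue_pair:
  fixes P :: "'a::euclidean_space \<Rightarrow> bool"
  assumes "AE x in lebesgue. P x"
  shows "AE z in lebesgue. P (fst z) \<and> P (snd z)"
proof -
  have "AE x in lborel. P x" using assms by (simp only: AE_completion_iff)
  then obtain N where N: "N \<in> null_sets lborel" "{x. \<not> P x} \<subseteq> N"
    unfolding eventually_ae_filter by auto
  have "N \<times> UNIV \<union> UNIV \<times> N \<in> null_sets (lborel :: ('a \<times> 'a) measure)"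
    using N(1) by (intro null_sets.Un null_sets_lborel_Times)
  moreover have "{z. \<not> (P (fst z) \<and> P (snd z))} \<subseteq> N \<times> UNIV \<union> UNIV \<times> N"
    using N(2) by (auto simp: mem_Times_iff)
  ultimately have "AE z in lborel. P (fst z) \<and> P (snd z)"
    unfolding eventually_ae_filter by auto
  then show ?thesis by (simp only: AE_completion_iff)
qed

text \<open>Between completed measures, measurability also needs preimages of null sets to be
  negligible; here these are cylinders over null sets.\<close>

lemma measurable_lebesgue_projections [measurable]:
  "(fst :: 'a::euclidean_space \<times> 'b::euclidean_space \<Rightarrow> 'a) \<in> lebesgue \<rightarrow>\<^sub>M lebesgue"
  "(snd :: 'a \<times> 'b \<Rightarrow> 'b) \<in> lebesgue \<rightarrow>\<^sub>M lebesgue"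
proof -
  have f: "(fst :: 'a \<times> 'b \<Rightarrow> 'a) \<in> lebesgue \<rightarrow>\<^sub>M lborel" "(snd :: 'a \<times> 'b \<Rightarrow> 'b) \<in> lebesgue \<rightarrow>\<^sub>M lborel"
    by (rule measurable_completion, simp add: borel_measurable_continuous_onI continuous_on_fst continuous_on_snd)+
  have "N \<in> null_sets (distr lebesgue lborel (fst :: 'a \<times> 'b \<Rightarrow> 'a))" if "N \<in> null_sets lborel" for N
  proof -
    have "fst -` N \<inter> space lebesgue = N \<times> (UNIV :: 'b set)" by auto
    moreover have "N \<times> (UNIV :: 'b set) \<in> null_sets lebesgue"
      by (rule null_sets_completionI[OF null_sets_lborel_Times(1)[OF that]])
    ultimately show ?thesis using that f(1) by (simp add: null_sets_def emeasure_distr)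
  qed
  then show "(fst :: 'a \<times> 'b \<Rightarrow> 'a) \<in> lebesgue \<rightarrow>\<^sub>M lebesgue"
    by (intro completion.measurable_completion2 f) auto
  have "N \<in> null_sets (distr lebesgue lborel (snd :: 'a \<times> 'b \<Rightarrow> 'b))" if "N \<in> null_sets lborel" for N
  proof -
    have "snd -` N \<inter> space lebesgue = (UNIV :: 'a set) \<times> N" by auto
    moreover have "(UNIV :: 'a set) \<times> N \<in> null_sets lebesgue"
      by (rule null_sets_completionI[OF null_sets_lborel_Times(2)[OF that]])
    ultimately show ?thesis using that f(2) by (simp add: null_sets_def emeasure_distr)
  qed
  then show "(snd :: 'a \<times> 'b \<Rightarrow> 'b) \<in> lebesgue \<rightarrow>\<^sub>M lebesgue"
    by (intro completion.measurable_completion2 f) auto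
qed

lemma gagliardo_kernel_pair_measurable [measurable]:
  "(\<lambda>z. gagliardo_kernel s (fst z) (snd z)) \<in> borel_measurable lebesgue"
proof -
  have "(\<lambda>z::(real^'n) \<times> (real^'n). gagliardo_kernel s (fst z) (snd z)) \<in> borel_measurable borel"
    by (rule gagliardo_kernel_measurable)
      (simp_all add: borel_measurable_continuous_onI continuous_on_fst continuous_on_snd)
  then show ?thesis by (intro measurable_completion) simp
qed

text \<open>The Bochner integral \<open>gagliardo_sq\<close> is 0 by default when the quotient is
  not integrable. This version is then infinite, so its finiteness characterizes membership, and
  Tonelli and Fatou apply to it.\<close>

definition gagliardo_nn :: "real \<Rightarrow> (real ^ 'n \<Rightarrow> real) \<Rightarrow> ennreal" where
  "gagliardo_nn s u =
    (\<integral>\<^sup>+ z. ennreal (\<bar>u (fst z) - u (snd z)\<bar>\<^sup>2 / gagliardo_kernel s (fst z) (snd z)) \<partial>lebesgue)"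

lemma gagliardo_quotient_measurable [measurable]:
  assumes [measurable]: "u \<in> borel_measurable lebesgue" "v \<in> borel_measurable lebesgue"
  shows "(\<lambda>z. (u (fst z) - u (snd z)) * (v (fst z) - v (snd z)) / gagliardo_kernel s (fst z) (snd z))
      \<in> borel_measurable lebesgue"
    "(\<lambda>z. \<bar>u (fst z) - u (snd z)\<bar>\<^sup>2 / gagliardo_kernel s (fst z) (snd z)) \<in> borel_measurable lebesgue"
  by measurable

lemma gagliardo_nn_cong_AE:
  assumes "AE x in lebesgue. u x = v x"
  shows "gagliardo_nn s u = gagliardo_nn s v"
  unfolding gagliardo_nn_def using AE_lebesgue_pair[OF assms]
  by (intro nn_integral_cong_AE) (auto elim: eventually_mono)

lemma gagliardo_nn_borel:
  assumes [measurable]: "u \<in> borel_measurable borel"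
  shows "gagliardo_nn s u = (\<integral>\<^sup>+ x. gagliardo_density s u x \<partial>lborel)"
proof -
  let ?f = "\<lambda>z. ennreal (\<bar>u (fst z) - u (snd z)\<bar>\<^sup>2 / gagliardo_kernel s (fst z) (snd z))"
  have "gagliardo_nn s u = integral\<^sup>N (lborel \<Otimes>\<^sub>M lborel) ?f"
    unfolding gagliardo_nn_def nn_integral_completion lborel_prod ..
  also have "\<dots> = (\<integral>\<^sup>+ x. \<integral>\<^sup>+ y. ?f (x, y) \<partial>lborel \<partial>lborel)"
    by (rule lborel.nn_integral_fst[symmetric]) measurable
  finally show ?thesis by (simp add: gagliardo_density_def)
qed

lemma frac_sobolev_iff:
  "u \<in> frac_sobolev s \<longleftrightarrow> u \<in> borel_measurable lebesgue \<and> integrable lebesgue (\<lambda>x. (u x)\<^sup>2) \<and> gagliardo_nn s u < \<infinity>"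
  unfolding frac_sobolev_def gagliardo_nn_def
  by (auto simp: integrable_iff_bounded case_prod_beta')

lemma gagliardo_nn_eq:
  assumes "u \<in> frac_sobolev s"
  shows "gagliardo_nn s u = ennreal (gagliardo_sq s u)"
proof -
  have "integrable lebesgue (\<lambda>z. \<bar>u (fst z) - u (snd z)\<bar>\<^sup>2 / gagliardo_kernel s (fst z) (snd z))"
    using assms by (simp add: frac_sobolev_def case_prod_beta')
  then show ?thesis
    unfolding gagliardo_nn_def gagliardo_sq_def case_prod_beta'
    by (intro nn_integral_eq_integral) auto
qed

lemma gagliardo_form_self: "gagliardo_form s u u = gagliardo_sq s u"
  by (simp add: gagliardo_form_def gagliardo_sq_def power2_eq_square)

lemma gagliardo_sq_nonneg: "0 \<le> gagliardo_sq s u"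
  unfolding gagliardo_sq_def by (intro integral_nonneg_AE) auto

lemma gagliardo_sq_le_iff:
  assumes "u \<in> frac_sobolev s"
  shows "gagliardo_sq s u \<le> c \<longleftrightarrow> 0 \<le> c \<and> gagliardo_nn s u \<le> ennreal c"
  using gagliardo_nn_eq[OF assms] gagliardo_sq_nonneg[of s u] by (auto simp: ennreal_le_iff intro: ennreal_leI)

lemma gagliardo_form_commute: "gagliardo_form s u v = gagliardo_form s v u"
  by (simp add: gagliardo_form_def mult.commute)

lemma frac_sobolev_integrable_form:
  assumes "u \<in> frac_sobolev s" "v \<in> frac_sobolev s"
  shows "integrable lebesgue (\<lambda>z. (u (fst z) - u (snd z)) * (v (fst z) - v (snd z)) / gagliardo_kernel s (fst z) (snd z))"
proof (rule Bochner_Integration.integrable_bound)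
  let ?q = "\<lambda>u z. \<bar>u (fst z) - u (snd z)\<bar>\<^sup>2 / gagliardo_kernel s (fst z) (snd z)"
  show "integrable lebesgue (\<lambda>z. ?q u z + ?q v z)"
    using assms by (simp add: frac_sobolev_def case_prod_beta')
  have [measurable]: "u \<in> borel_measurable lebesgue" "v \<in> borel_measurable lebesgue"
    using assms by (auto simp: frac_sobolev_def)
  show "(\<lambda>z. (u (fst z) - u (snd z)) * (v (fst z) - v (snd z)) / gagliardo_kernel s (fst z) (snd z))
      \<in> borel_measurable lebesgue" by measurable
  have "\<bar>x * y\<bar> \<le> \<bar>x\<bar>\<^sup>2 + \<bar>y\<bar>\<^sup>2" for x y :: real
    using sum_squares_bound[of "\<bar>x\<bar>" "\<bar>y\<bar>"] mult_nonneg_nonneg[of "\<bar>x\<bar>" "\<bar>y\<bar>"]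
    unfolding abs_mult by linarith
  then show "AE z in lebesgue. norm ((u (fst z) - u (snd z)) * (v (fst z) - v (snd z)) / gagliardo_kernel s (fst z) (snd z))
      \<le> norm (?q u z + ?q v z)"
    by (auto simp: abs_divide divide_right_mono simp flip: add_divide_distrib)
qed

text \<open>The abstract locales need a type of class \<open>real_vector\<close>; the function
  spaces enter as subspaces of the type of all functions.\<close>

instantiation "fun" :: (type, real_vector) real_vector
begin

definition scaleR_fun :: "real \<Rightarrow> ('a \<Rightarrow> 'b) \<Rightarrow> 'a \<Rightarrow> 'b" where "scaleR_fun c u = (\<lambda>x. c *\<^sub>R u x)"

instance
  by standard (auto simp: scaleR_fun_def plus_fun_def scaleR_add_left scaleR_add_right)

end

lemmas fun_vector_simps = plus_fun_def fun_diff_def fun_Compl_def zero_fun_def scaleR_fun_def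

lemma gagliardo_form_add:
  assumes "u \<in> frac_sobolev s" "v \<in> frac_sobolev s" "w \<in> frac_sobolev s"
  shows "gagliardo_form s (u + v) w = gagliardo_form s u w + gagliardo_form s v w"
  using Bochner_Integration.integral_add[OF frac_sobolev_integrable_form[OF assms(1,3)] frac_sobolev_integrable_form[OF assms(2,3)]]
  by (simp add: gagliardo_form_def case_prod_beta' fun_vector_simps algebra_simps add_divide_distrib diff_divide_distrib)

lemma gagliardo_form_scale: "gagliardo_form s (c *\<^sub>R u) w = c * gagliardo_form s u w"
proof -
  have "gagliardo_form s (c *\<^sub>R u) w = (LINT z|lebesgue. c * ((u (fst z) - u (snd z)) * (w (fst z) - w (snd z)) / gagliardo_kernel s (fst z) (snd z)))"
    by (simp add: gagliardo_form_def case_prod_beta' fun_vector_simps algebra_simps)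
  also have "\<dots> = c * (LINT z|lebesgue. (u (fst z) - u (snd z)) * (w (fst z) - w (snd z)) / gagliardo_kernel s (fst z) (snd z))"
    by (rule integral_mult_right_zero)
  finally show ?thesis by (simp add: gagliardo_form_def case_prod_beta')
qed

lemma subspace_frac_sobolev: "subspace (frac_sobolev s)"
proof (rule subspaceI)
  show "0 \<in> frac_sobolev s"
    by (simp add: frac_sobolev_def fun_vector_simps case_prod_beta')
next
  fix u :: "real ^ 'n \<Rightarrow> real" and c assume u: "u \<in> frac_sobolev s"
  then have "integrable lebesgue (\<lambda>z. c\<^sup>2 * (\<bar>u (fst z) - u (snd z)\<bar>\<^sup>2 / gagliardo_kernel s (fst z) (snd z)))"
    by (intro integrable_mult_right) (simp add: frac_sobolev_def case_prod_beta')
  moreover have "c\<^sup>2 * (\<bar>x - y\<bar>\<^sup>2 / k) = \<bar>c * x - c * y\<bar>\<^sup>2 / k" for x y k :: real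
    by (simp add: power_mult_distrib flip: right_diff_distrib)
  ultimately have "integrable lebesgue (\<lambda>(x, y). \<bar>(c *\<^sub>R u) x - (c *\<^sub>R u) y\<bar>\<^sup>2 / gagliardo_kernel s x y)"
    by (simp only: case_prod_beta' scaleR_fun_def real_scaleR_def)
  then show "c *\<^sub>R u \<in> frac_sobolev s"
    using u by (simp add: frac_sobolev_def scaleR_fun_def power_mult_distrib borel_measurable_times)
next
  fix u v :: "real ^ 'n \<Rightarrow> real" assume u: "u \<in> frac_sobolev s" and v: "v \<in> frac_sobolev s"
  have [measurable]: "u \<in> borel_measurable lebesgue" "v \<in> borel_measurable lebesgue"
    using u v by (auto simp: frac_sobolev_def)
  have abs_mono: "\<bar>x\<bar> \<le> \<bar>y\<bar>" if "0 \<le> x" "x \<le> y" for x y :: real using that by simp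
  have sq: "(x + y)\<^sup>2 \<le> 2 * x\<^sup>2 + 2 * y\<^sup>2" for x y :: real
    using sum_squares_bound[of x y] by (simp add: power2_sum)
  have "integrable lebesgue (\<lambda>x. (u x + v x)\<^sup>2)"
  proof (rule Bochner_Integration.integrable_bound)
    show "integrable lebesgue (\<lambda>x. 2 * (u x)\<^sup>2 + 2 * (v x)\<^sup>2)"
      using u v by (simp add: frac_sobolev_def)
  qed (use sq in auto)
  moreover have "integrable lebesgue (\<lambda>z. \<bar>u (fst z) + v (fst z) - (u (snd z) + v (snd z))\<bar>\<^sup>2 / gagliardo_kernel s (fst z) (snd z))"
  proof (rule Bochner_Integration.integrable_bound)
    let ?q = "\<lambda>u z. \<bar>u (fst z) - u (snd z)\<bar>\<^sup>2 / gagliardo_kernel s (fst z) (snd z)"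
    show "integrable lebesgue (\<lambda>z. 2 * ?q u z + 2 * ?q v z)"
      using u v by (intro Bochner_Integration.integrable_add integrable_mult_right)
        (simp_all add: frac_sobolev_def case_prod_beta')
    have "\<bar>u (fst z) + v (fst z) - (u (snd z) + v (snd z))\<bar>\<^sup>2 / gagliardo_kernel s (fst z) (snd z)
        \<le> 2 * ?q u z + 2 * ?q v z" for z
    proof -
      have "\<bar>u (fst z) + v (fst z) - (u (snd z) + v (snd z))\<bar>\<^sup>2 \<le>
          2 * \<bar>u (fst z) - u (snd z)\<bar>\<^sup>2 + 2 * \<bar>v (fst z) - v (snd z)\<bar>\<^sup>2"
        using sq[of "u (fst z) - u (snd z)" "v (fst z) - v (snd z)"] by (simp add: algebra_simps)
      from divide_right_mono[OF this gagliardo_kernel_nonneg[of s "fst z" "snd z"]] show ?thesis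
        by (simp add: add_divide_distrib)
    qed
    then show "AE z in lebesgue. norm (\<bar>u (fst z) + v (fst z) - (u (snd z) + v (snd z))\<bar>\<^sup>2 / gagliardo_kernel s (fst z) (snd z))
        \<le> norm (2 * ?q u z + 2 * ?q v z)"
      unfolding real_norm_def by (intro always_eventually allI abs_mono) auto
  qed measurable
  ultimately show "u + v \<in> frac_sobolev s"
    by (simp add: frac_sobolev_def fun_vector_simps case_prod_beta')
qed

lemma subspace_frac_sobolev0: "subspace (frac_sobolev0 s \<Omega>)"
proof (rule subspaceI)
  show "0 \<in> frac_sobolev0 s \<Omega>"
    using subspace_0[OF subspace_frac_sobolev] by (simp add: frac_sobolev0_def zero_fun_def)
next
  fix u and c :: real assume "u \<in> frac_sobolev0 s \<Omega>"
  then show "c *\<^sub>R u \<in> frac_sobolev0 s \<Omega>"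
    using subspace_scale[OF subspace_frac_sobolev, of u s c]
    by (auto simp: frac_sobolev0_def scaleR_fun_def elim: eventually_mono)
next
  fix u v assume uv: "u \<in> frac_sobolev0 s \<Omega>" "v \<in> frac_sobolev0 s \<Omega>"
  have "AE x in lebesgue. x \<notin> \<Omega> \<longrightarrow> u x = 0" "AE x in lebesgue. x \<notin> \<Omega> \<longrightarrow> v x = 0"
    using uv by (auto simp: frac_sobolev0_def)
  then have "AE x in lebesgue. x \<notin> \<Omega> \<longrightarrow> u x + v x = 0" by eventually_elim simp
  then show "u + v \<in> frac_sobolev0 s \<Omega>"
    using subspace_add[OF subspace_frac_sobolev, of u s v] uv
    by (simp add: frac_sobolev0_def plus_fun_def)
qed

text \<open>The inequalities above concern Borel functions that vanish everywhere outside \<Omega>.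
  The modification takes place on a null set, which changes no integral.\<close>

lemma frac_sobolev0_borel_representative:
  assumes u: "u \<in> frac_sobolev0 s \<Omega>" and \<Omega>: "open \<Omega>"
  obtains v where "v \<in> borel_measurable borel" "\<And>x. x \<notin> \<Omega> \<Longrightarrow> v x = 0" "AE x in lebesgue. u x = v x"
    "(\<integral>\<^sup>+ x. gagliardo_density s v x \<partial>lborel) = ennreal (gagliardo_sq s u)"
proof -
  have um: "u \<in> borel_measurable lebesgue" and us: "u \<in> frac_sobolev s"
    and z: "AE x in lebesgue. x \<notin> \<Omega> \<longrightarrow> u x = 0"
    using u by (auto simp: frac_sobolev0_def frac_sobolev_def)
  obtain v where v: "v \<in> borel_measurable lborel" "AE x in lborel. u x = v x"
    using completion_ex_borel_measurable_real[OF um] by auto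
  define v' where "v' x = v x * indicator \<Omega> x" for x
  have [measurable]: "v \<in> borel_measurable borel" "\<Omega> \<in> sets borel" using v \<Omega> by auto
  have v'm: "v' \<in> borel_measurable borel" unfolding v'_def by measurable
  have eq: "AE x in lebesgue. u x = v' x"
    using z AE_completion[OF v(2)] by eventually_elim (auto simp: v'_def indicator_def)
  show ?thesis
  proof (rule that[of v'])
    show "(\<integral>\<^sup>+ x. gagliardo_density s v' x \<partial>lborel) = ennreal (gagliardo_sq s u)"
      using gagliardo_nn_borel[OF v'm] gagliardo_nn_cong_AE[OF eq] gagliardo_nn_eq[OF us] by simp
  qed (use v'm eq in \<open>auto simp: v'_def\<close>)
qed

lemma gagliardo_nn_fatou:
  assumes [measurable]: "\<And>k::nat. w k \<in> borel_measurable lebesgue" "u \<in> borel_measurable lebesgue"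
    and lim: "AE x in lebesgue. (\<lambda>k. w k x) \<longlonglongrightarrow> u x"
    and le: "\<And>k. gagliardo_nn s (w k) \<le> R"
  shows "gagliardo_nn s u \<le> R"
proof -
  let ?q = "\<lambda>u z. \<bar>u (fst z) - u (snd z)\<bar>\<^sup>2 / gagliardo_kernel s (fst z) (snd z)"
  have "AE z in lebesgue. ennreal (?q u z) = liminf (\<lambda>k. ennreal (?q (w k) z))"
    using AE_lebesgue_pair[OF lim]
  proof eventually_elim
    case (elim z)
    \<comment> \<open>On the diagonal the kernel is 0 and all quotients are 0 by the convention for
      division.\<close>
    then have "(\<lambda>k. ennreal (?q (w k) z)) \<longlonglongrightarrow> ennreal (?q u z)"
      by (cases "gagliardo_kernel s (fst z) (snd z) = 0") (auto intro!: tendsto_intros)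
    from lim_imp_Liminf[OF sequentially_bot this] show ?case by (rule sym)
  qed
  then have "gagliardo_nn s u = (\<integral>\<^sup>+ z. liminf (\<lambda>k. ennreal (?q (w k) z)) \<partial>lebesgue)"
    unfolding gagliardo_nn_def by (rule nn_integral_cong_AE)
  also have "\<dots> \<le> liminf (\<lambda>k. gagliardo_nn s (w k))"
    unfolding gagliardo_nn_def by (rule nn_integral_liminf) measurable
  also have "\<dots> \<le> R"
    using le by (intro Liminf_le) auto
  finally show ?thesis .
qed

lemma frac_sobolev0_sobolev:
  fixes \<Omega> :: "(real ^ 'n) set"
  assumes s: "0 < s" "2 * s < real CARD('n)" and \<Omega>: "open \<Omega>"
    and p: "p = 2 * real CARD('n) / (real CARD('n) - 2 * s)"
  shows "\<exists>C>0. \<forall>u\<in>frac_sobolev0 s \<Omega>.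
    integrable lebesgue (\<lambda>x. \<bar>u x\<bar> powr p) \<and> (LINT x|lebesgue. \<bar>u x\<bar> powr p) \<le> (C * gagliardo_sq s u) powr (p / 2)"
proof -
  define C where "C = 8 / unit_ball_vol CARD('n) * (2 powr (p + 1) / unit_ball_vol CARD('n)) powr (2 * s / real CARD('n))"
  have "unit_ball_vol (real CARD('n)) > 0" by simp
  then have C: "C > 0" unfolding C_def by (intro mult_pos_pos divide_pos_pos) auto
  have "integrable lebesgue (\<lambda>x. \<bar>u x\<bar> powr p) \<and> (LINT x|lebesgue. \<bar>u x\<bar> powr p) \<le> (C * gagliardo_sq s u) powr (p / 2)"
    if u: "u \<in> frac_sobolev0 s \<Omega>" for u
  proof -
    have [measurable]: "u \<in> borel_measurable lebesgue" and sq: "integrable lebesgue (\<lambda>x. (u x)\<^sup>2)"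
      using u by (auto simp: frac_sobolev0_def frac_sobolev_def)
    obtain v where v: "v \<in> borel_measurable borel" "AE x in lebesgue. u x = v x"
      "(\<integral>\<^sup>+ x. gagliardo_density s v x \<partial>lborel) = ennreal (gagliardo_sq s u)"
      using frac_sobolev0_borel_representative[OF u \<Omega>] by metis
    have "(\<integral>\<^sup>+ x. ennreal ((v x)\<^sup>2) \<partial>lborel) = (\<integral>\<^sup>+ x. ennreal ((u x)\<^sup>2) \<partial>lebesgue)"
      unfolding nn_integral_completion[symmetric, of lborel]
      using v(2) by (intro nn_integral_cong_AE) (auto elim: eventually_mono)
    also have "\<dots> < \<infinity>" using sq by (simp add: integrable_iff_bounded)
    finally have "(\<integral>\<^sup>+ x. ennreal (\<bar>v x\<bar> powr p) \<partial>lborel) \<le> ennreal ((C * gagliardo_sq s u) powr (p / 2))"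
      using v gagliardo_sq_nonneg by (intro sobolev_borel[OF s _ p]) (auto simp: C_def)
    also have "(\<integral>\<^sup>+ x. ennreal (\<bar>v x\<bar> powr p) \<partial>lborel) = (\<integral>\<^sup>+ x. ennreal (\<bar>u x\<bar> powr p) \<partial>lebesgue)"
      unfolding nn_integral_completion[symmetric, of lborel]
      using v(2) by (intro nn_integral_cong_AE) (auto elim: eventually_mono)
    finally have le: "(\<integral>\<^sup>+ x. ennreal (\<bar>u x\<bar> powr p) \<partial>lebesgue) \<le> ennreal ((C * gagliardo_sq s u) powr (p / 2))" .
    then have int: "integrable lebesgue (\<lambda>x. \<bar>u x\<bar> powr p)"
      by (auto simp: integrable_iff_bounded intro: le_less_trans)
    moreover have "(\<integral>\<^sup>+ x. ennreal (\<bar>u x\<bar> powr p) \<partial>lebesgue) = ennreal (LINT x|lebesgue. \<bar>u x\<bar> powr p)"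
      by (rule nn_integral_eq_integral[OF int]) auto
    ultimately show ?thesis using le by (simp add: ennreal_le_iff)
  qed
  then show ?thesis using C by blast
qed

text \<open>The second half derives square integrability from a finite seminorm and vanishing
  outside \<Omega>. It is the membership test for limits of sequences and for Lipschitz test
  functions.\<close>

lemma frac_sobolev0_poincare:
  fixes \<Omega> :: "(real ^ 'n) set"
  assumes s: "0 < s" and \<Omega>: "open \<Omega>" "bounded \<Omega>"
  shows "\<exists>C>0. (\<forall>u\<in>frac_sobolev0 s \<Omega>. (LINT x|lebesgue. (u x)\<^sup>2) \<le> C * gagliardo_sq s u) \<and>
    (\<forall>u\<in>borel_measurable lebesgue. gagliardo_nn s u < \<infinity> \<longrightarrow> (AE x in lebesgue. x \<notin> \<Omega> \<longrightarrow> u x = 0) \<longrightarrow>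
      u \<in> frac_sobolev0 s \<Omega>)"
proof -
  obtain C where C: "C > 0" "\<And>u. u \<in> borel_measurable borel \<Longrightarrow> (\<And>x. x \<notin> \<Omega> \<Longrightarrow> u x = 0) \<Longrightarrow>
    (\<integral>\<^sup>+ x. ennreal ((u x)\<^sup>2) \<partial>lborel) \<le> ennreal C * (\<integral>\<^sup>+ x. gagliardo_density s u x \<partial>lborel)"
    using poincare_borel[OF s \<Omega>] by metis
  have nn: "(\<integral>\<^sup>+ x. ennreal ((u x)\<^sup>2) \<partial>lebesgue) \<le> ennreal C * gagliardo_nn s u"
    if u: "u \<in> borel_measurable lebesgue" "AE x in lebesgue. x \<notin> \<Omega> \<longrightarrow> u x = 0" for u
  proof -
    obtain v where v: "v \<in> borel_measurable lborel" "AE x in lborel. u x = v x"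
      using completion_ex_borel_measurable_real[OF u(1)] by auto
    define v' where "v' x = v x * indicator \<Omega> x" for x
    have [measurable]: "v \<in> borel_measurable borel" "\<Omega> \<in> sets borel" using v \<Omega> by auto
    have v'm: "v' \<in> borel_measurable borel" unfolding v'_def by measurable
    have eq: "AE x in lebesgue. u x = v' x"
      using u(2) AE_completion[OF v(2)] by eventually_elim (auto simp: v'_def indicator_def)
    have "(\<integral>\<^sup>+ x. ennreal ((u x)\<^sup>2) \<partial>lebesgue) = (\<integral>\<^sup>+ x. ennreal ((v' x)\<^sup>2) \<partial>lborel)"
      unfolding nn_integral_completion[symmetric, of lborel]
      using eq by (intro nn_integral_cong_AE) (auto elim: eventually_mono)
    also have "\<dots> \<le> ennreal C * (\<integral>\<^sup>+ x. gagliardo_density s v' x \<partial>lborel)"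
      by (rule C(2)[OF v'm]) (simp add: v'_def)
    also have "\<dots> = ennreal C * gagliardo_nn s u"
      using gagliardo_nn_borel[OF v'm] gagliardo_nn_cong_AE[OF eq] by simp
    finally show ?thesis .
  qed
  show ?thesis
  proof (intro exI[of _ C] conjI ballI impI)
    fix u assume u: "u \<in> frac_sobolev0 s \<Omega>"
    then have us: "u \<in> frac_sobolev s" by (simp add: frac_sobolev0_def)
    have "ennreal (LINT x|lebesgue. (u x)\<^sup>2) = (\<integral>\<^sup>+ x. ennreal ((u x)\<^sup>2) \<partial>lebesgue)"
      using us by (intro nn_integral_eq_integral[symmetric]) (auto simp: frac_sobolev_def)
    also have "\<dots> \<le> ennreal C * gagliardo_nn s u"
      using u by (intro nn) (auto simp: frac_sobolev0_def frac_sobolev_def)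
    also have "\<dots> = ennreal (C * gagliardo_sq s u)"
      using gagliardo_nn_eq[OF us] C(1) gagliardo_sq_nonneg[of s u] by (simp add: ennreal_mult)
    finally show "(LINT x|lebesgue. (u x)\<^sup>2) \<le> C * gagliardo_sq s u"
      using C(1) gagliardo_sq_nonneg[of s u] by (simp add: ennreal_le_iff)
  next
    fix u :: "real ^ 'n \<Rightarrow> real"
    assume u: "u \<in> borel_measurable lebesgue" "gagliardo_nn s u < \<infinity>" "AE x in lebesgue. x \<notin> \<Omega> \<longrightarrow> u x = 0"
    then have "(\<integral>\<^sup>+ x. ennreal ((u x)\<^sup>2) \<partial>lebesgue) < \<infinity>"
      using nn[OF u(1,3)] by (auto simp: ennreal_mult_less_top intro: le_less_trans)
    then have "integrable lebesgue (\<lambda>x. (u x)\<^sup>2)"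
      using u(1) by (simp add: integrable_iff_bounded)
    then show "u \<in> frac_sobolev0 s \<Omega>"
      using u by (simp add: frac_sobolev0_def frac_sobolev_iff)
  qed (rule C(1))
qed

section \<open>Compact embedding\<close>

text \<open>Riesz-Fischer argument. Along a subsequence the squared increments have integrals at
  most \<open>(1/8)^j\<close>; weighted by \<open>4^j\<close> they are still summable, so almost
  everywhere the increments are bounded by a multiple of \<open>(1/2)^j\<close> and their
  telescoping series converges.\<close>

lemma L2_Cauchy_imp_AE_convergent_subseq:
  fixes f :: "nat \<Rightarrow> 'a \<Rightarrow> real"
  assumes meas [measurable]: "\<And>k. f k \<in> borel_measurable M"
    and cauchy: "\<And>e. e > 0 \<Longrightarrow> \<exists>N. \<forall>k\<ge>N. \<forall>l\<ge>N. (\<integral>\<^sup>+ x. ennreal ((f k x - f l x)\<^sup>2) \<partial>M) \<le> ennreal e"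
  obtains r where "strict_mono (r :: nat \<Rightarrow> nat)" "AE x in M. convergent (\<lambda>k. f (r k) x)"
proof -
  have "\<exists>r. strict_mono (r :: nat \<Rightarrow> nat) \<and>
    (\<forall>j. \<forall>l\<ge>r j. (\<integral>\<^sup>+ x. ennreal ((f (r j) x - f l x)\<^sup>2) \<partial>M) \<le> ennreal ((1/8)^j))"
  proof -
    have "\<exists>r. \<forall>j. (\<forall>l\<ge>r j. (\<integral>\<^sup>+ x. ennreal ((f (r j) x - f l x)\<^sup>2) \<partial>M) \<le> ennreal ((1/8)^j)) \<and> r j < (r (Suc j) :: nat)"
    proof (rule dependent_nat_choice)
      show "\<exists>x::nat. \<forall>l\<ge>x. (\<integral>\<^sup>+ y. ennreal ((f x y - f l y)\<^sup>2) \<partial>M) \<le> ennreal ((1/8)^0)"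
        using cauchy[of 1] by auto
      fix x :: nat and n
      obtain N where N: "\<forall>k\<ge>N. \<forall>l\<ge>N. (\<integral>\<^sup>+ x. ennreal ((f k x - f l x)\<^sup>2) \<partial>M) \<le> ennreal ((1/8)^Suc n)"
        using cauchy[of "(1/8)^Suc n"] by auto
      show "\<exists>y. (\<forall>l\<ge>y. (\<integral>\<^sup>+ x. ennreal ((f y x - f l x)\<^sup>2) \<partial>M) \<le> ennreal ((1/8)^Suc n)) \<and> x < y"
        using N by (intro exI[of _ "max N (Suc x)"]) auto
    qed
    then obtain r where "\<And>j. (\<forall>l\<ge>r j. (\<integral>\<^sup>+ x. ennreal ((f (r j) x - f l x)\<^sup>2) \<partial>M) \<le> ennreal ((1/8)^j))"
       "\<And>j. r j < (r (Suc j) :: nat)" by blast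
    then show ?thesis by (intro exI[of _ r]) (auto simp: strict_mono_Suc_iff)
  qed
  then obtain r :: "nat \<Rightarrow> nat" where r: "strict_mono r"
    "\<And>j l. l \<ge> r j \<Longrightarrow> (\<integral>\<^sup>+ x. ennreal ((f (r j) x - f l x)\<^sup>2) \<partial>M) \<le> ennreal ((1/8)^j)" by blast
  define \<Delta> where "\<Delta> j x = f (r (Suc j)) x - f (r j) x" for j x
  have [measurable]: "\<Delta> j \<in> borel_measurable M" for j unfolding \<Delta>_def by measurable
  have "(\<integral>\<^sup>+ x. (\<Sum>j. ennreal (4^j * (\<Delta> j x)\<^sup>2)) \<partial>M) = (\<Sum>j. \<integral>\<^sup>+ x. ennreal (4^j * (\<Delta> j x)\<^sup>2) \<partial>M)"
    by (rule nn_integral_suminf) measurable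
  also have "\<dots> \<le> (\<Sum>j. ennreal ((1/2)^j))"
  proof (rule suminf_le)
    fix j
    have "(\<integral>\<^sup>+ x. ennreal (4^j * (\<Delta> j x)\<^sup>2) \<partial>M) = ennreal (4^j) * (\<integral>\<^sup>+ x. ennreal ((f (r j) x - f (r (Suc j)) x)\<^sup>2) \<partial>M)"
      by (subst nn_integral_cmult[symmetric]) (auto simp: \<Delta>_def power2_commute ennreal_mult)
    also have "\<dots> \<le> ennreal (4^j) * ennreal ((1/8)^j)"
      using r(1) by (intro mult_left_mono r(2)) (auto simp: strict_mono_less_eq)
    also have "\<dots> = ennreal ((1/2)^j)"
      by (subst ennreal_mult[symmetric]) (auto simp: power_mult_distrib[symmetric])
    finally show "(\<integral>\<^sup>+ x. ennreal (4^j * (\<Delta> j x)\<^sup>2) \<partial>M) \<le> ennreal ((1/2)^j)" .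
  qed auto
  also have "\<dots> = ennreal (\<Sum>j. (1/2)^j)"
    by (intro suminf_ennreal2) (auto intro: summable_geometric)
  finally have "(\<integral>\<^sup>+ x. (\<Sum>j. ennreal (4^j * (\<Delta> j x)\<^sup>2)) \<partial>M) \<noteq> \<infinity>"
    by (auto simp: top_unique)
  then have "AE x in M. (\<Sum>j. ennreal (4^j * (\<Delta> j x)\<^sup>2)) \<noteq> \<infinity>"
    by (intro nn_integral_PInf_AE) auto
  then have "AE x in M. convergent (\<lambda>k. f (r k) x)"
  proof eventually_elim
    case (elim x)
    then have "summable (\<lambda>j. 4^j * (\<Delta> j x)\<^sup>2)"
      by (intro summable_suminf_not_top) auto
    then obtain K where K: "\<And>j. norm (4^j * (\<Delta> j x)\<^sup>2) \<le> K"
      using summable_imp_Bseq unfolding Bseq_def by blast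
    have "norm (\<Delta> j x) \<le> sqrt K * (1/2)^j" for j
    proof -
      have "(2^j * \<bar>\<Delta> j x\<bar>)\<^sup>2 \<le> K"
      proof -
        have "(4::real)^j = (2^j)\<^sup>2"
          using power_mult_distrib[of "2::real" 2 j] by (simp add: power2_eq_square)
        then have "(2^j * \<bar>\<Delta> j x\<bar>)\<^sup>2 = 4^j * (\<Delta> j x)\<^sup>2"
          by (simp add: power_mult_distrib)
        then show ?thesis using K[of j] by simp
      qed
      then have "2^j * \<bar>\<Delta> j x\<bar> \<le> sqrt K" by (rule real_le_rsqrt)
      then show ?thesis by (simp add: field_simps power_one_over)
    qed
    moreover have "summable (\<lambda>j. sqrt K * (1/2::real)^j)"
      by (intro summable_mult summable_geometric) auto
    ultimately have "summable (\<lambda>j. \<Delta> j x)" by (rule summable_comparison_test'[rotated, where N = 0])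
    then have "(\<lambda>k. \<Sum>j<k. \<Delta> j x) \<longlonglongrightarrow> (\<Sum>j. \<Delta> j x)" by (rule summable_LIMSEQ)
    then have "(\<lambda>k. f (r 0) x + (\<Sum>j<k. \<Delta> j x)) \<longlonglongrightarrow> f (r 0) x + (\<Sum>j. \<Delta> j x)"
      by (intro tendsto_intros)
    moreover have "f (r 0) x + (\<Sum>j<k. \<Delta> j x) = f (r k) x" for k
      unfolding \<Delta>_def using sum_lessThan_telescope[of "\<lambda>j. f (r j) x" k] by simp
    ultimately show ?case by (auto simp: convergent_def)
  qed
  with r(1) that show ?thesis by blast
qed

section \<open>Grids of cubes\<close>

definition cell_index :: "nat \<Rightarrow> real ^ 'n \<Rightarrow> int ^ 'n" where
  "cell_index m x = (\<chi> j. \<lfloor>real (Suc m) * x $ j\<rfloor>)"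

text \<open>Half-open cubes of side \<open>1 / (m + 1)\<close>: every point lies in exactly one of
  them, so sums over cells need no care at the faces.\<close>

definition cell :: "nat \<Rightarrow> int ^ 'n \<Rightarrow> (real ^ 'n) set" where
  "cell m i = {x. cell_index m x = i}"

lemma cell_eq: "cell m i = {x. \<forall>j. real_of_int (i $ j) \<le> real (Suc m) * x $ j \<and> real (Suc m) * x $ j < real_of_int (i $ j) + 1}"
  unfolding cell_def cell_index_def vec_eq_iff by (auto simp: floor_eq_iff)

lemma cell_measurable [measurable]: "cell m i \<in> sets borel"
proof -
  have "cell m i = (\<Inter>j. {x. real_of_int (i $ j) \<le> real (Suc m) * x $ j} \<inter> {x. real (Suc m) * x $ j < real_of_int (i $ j) + 1})"
    by (auto simp: cell_eq)
  also have "\<dots> \<in> sets borel"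
    by (intro sets.countable_INT'' sets.Int borel_closed borel_open closed_Collect_le open_Collect_less continuous_intros) auto
  finally show ?thesis .
qed

lemma emeasure_cell:
  fixes i :: "int ^ 'n"
  shows "emeasure lborel (cell m i) = ennreal ((1 / real (Suc m)) ^ CARD('n))"
proof -
  define l where "l = (\<chi> j. real_of_int (i $ j) / real (Suc m))"
  define u where "u = (\<chi> j. (real_of_int (i $ j) + 1) / real (Suc m))"
  have ul: "(u - l) \<bullet> b = 1 / real (Suc m)" "l \<bullet> b \<le> u \<bullet> b" if "b \<in> Basis" for b
    using that by (auto simp: Basis_vec_def l_def u_def inner_axis field_simps)
  have prod: "(\<Prod>b\<in>Basis. (u - l) \<bullet> b) = (1 / real (Suc m)) ^ CARD('n)"
    using ul by (simp add: prod_constant)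
  have "box l u \<subseteq> cell m i"
    by (auto simp: cell_eq mem_box_cart l_def u_def field_simps intro: less_imp_le)
  moreover have "cell m i \<subseteq> cbox l u"
    by (fastforce simp: cell_eq mem_box_cart l_def u_def field_simps intro: less_imp_le)
  ultimately have "emeasure lborel (box l u) \<le> emeasure lborel (cell m i)" "emeasure lborel (cell m i) \<le> emeasure lborel (cbox l u)"
    by (auto intro!: emeasure_mono)
  moreover have "emeasure lborel (box l u) = ennreal ((1 / real (Suc m)) ^ CARD('n))"
    using emeasure_lborel_box[of l u] ul prod by simp
  moreover have "emeasure lborel (cbox l u) = ennreal ((1 / real (Suc m)) ^ CARD('n))"
    using emeasure_lborel_cbox[of l u] ul prod by simp
  ultimately show ?thesis by simp
qed

text \<open>The norm is estimated by the sum of the coordinates, hence the dimension and not its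
  square root.\<close>

lemma dist_cell:
  fixes x y :: "real ^ 'n"
  assumes "x \<in> cell m i" "y \<in> cell m i"
  shows "norm (x - y) \<le> real CARD('n) / real (Suc m)"
proof -
  have "\<bar>(x - y) $ j\<bar> \<le> 1 / real (Suc m)" for j
  proof -
    have "real_of_int (i $ j) \<le> real (Suc m) * x $ j" "real (Suc m) * x $ j < real_of_int (i $ j) + 1"
      "real_of_int (i $ j) \<le> real (Suc m) * y $ j" "real (Suc m) * y $ j < real_of_int (i $ j) + 1"
      using assms by (auto simp: cell_eq)
    then have "\<bar>real (Suc m) * x $ j - real (Suc m) * y $ j\<bar> \<le> 1" by linarith
    then have "real (Suc m) * \<bar>(x - y) $ j\<bar> \<le> 1"
      by (simp add: abs_mult flip: right_diff_distrib)
    then show ?thesis by (simp add: field_simps)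
  qed
  then have "(\<Sum>j\<in>UNIV. \<bar>(x - y) $ j\<bar>) \<le> (\<Sum>j\<in>(UNIV::'n set). 1 / real (Suc m))" by (intro sum_mono)
  then show ?thesis using norm_le_l1_cart[of "x - y"] by simp
qed

lemma finite_cells:
  fixes \<Omega> :: "(real ^ 'n) set"
  assumes "bounded \<Omega>"
  shows "finite (cell_index m ` \<Omega>)"
proof -
  obtain K where K: "\<And>x. x \<in> \<Omega> \<Longrightarrow> norm x \<le> K" using assms by (auto simp: bounded_iff)
  define k where "k = \<lceil>real (Suc m) * K\<rceil> + 1"
  have "cell_index m ` \<Omega> \<subseteq> vec_lambda ` {g. \<forall>j. g j \<in> {- k..k}}"
  proof
    fix i assume "i \<in> cell_index m ` \<Omega>"
    then obtain x where x: "x \<in> \<Omega>" "i = cell_index m x" by auto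
    have "i $ j \<in> {- k..k}" for j
    proof -
      have "\<bar>x $ j\<bar> \<le> K" using K[OF x(1)] component_le_norm_cart[of x j] by linarith
      then have "real (Suc m) * \<bar>x $ j\<bar> \<le> real (Suc m) * K" by (intro mult_left_mono) auto
      then have "\<bar>real (Suc m) * x $ j\<bar> \<le> real (Suc m) * K" by (simp add: abs_mult)
      moreover have "real (Suc m) * K \<le> of_int \<lceil>real (Suc m) * K\<rceil>" by simp
      ultimately show ?thesis unfolding x(2) cell_index_def k_def by (simp del: of_nat_Suc) linarith
    qed
    then show "i \<in> vec_lambda ` {g. \<forall>j. g j \<in> {- k..k}}"
      by (intro image_eqI[of _ _ "\<lambda>j. i $ j"]) auto
  qed
  moreover have "finite {g :: 'n \<Rightarrow> int. \<forall>j. g j \<in> {- k..k}}"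
    using finite_set_of_finite_funs[of UNIV "{-k..k}" undefined] finite_PiE[of "UNIV :: 'n set" "\<lambda>_. {-k..k}"]
    by (simp add: PiE_UNIV_domain Pi_def)
  ultimately show ?thesis by (meson finite_imageI finite_subset)
qed

text \<open>The square is expanded and integrated first in \<open>y\<close>, then in
  \<open>x\<close>. On a cell this identifies the double integral of squared differences with a
  multiple of the variance of \<open>w\<close>, which the Gagliardo seminorm controls.\<close>

lemma variance_identity:
  fixes w :: "'a \<Rightarrow> real"
  assumes w2: "integrable M (\<lambda>x. indicator Q x * (w x)\<^sup>2)" and w1: "integrable M (\<lambda>x. indicator Q x * w x)"
    and Q [measurable]: "Q \<in> sets M" and fin: "emeasure M Q = ennreal q" "0 \<le> q"
    and wm [measurable]: "w \<in> borel_measurable M"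
  shows "(\<integral>\<^sup>+ x. (\<integral>\<^sup>+ y. ennreal ((w x - w y)\<^sup>2) * (indicator Q x * indicator Q y) \<partial>M) \<partial>M) =
    ennreal (2 * q * (LINT x|M. indicator Q x * (w x)\<^sup>2) - 2 * (LINT x|M. indicator Q x * w x)\<^sup>2)"
proof -
  let ?S = "LINT x|M. indicator Q x * (w x)\<^sup>2" and ?I = "LINT x|M. indicator Q x * w x"
  have iQ: "integrable M (indicator Q :: 'a \<Rightarrow> real)" using fin by (simp add: integrable_indicator_iff)
  have mQ: "measure M Q = q" using fin by (simp add: measure_def)
  have inner: "(\<integral>\<^sup>+ y. ennreal ((w x - w y)\<^sup>2) * (indicator Q x * indicator Q y) \<partial>M) =
      ennreal (indicator Q x * (q * (w x)\<^sup>2 - 2 * w x * ?I + ?S))" for x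
  proof -
    have eq: "indicator Q y * (w x - w y)\<^sup>2 = (w x)\<^sup>2 * indicator Q y - (2 * w x) * (indicator Q y * w y) + indicator Q y * (w y)\<^sup>2" for y
      by (simp add: power2_diff algebra_simps)
    have int: "integrable M (\<lambda>y. indicator Q y * (w x - w y)\<^sup>2)"
      unfolding eq by (intro Bochner_Integration.integrable_add Bochner_Integration.integrable_diff integrable_mult_right iQ w1 w2)
    have "(LINT y|M. indicator Q y * (w x - w y)\<^sup>2) = (w x)\<^sup>2 * q - 2 * w x * ?I + ?S"
      unfolding eq using iQ w1 w2 by (simp add: mQ)
    moreover have "(\<integral>\<^sup>+ y. ennreal (indicator Q y * (w x - w y)\<^sup>2) \<partial>M) = ennreal (LINT y|M. indicator Q y * (w x - w y)\<^sup>2)"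
      by (rule nn_integral_eq_integral[OF int]) auto
    moreover have "(\<integral>\<^sup>+ y. ennreal ((w x - w y)\<^sup>2) * (indicator Q x * indicator Q y) \<partial>M) =
        indicator Q x * (\<integral>\<^sup>+ y. ennreal (indicator Q y * (w x - w y)\<^sup>2) \<partial>M)"
      by (subst nn_integral_cmult[symmetric]) (auto intro!: nn_integral_cong simp: indicator_def)
    ultimately show ?thesis by (auto simp: indicator_def mult.commute)
  qed
  have eq2: "indicator Q x * (q * (w x)\<^sup>2 - 2 * w x * ?I + ?S) = q * (indicator Q x * (w x)\<^sup>2) - (2 * ?I) * (indicator Q x * w x) + ?S * indicator Q x" for x
    by (simp add: algebra_simps)
  have int2: "integrable M (\<lambda>x. indicator Q x * (q * (w x)\<^sup>2 - 2 * w x * ?I + ?S))"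
    unfolding eq2 by (intro Bochner_Integration.integrable_add Bochner_Integration.integrable_diff integrable_mult_right iQ w1 w2)
  \<comment> \<open>\<open>ennreal\<close> sends negative numbers to 0, so the closed form of the
    inner integral must be known to be nonnegative before it can be integrated as a real
    function.\<close>
  have nonneg: "0 \<le> indicator Q x * (q * (w x)\<^sup>2 - 2 * w x * ?I + ?S)" for x
  proof -
    have eq: "indicator Q y * (w x - w y)\<^sup>2 = (w x)\<^sup>2 * indicator Q y - (2 * w x) * (indicator Q y * w y) + indicator Q y * (w y)\<^sup>2" for y
      by (simp add: power2_diff algebra_simps)
    have "0 \<le> (LINT y|M. indicator Q y * (w x - w y)\<^sup>2)" by (intro integral_nonneg_AE) auto
    also have "\<dots> = (w x)\<^sup>2 * q - 2 * w x * ?I + ?S"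
      unfolding eq using iQ w1 w2 by (simp add: mQ)
    finally show ?thesis by (simp add: mult.commute)
  qed
  have "(LINT x|M. indicator Q x * (q * (w x)\<^sup>2 - 2 * w x * ?I + ?S)) = q * ?S - (2 * ?I) * ?I + ?S * q"
    unfolding eq2 using iQ w1 w2 by (simp add: mQ)
  also have "\<dots> = 2 * q * ?S - 2 * ?I\<^sup>2" by (simp add: power2_eq_square)
  finally show ?thesis
    unfolding inner using nn_integral_eq_integral[OF int2] nonneg by simp
qed

text \<open>
  Up to an error of order \<open>m powr (- 2 * s)\<close>, finitely many cell averages control the norm of \<open>L\<^sup>2\<close>.
  This is the source of compactness: a diagonal subsequence makes all cell averages converge.
\<close>

lemma frac_sobolev0_cell_inequality:
  fixes \<Omega> :: "(real ^ 'n) set" and u :: "real ^ 'n \<Rightarrow> real"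
  assumes s: "0 < s" and \<Omega>: "open \<Omega>" "bounded \<Omega>" and u: "u \<in> frac_sobolev0 s \<Omega>"
  shows "(LINT x|lebesgue. (u x)\<^sup>2) \<le>
    real (Suc m) ^ CARD('n) * (\<Sum>i\<in>cell_index m ` \<Omega>. (LINT x|lebesgue. indicator (cell m i) x * u x)\<^sup>2)
    + real CARD('n) powr (real CARD('n) + 2 * s) / 2 * real (Suc m) powr (- 2 * s) * gagliardo_sq s u"
proof -
  let ?n = "CARD('n)" and ?M = "real (Suc m)" and ?I = "cell_index m ` \<Omega>"
  obtain v where v [measurable]: "v \<in> borel_measurable borel" and v0: "\<And>x. x \<notin> \<Omega> \<Longrightarrow> v x = 0"
    and uv: "AE x in lebesgue. u x = v x"
    and N: "(\<integral>\<^sup>+ x. gagliardo_density s v x \<partial>lborel) = ennreal (gagliardo_sq s u)"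
    using frac_sobolev0_borel_representative[OF u \<Omega>(1)] by metis
  have [measurable]: "u \<in> borel_measurable lebesgue" and u2: "integrable lebesgue (\<lambda>x. (u x)\<^sup>2)"
    using u by (auto simp: frac_sobolev0_def frac_sobolev_def)
  have vl [measurable]: "v \<in> borel_measurable lebesgue" "cell m i \<in> sets lebesgue" for i
    by (auto intro!: measurable_completion)
  have fin: "finite ?I" by (rule finite_cells[OF \<Omega>(2)])
  have "integrable lebesgue (\<lambda>x. (v x)\<^sup>2)"
    using u2 uv by (subst integrable_cong_AE[where g = "\<lambda>x. (u x)\<^sup>2"]) (auto elim: eventually_mono)
  then have v2: "integrable lborel (\<lambda>x. (v x)\<^sup>2)"
    by (subst (asm) integrable_completion) auto
  define q where "q = (1 / ?M) ^ ?n"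
  have q: "q > 0" "emeasure lborel (cell m i) = ennreal q" for i :: "int ^ 'n"
    unfolding q_def emeasure_cell by auto
  have iQ: "integrable lborel (indicator (cell m i) :: _ \<Rightarrow> real)" for i :: "int ^ 'n"
    using q by (simp add: integrable_indicator_iff)
  have w2: "integrable lborel (\<lambda>x. indicator (cell m i) x * (v x)\<^sup>2)" for i
    by (rule Bochner_Integration.integrable_bound[OF v2]) (auto simp: indicator_def)
  have "\<bar>t\<bar> \<le> 1 + t\<^sup>2" for t :: real
    using sum_squares_bound[of "\<bar>t\<bar>" 1] by (auto simp: power2_eq_square)
  then have w1: "integrable lborel (\<lambda>x. indicator (cell m i) x * v x)" for i
    by (intro Bochner_Integration.integrable_bound[OF Bochner_Integration.integrable_add[OF iQ[of i] v2]]) (auto simp: indicator_def)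
  define S where "S i = (LINT x|lborel. indicator (cell m i) x * (v x)\<^sup>2)" for i
  define J where "J i = (LINT x|lborel. indicator (cell m i) x * v x)" for i
  \<comment> \<open>The largest value of the kernel on pairs of points in a common cell, by
    \<open>dist_cell\<close>.\<close>
  define L where "L = (real ?n / ?M) powr (real ?n + 2 * s)"
  have pt: "(\<Sum>i\<in>?I. ennreal ((v x - v y)\<^sup>2) * (indicator (cell m i) x * indicator (cell m i) y))
      \<le> ennreal L * ennreal (\<bar>v x - v y\<bar>\<^sup>2 / gagliardo_kernel s x y)" for x y
  \<comment> \<open>Otherwise the left side is 0: no cell contains both points, or the difference
    vanishes.\<close>
  proof (cases "cell_index m x = cell_index m y \<and> x \<noteq> y")
    case True
    have "(\<Sum>i\<in>?I. ennreal ((v x - v y)\<^sup>2) * (indicator (cell m i) x * indicator (cell m i) y))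
        = (\<Sum>i\<in>?I. if i = cell_index m x then ennreal ((v x - v y)\<^sup>2) else 0)"
      using True by (intro sum.cong) (auto simp: cell_def indicator_def)
    also have "\<dots> \<le> ennreal ((v x - v y)\<^sup>2)"
      using fin by simp
    also have "(v x - v y)\<^sup>2 \<le> L * (\<bar>v x - v y\<bar>\<^sup>2 / gagliardo_kernel s x y)"
    proof -
      have "norm (x - y) \<le> real ?n / ?M" by (rule dist_cell[of x m "cell_index m x"]) (use True in \<open>auto simp: cell_def\<close>)
      then have "gagliardo_kernel s x y \<le> L"
        unfolding gagliardo_kernel_def L_def using s by (intro powr_mono2) auto
      moreover have "gagliardo_kernel s x y > 0" using True by (simp add: gagliardo_kernel_def)
      ultimately have "1 \<le> L / gagliardo_kernel s x y" by simp
      from mult_right_mono[OF this, of "(v x - v y)\<^sup>2"] show ?thesis by simp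
    qed
    then have "ennreal ((v x - v y)\<^sup>2) \<le> ennreal (L * (\<bar>v x - v y\<bar>\<^sup>2 / gagliardo_kernel s x y))"
      by (rule ennreal_leI)
    also have "\<dots> = ennreal L * ennreal (\<bar>v x - v y\<bar>\<^sup>2 / gagliardo_kernel s x y)"
      by (rule ennreal_mult) (auto simp: L_def)
    finally show ?thesis .
  next
    case False
    then have "ennreal ((v x - v y)\<^sup>2) * (indicator (cell m i) x * indicator (cell m i) y) = 0" for i
      by (auto simp: cell_def indicator_def)
    then show ?thesis by (simp only: sum.neutral_const zero_le)
  qed
  have "(\<Sum>i\<in>?I. ennreal (2 * q * S i - 2 * (J i)\<^sup>2)) =
      (\<Sum>i\<in>?I. \<integral>\<^sup>+ x. (\<integral>\<^sup>+ y. ennreal ((v x - v y)\<^sup>2) * (indicator (cell m i) x * indicator (cell m i) y) \<partial>lborel) \<partial>lborel)"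
    unfolding S_def J_def using q by (intro sum.cong refl variance_identity[symmetric] w1 w2) (auto intro: less_imp_le)
  also have "\<dots> = (\<integral>\<^sup>+ x. (\<Sum>i\<in>?I. \<integral>\<^sup>+ y. ennreal ((v x - v y)\<^sup>2) * (indicator (cell m i) x * indicator (cell m i) y) \<partial>lborel) \<partial>lborel)"
    by (rule nn_integral_sum[symmetric]) measurable
  also have "\<dots> = (\<integral>\<^sup>+ x. \<integral>\<^sup>+ y. (\<Sum>i\<in>?I. ennreal ((v x - v y)\<^sup>2) * (indicator (cell m i) x * indicator (cell m i) y)) \<partial>lborel \<partial>lborel)"
    by (intro nn_integral_cong nn_integral_sum[symmetric]) measurable
  also have "\<dots> \<le> (\<integral>\<^sup>+ x. \<integral>\<^sup>+ y. ennreal L * ennreal (\<bar>v x - v y\<bar>\<^sup>2 / gagliardo_kernel s x y) \<partial>lborel \<partial>lborel)"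
    by (intro nn_integral_mono pt)
  also have "\<dots> = (\<integral>\<^sup>+ x. ennreal L * gagliardo_density s v x \<partial>lborel)"
    unfolding gagliardo_density_def by (intro nn_integral_cong nn_integral_cmult) measurable
  also have "\<dots> = ennreal L * ennreal (gagliardo_sq s u)"
    unfolding N[symmetric] by (rule nn_integral_cmult) simp
  also have "\<dots> = ennreal (L * gagliardo_sq s u)"
    by (rule ennreal_mult[symmetric]) (auto simp: L_def gagliardo_sq_nonneg)
  finally have le: "(\<Sum>i\<in>?I. ennreal (2 * q * S i - 2 * (J i)\<^sup>2)) \<le> ennreal (L * gagliardo_sq s u)" .
  \<comment> \<open>To leave \<open>ennreal\<close>, each summand is replaced by its positive part;
    removing the \<open>max\<close> afterwards only lowers the sum.\<close>
  have "(\<Sum>i\<in>?I. ennreal (2 * q * S i - 2 * (J i)\<^sup>2)) = (\<Sum>i\<in>?I. ennreal (max 0 (2 * q * S i - 2 * (J i)\<^sup>2)))"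
    by (intro sum.cong) (auto simp: max_def ennreal_neg)
  also have "\<dots> = ennreal (\<Sum>i\<in>?I. max 0 (2 * q * S i - 2 * (J i)\<^sup>2))"
    by (rule sum_ennreal) auto
  finally have "(\<Sum>i\<in>?I. max 0 (2 * q * S i - 2 * (J i)\<^sup>2)) \<le> L * gagliardo_sq s u"
    using le gagliardo_sq_nonneg[of s u] by (simp add: ennreal_le_iff L_def)
  moreover have "(\<Sum>i\<in>?I. 2 * q * S i - 2 * (J i)\<^sup>2) \<le> (\<Sum>i\<in>?I. max 0 (2 * q * S i - 2 * (J i)\<^sup>2))"
    by (intro sum_mono) auto
  ultimately have main: "2 * q * (\<Sum>i\<in>?I. S i) \<le> 2 * (\<Sum>i\<in>?I. (J i)\<^sup>2) + L * gagliardo_sq s u"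
    by (simp add: sum_subtractf sum_distrib_left)
  have "(\<Sum>i\<in>?I. S i) = (LINT x|lborel. (\<Sum>i\<in>?I. indicator (cell m i) x * (v x)\<^sup>2))"
    unfolding S_def using w2 by simp
  also have "\<dots> = (LINT x|lborel. (v x)\<^sup>2)"
  proof (rule Bochner_Integration.integral_cong)
    fix x
    show "(\<Sum>i\<in>?I. indicator (cell m i) x * (v x)\<^sup>2) = (v x)\<^sup>2"
    proof (cases "x \<in> \<Omega>")
      case True
      have "(\<Sum>i\<in>?I. indicator (cell m i) x * (v x)\<^sup>2) = (\<Sum>i\<in>?I. if i = cell_index m x then (v x)\<^sup>2 else 0)"
        by (intro sum.cong) (auto simp: cell_def indicator_def)
      then show ?thesis using True fin by simp
    qed (simp add: v0)
  qed simp
  also have "\<dots> = (LINT x|lebesgue. (v x)\<^sup>2)" by (subst integral_completion) auto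
  also have "\<dots> = (LINT x|lebesgue. (u x)\<^sup>2)" using uv by (intro integral_cong_AE) (auto elim: eventually_mono)
  finally have S: "(\<Sum>i\<in>?I. S i) = (LINT x|lebesgue. (u x)\<^sup>2)" .
  have J: "J i = (LINT x|lebesgue. indicator (cell m i) x * u x)" for i
  proof -
    have "J i = (LINT x|lebesgue. indicator (cell m i) x * v x)"
      unfolding J_def by (subst integral_completion) auto
    also have "\<dots> = (LINT x|lebesgue. indicator (cell m i) x * u x)"
      using uv by (intro integral_cong_AE) (auto elim: eventually_mono)
    finally show ?thesis .
  qed
  have "(LINT x|lebesgue. (u x)\<^sup>2) \<le> 1 / q * (\<Sum>i\<in>?I. (J i)\<^sup>2) + L / q / 2 * gagliardo_sq s u"
    using main q(1) unfolding S by (simp add: field_simps)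
  moreover have "1 / q = ?M ^ ?n" by (simp add: q_def power_one_over)
  moreover have "L / q = real ?n powr (real ?n + 2 * s) * ?M powr (- 2 * s)"
  proof -
    have "L / q = real ?n powr (real ?n + 2 * s) / ?M powr (real ?n + 2 * s) * ?M powr real ?n"
      by (simp add: L_def q_def powr_divide power_one_over powr_realpow del: of_nat_Suc)
    also have "?M powr (real ?n + 2 * s) = ?M powr real ?n * ?M powr (2 * s)" by (rule powr_add)
    finally show ?thesis by (simp add: powr_minus field_simps del: of_nat_Suc)
  qed
  ultimately show ?thesis unfolding J by simp
qed

section \<open>Lower semicontinuity and compactness\<close>

lemma gagliardo_sq_diff_le:
  assumes "u \<in> frac_sobolev0 s \<Omega>" "v \<in> frac_sobolev0 s \<Omega>"
  shows "gagliardo_sq s (u - v) \<le> 2 * gagliardo_sq s u + 2 * gagliardo_sq s v"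
proof -
  have uv: "u \<in> frac_sobolev s" "v \<in> frac_sobolev s" "(-1) *\<^sub>R v \<in> frac_sobolev s" "u + v \<in> frac_sobolev s" "u - v \<in> frac_sobolev s"
    using assms subspace_scale[OF subspace_frac_sobolev, of v s "-1"]
      subspace_add[OF subspace_frac_sobolev, of u s v] subspace_diff[OF subspace_frac_sobolev, of u s v]
    by (auto simp: frac_sobolev0_def)
  have exp: "gagliardo_form s (x + c *\<^sub>R y) (x + c *\<^sub>R y) = gagliardo_form s x x + 2 * c * gagliardo_form s x y + c\<^sup>2 * gagliardo_form s y y"
    if "x \<in> frac_sobolev s" "y \<in> frac_sobolev s" for x y :: "real ^ 'a \<Rightarrow> real" and c
  proof -
    have in_V: "c *\<^sub>R y \<in> frac_sobolev s" "x + c *\<^sub>R y \<in> frac_sobolev s"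
      using that by (auto intro!: subspace_add[OF subspace_frac_sobolev] subspace_scale[OF subspace_frac_sobolev])
    have 1: "gagliardo_form s (x + c *\<^sub>R y) z = gagliardo_form s x z + c * gagliardo_form s y z" if "z \<in> frac_sobolev s" for z
      using gagliardo_form_add[of x s "c *\<^sub>R y" z] gagliardo_form_scale[of s c y z] that in_V \<open>x \<in> frac_sobolev s\<close> by simp
    have 2: "gagliardo_form s z (x + c *\<^sub>R y) = gagliardo_form s x z + c * gagliardo_form s y z" if "z \<in> frac_sobolev s" for z
      using 1[OF that] by (simp add: gagliardo_form_commute[of s z])
    show ?thesis
      unfolding 1[OF in_V(2)] 2[OF that(1)] 2[OF that(2)] gagliardo_form_commute[of s y x]
      by (simp add: algebra_simps power2_eq_square)
  qed
  \<comment> \<open>Parallelogram identity, of which only the term with \<open>u + v\<close> is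
    dropped.\<close>
  have "gagliardo_sq s (u - v) + gagliardo_sq s (u + v) = 2 * gagliardo_sq s u + 2 * gagliardo_sq s v"
    using exp[OF uv(1,2), of 1] exp[OF uv(1,2), of "-1"] by (simp add: gagliardo_form_self)
  then show ?thesis using gagliardo_sq_nonneg[of s "u + v"] by linarith
qed

lemma L2_tendsto_imp_AE_subseq:
  assumes "\<And>k. (f k :: 'a \<Rightarrow> real) \<in> borel_measurable M" "\<And>k. integrable M (\<lambda>x. (f k x)\<^sup>2)"
    and "(\<lambda>k. LINT x|M. (f k x)\<^sup>2) \<longlonglongrightarrow> 0"
  obtains r where "strict_mono (r :: nat \<Rightarrow> nat)" "AE x in M. (\<lambda>k. f (r k) x) \<longlonglongrightarrow> 0"
proof -
  have "\<exists>r. strict_mono r \<and> (AE x in M. (\<lambda>k. (f (r k) x)\<^sup>2) \<longlonglongrightarrow> 0)"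
    by (rule tendsto_L1_AE_subseq) (use assms in auto)
  then obtain r where r: "strict_mono r" "AE x in M. (\<lambda>k. (f (r k) x)\<^sup>2) \<longlonglongrightarrow> 0" by blast
  from r(2) have "AE x in M. (\<lambda>k. f (r k) x) \<longlonglongrightarrow> 0"
  proof eventually_elim
    case (elim x)
    then have "(\<lambda>k. sqrt ((f (r k) x)\<^sup>2)) \<longlonglongrightarrow> sqrt 0" by (rule tendsto_real_sqrt)
    then show ?case by (simp add: tendsto_rabs_zero_iff)
  qed
  with r(1) that show ?thesis by blast
qed

text \<open>Convergence in L2 gives a.e. convergence along a subsequence, and Fatou's lemma applies
  to the double integral.\<close>

lemma frac_sobolev0_lsc:
  assumes w: "\<And>k. w k \<in> frac_sobolev0 s \<Omega>" "\<And>k. gagliardo_sq s (w k) \<le> c"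
    and u: "u \<in> frac_sobolev0 s \<Omega>" and lim: "(\<lambda>k. LINT x|lebesgue. ((w k - u) x)\<^sup>2) \<longlonglongrightarrow> 0"
  shows "gagliardo_sq s u \<le> c"
proof -
  have diff: "w k - u \<in> frac_sobolev0 s \<Omega>" for k
    by (intro subspace_diff[OF subspace_frac_sobolev0] w u)
  have m: "w k - u \<in> borel_measurable lebesgue" and i: "integrable lebesgue (\<lambda>x. ((w k - u) x)\<^sup>2)" for k
    using diff[of k] unfolding frac_sobolev0_def frac_sobolev_def by blast+
  obtain r :: "nat \<Rightarrow> nat" where r: "strict_mono r" "AE x in lebesgue. (\<lambda>k. (w (r k) - u) x) \<longlonglongrightarrow> 0"
    using L2_tendsto_imp_AE_subseq[OF m i lim] by metis
  have us: "u \<in> frac_sobolev s" and ws: "w k \<in> frac_sobolev s" for k using u w by (auto simp: frac_sobolev0_def)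
  have "AE x in lebesgue. (\<lambda>k. w (r k) x) \<longlonglongrightarrow> u x"
    using r(2) by (auto simp: fun_diff_def LIM_zero_iff elim: eventually_mono)
  moreover have c0: "0 \<le> c" using w(2)[of 0] gagliardo_sq_nonneg[of s "w 0"] by linarith
  moreover have "w k \<in> borel_measurable lebesgue" "u \<in> borel_measurable lebesgue" for k
    using us ws by (auto simp: frac_sobolev_def)
  moreover have "gagliardo_nn s (w k) \<le> ennreal c" for k
    unfolding gagliardo_nn_eq[OF ws] by (rule ennreal_leI[OF w(2)])
  ultimately have "gagliardo_nn s u \<le> ennreal c"
    by - (rule gagliardo_nn_fatou[of "\<lambda>k. w (r k)"])
  then show ?thesis using gagliardo_sq_le_iff[OF us] \<open>0 \<le> c\<close> by simp
qed

text \<open>Once all cell integrals converge, the cell inequality makes the sequence Cauchy in L2: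
  first the mesh is chosen fine enough, then the indices large. The a.e. limit of a further
  subsequence belongs to the space by Fatou and \<open>frac_sobolev0_poincare\<close>, and Fatou
  once more turns the Cauchy property into convergence.\<close>

lemma frac_sobolev0_compact:
  fixes \<Omega> :: "(real ^ 'n) set" and w :: "nat \<Rightarrow> real ^ 'n \<Rightarrow> real"
  assumes s: "0 < s" and \<Omega>: "open \<Omega>" "bounded \<Omega>"
    and w: "\<And>k. w k \<in> frac_sobolev0 s \<Omega>" and R: "\<And>k. gagliardo_sq s (w k) \<le> R"
  obtains r u where "strict_mono r" "u \<in> frac_sobolev0 s \<Omega>" "(\<lambda>k. LINT x|lebesgue. ((w (r k) - u) x)\<^sup>2) \<longlonglongrightarrow> 0"
proof -
  let ?V = "frac_sobolev0 s \<Omega>"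
  obtain C where C: "C > 0" "\<And>u. u \<in> ?V \<Longrightarrow> (LINT x|lebesgue. (u x)\<^sup>2) \<le> C * gagliardo_sq s u"
    and in_V: "\<And>u. u \<in> borel_measurable lebesgue \<Longrightarrow> gagliardo_nn s u < \<infinity> \<Longrightarrow> (AE x in lebesgue. x \<notin> \<Omega> \<longrightarrow> u x = 0) \<Longrightarrow> u \<in> ?V"
    using frac_sobolev0_poincare[OF s \<Omega>] by blast
  have meas [measurable]: "u \<in> borel_measurable lebesgue" and sq: "integrable lebesgue (\<lambda>x. (u x)\<^sup>2)"
    and fs: "u \<in> frac_sobolev s" if "u \<in> ?V" for u
    using that by (auto simp: frac_sobolev0_def frac_sobolev_def)
  have [measurable]: "cell m i \<in> sets lebesgue" for m and i :: "int ^ 'n"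
    using cell_measurable by auto
  \<comment> \<open>Integrals over cells, indexed by mesh and position together: a countable family,
    as the diagonal argument requires.\<close>
  define ell where "ell j u = (LINT x|lebesgue. indicator (case_prod cell j) x * u x)" for j :: "nat \<times> (int ^ 'n)" and u :: "real ^ 'n \<Rightarrow> real"
  have iQ: "integrable lebesgue (indicator (cell m i) :: _ \<Rightarrow> real)" "(LINT x|lebesgue. indicator (cell m i) x) \<le> (1::real)" for m and i :: "int ^ 'n"
  proof -
    have e: "emeasure lebesgue (cell m i) = ennreal ((1 / real (Suc m)) ^ CARD('n))"
      using emeasure_cell[of m i] cell_measurable[of m i] by simp
    then show "integrable lebesgue (indicator (cell m i) :: _ \<Rightarrow> real)" by (simp add: integrable_indicator_iff)
    have "measure lebesgue (cell m i) = (1 / real (Suc m)) ^ CARD('n)"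
      using e by (simp add: measure_def)
    also have "\<dots> \<le> 1" by (intro power_le_one) auto
    finally show "(LINT x|lebesgue. indicator (cell m i) x) \<le> (1::real)" by simp
  qed
  have abs1: "\<bar>t\<bar> \<le> 1 + t\<^sup>2" for t :: real
    using sum_squares_bound[of "\<bar>t\<bar>" 1] by (auto simp: power2_eq_square)
  have dom: "norm (indicator (cell m i) x * u x) \<le> indicator (cell m i) x + (u x)\<^sup>2" for m x and i :: "int ^ 'n" and u
    using abs1 by (auto simp: indicator_def)
  have int: "integrable lebesgue (\<lambda>x. indicator (cell m i) x * u x)" if "u \<in> ?V" for m i u
  proof (rule Bochner_Integration.integrable_bound[OF Bochner_Integration.integrable_add[OF iQ(1)[of m i] sq[OF that]]])
    have [measurable]: "u \<in> borel_measurable lebesgue" by (rule meas[OF that])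
    show "(\<lambda>x. indicator (cell m i) x * u x) \<in> borel_measurable lebesgue" by measurable
    show "AE x in lebesgue. norm (indicator (cell m i) x * u x) \<le> norm (indicator (cell m i) x + (u x)\<^sup>2)"
      using dom[of m i _ u] by (auto intro!: always_eventually order_trans[OF dom])
  qed
  have bound: "\<bar>ell j (w k)\<bar> \<le> 1 + C * R" for j k
  proof -
    obtain m i where j: "j = (m, i)" by (cases j)
    have "\<bar>ell j (w k)\<bar> \<le> (LINT x|lebesgue. indicator (cell m i) x + (w k x)\<^sup>2)"
      unfolding ell_def j real_norm_def[symmetric] case_prod_conv
      by (rule Bochner_Integration.integral_norm_bound_integral[OF int[OF w[of k], of m i]
            Bochner_Integration.integrable_add[OF iQ(1)[of m i] sq[OF w[of k]]]])
        (rule dom)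
    also have "\<dots> = (LINT x|lebesgue. indicator (cell m i) x) + (LINT x|lebesgue. (w k x)\<^sup>2)"
      by (rule Bochner_Integration.integral_add[OF iQ(1) sq[OF w]])
    also have "\<dots> \<le> 1 + C * gagliardo_sq s (w k)" by (intro add_mono iQ(2) C(2) w)
    also have "\<dots> \<le> 1 + C * R" using R C(1) by (simp add: mult_left_mono)
    finally show ?thesis .
  qed
  \<comment> \<open>The property to be achieved at stage \<open>n\<close>, where
    \<open>from_nat\<close> enumerates all cells of all grids.\<close>
  define P where "P n r = convergent (\<lambda>k. ell (from_nat n) (w (r k)))" for n and r :: "nat \<Rightarrow> nat"
  interpret subseqs P
  proof
    fix n and r :: "nat \<Rightarrow> nat"
    have "bounded (range (\<lambda>k. ell (from_nat n) (w (r k))))"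
      unfolding bounded_iff using bound by (intro exI[of _ "1 + C * R"]) auto
    then obtain l r' where "strict_mono r'" "((\<lambda>k. ell (from_nat n) (w (r k))) \<circ> r') \<longlonglongrightarrow> l"
      using bounded_imp_convergent_subsequence by blast
    then show "\<exists>r'. strict_mono r' \<and> P n (r \<circ> r')"
      unfolding P_def convergent_def by (auto simp: o_def)
  qed
  have "P n (diagseq \<circ> (+) (Suc n))" for n
  proof (rule diagseq_holds)
    fix r :: "nat \<Rightarrow> nat" and t n assume "strict_mono r" "P n t"
    then show "P n (t \<circ> r)"
      using convergent_subseq_convergent[of "\<lambda>k. ell (from_nat n) (w (t k))" r] by (simp add: P_def o_def)
  qed
  then have conv: "convergent (\<lambda>k. ell j (w (diagseq k)))" for j
  proof -
    have "convergent (\<lambda>k. ell (from_nat (to_nat j)) (w (diagseq (k + Suc (to_nat j)))))"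
      using \<open>\<And>n. P n (diagseq \<circ> (+) (Suc n))\<close>[of "to_nat j"] by (simp add: P_def o_def add.commute)
    then show ?thesis using convergent_ignore_initial_segment[of "\<lambda>k. ell j (w (diagseq k))" "Suc (to_nat j)"] by simp
  qed
  define v where "v k = w (diagseq k)" for k
  have v: "v k \<in> ?V" "gagliardo_sq s (v k) \<le> R" for k using w R by (auto simp: v_def)
  have vd: "v k - v l \<in> ?V" for k l by (intro subspace_diff[OF subspace_frac_sobolev0] v)
  have cauchy: "\<exists>N. \<forall>k\<ge>N. \<forall>l\<ge>N. (LINT x|lebesgue. ((v k - v l) x)\<^sup>2) \<le> e" if e: "e > 0" for e
  proof -
    \<comment> \<open>The factor \<open>4 * R\<close> bounds the seminorm of a difference of two
      members of the sequence.\<close>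
    define D where "D = real CARD('n) powr (real CARD('n) + 2 * s) / 2 * (4 * R)"
    have "filterlim (\<lambda>m. real (Suc m)) at_top sequentially"
      by (rule filterlim_compose[OF filterlim_real_sequentially filterlim_Suc])
    then have "(\<lambda>m. real (Suc m) powr (- 2 * s)) \<longlonglongrightarrow> 0"
      by (rule tendsto_neg_powr[rotated]) (use s in simp)
    then have "(\<lambda>m. D * real (Suc m) powr (- 2 * s)) \<longlonglongrightarrow> 0" by (rule tendsto_mult_right_zero)
    then have "\<forall>\<^sub>F m in sequentially. D * real (Suc m) powr (- 2 * s) < e / 2"
      by (rule order_tendstoD(2)) (use e in auto)
    then obtain m where m: "D * real (Suc m) powr (- 2 * s) < e / 2"
      by (meson eventually_happens trivial_limit_sequentially)
    let ?I = "cell_index m ` \<Omega>"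
    let ?a = "\<lambda>i k. ell (m, i) (v k)"
    define T where "T kl = real (Suc m) ^ CARD('n) * (\<Sum>i\<in>?I. (?a i (fst kl) - ?a i (snd kl))\<^sup>2)" for kl
    have "\<exists>N. \<forall>k\<ge>N. \<forall>l\<ge>N. T (k, l) \<le> e / 2"
    proof -
      \<comment> \<open>The added 1 avoids division by zero when no cell meets \<Omega>.\<close>
      define \<epsilon> where "\<epsilon> = e / 2 / (real (Suc m) ^ CARD('n) * (real (card ?I) + 1))"
      have \<epsilon>: "\<epsilon> > 0" using e by (simp add: \<epsilon>_def)
      have cancel: "A * (c * (e / 2 / (A * c))) = e / 2" if "A \<noteq> 0" "c \<noteq> 0" for A c :: real
        using that by simp
      have "\<exists>N. \<forall>k\<ge>N. \<forall>l\<ge>N. \<bar>?a i k - ?a i l\<bar> < sqrt \<epsilon>" for i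
      proof -
        have "Cauchy (\<lambda>k. ?a i k)" using conv[of "(m, i)"] by (simp add: v_def Cauchy_convergent_iff)
        then show ?thesis using \<epsilon> unfolding Cauchy_def dist_real_def by (metis real_sqrt_gt_zero)
      qed
      then obtain N where N: "\<And>i k l. k \<ge> N i \<Longrightarrow> l \<ge> N i \<Longrightarrow> \<bar>?a i k - ?a i l\<bar> < sqrt \<epsilon>" by metis
      have fin: "finite ?I" by (rule finite_cells[OF \<Omega>(2)])
      define N0 where "N0 = Max (insert 0 (N ` ?I))"
      have "T (k, l) \<le> e / 2" if kl: "k \<ge> N0" "l \<ge> N0" for k l
      proof -
        have "(?a i k - ?a i l)\<^sup>2 \<le> \<epsilon>" if i: "i \<in> ?I" for i
        proof -
          have "N i \<le> N0" unfolding N0_def using fin i by (intro Max_ge) auto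
          then have "\<bar>?a i k - ?a i l\<bar> \<le> sqrt \<epsilon>" using N[of i k l] kl by auto
          then have "\<bar>?a i k - ?a i l\<bar>\<^sup>2 \<le> (sqrt \<epsilon>)\<^sup>2" by (intro power_mono) auto
          then show ?thesis using \<epsilon> by simp
        qed
        then have "(\<Sum>i\<in>?I. (?a i k - ?a i l)\<^sup>2) \<le> real (card ?I) * \<epsilon>" by (rule sum_bounded_above)
        also have "\<dots> \<le> (real (card ?I) + 1) * \<epsilon>" using \<epsilon> by (intro mult_right_mono) auto
        finally have "T (k, l) \<le> real (Suc m) ^ CARD('n) * ((real (card ?I) + 1) * \<epsilon>)"
          unfolding T_def by (simp add: mult_left_mono del: of_nat_Suc)
        also have "\<dots> = e / 2"
          unfolding \<epsilon>_def by (rule cancel) (simp_all add: add_nonneg_eq_0_iff)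
        finally show ?thesis .
      qed
      then show ?thesis by blast
    qed
    then obtain N where N: "\<And>k l. k \<ge> N \<Longrightarrow> l \<ge> N \<Longrightarrow> T (k, l) \<le> e / 2" by blast
    have "(LINT x|lebesgue. ((v k - v l) x)\<^sup>2) \<le> e" if kl: "k \<ge> N" "l \<ge> N" for k l
    proof -
      have lin: "(LINT x|lebesgue. indicator (cell m i) x * (v k - v l) x) = ?a i k - ?a i l" for i
        using Bochner_Integration.integral_diff[OF int[OF v(1)[of k], of m i] int[OF v(1)[of l], of m i]]
        by (simp add: ell_def fun_diff_def right_diff_distrib)
      have "gagliardo_sq s (v k - v l) \<le> 4 * R" using gagliardo_sq_diff_le[OF v(1)[of k] v(1)[of l]] v(2)[of k] v(2)[of l] by linarith
      then have "real CARD('n) powr (real CARD('n) + 2 * s) / 2 * real (Suc m) powr (- 2 * s) * gagliardo_sq s (v k - v l) \<le>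
        real CARD('n) powr (real CARD('n) + 2 * s) / 2 * real (Suc m) powr (- 2 * s) * (4 * R)"
        by (intro mult_left_mono) auto
      also have "\<dots> = D * real (Suc m) powr (- 2 * s)" by (simp add: D_def)
      finally show ?thesis
        using frac_sobolev0_cell_inequality[OF s \<Omega> vd[of k l], of m] N[OF kl] m
        unfolding lin T_def fst_conv snd_conv by linarith
    qed
    then show ?thesis by blast
  qed
  have nn: "(\<integral>\<^sup>+ x. ennreal ((u x)\<^sup>2) \<partial>lebesgue) = ennreal (LINT x|lebesgue. (u x)\<^sup>2)" if "u \<in> ?V" for u
    by (rule nn_integral_eq_integral[OF sq[OF that]]) auto
  have cauchy_nn: "\<exists>N. \<forall>k\<ge>N. \<forall>l\<ge>N. (\<integral>\<^sup>+ x. ennreal ((v k x - v l x)\<^sup>2) \<partial>lebesgue) \<le> ennreal e" if "e > 0" for e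
  proof -
    have "(\<integral>\<^sup>+ x. ennreal ((v k x - v l x)\<^sup>2) \<partial>lebesgue) = ennreal (LINT x|lebesgue. ((v k - v l) x)\<^sup>2)" for k l
      using nn[OF vd[of k l]] by (simp add: fun_diff_def)
    then show ?thesis using cauchy[OF that] by (metis ennreal_leI)
  qed
  obtain r where r: "strict_mono r" "AE x in lebesgue. convergent (\<lambda>k. v (r k) x)"
    by (rule L2_Cauchy_imp_AE_convergent_subseq[of v lebesgue, OF _ cauchy_nn]) (use v meas in auto)
  define u where "u x = lim (\<lambda>k. v (r k) x)" for x
  have um [measurable]: "u \<in> borel_measurable lebesgue"
    unfolding u_def by (rule borel_measurable_lim_metric) (use v meas in auto)
  have lim: "AE x in lebesgue. (\<lambda>k. v (r k) x) \<longlonglongrightarrow> u x"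
    using r(2) by (auto simp: u_def convergent_LIMSEQ_iff elim: eventually_mono)
  have vR: "gagliardo_nn s (v k) \<le> ennreal R" for k
    unfolding gagliardo_nn_eq[OF fs[OF v(1)]] by (rule ennreal_leI[OF v(2)])
  have "gagliardo_nn s u \<le> ennreal R"
    by (rule gagliardo_nn_fatou[OF meas[OF v(1)] um lim vR])
  then have "gagliardo_nn s u < \<infinity>" by (auto intro: le_less_trans)
  moreover have "AE x in lebesgue. x \<notin> \<Omega> \<longrightarrow> u x = 0"
  proof -
    have "AE x in lebesgue. \<forall>k. x \<notin> \<Omega> \<longrightarrow> v (r k) x = 0"
      unfolding AE_all_countable using v by (auto simp: frac_sobolev0_def)
    with lim show ?thesis
    proof eventually_elim
      case (elim x)
      then show ?case using LIMSEQ_unique[of "\<lambda>k. v (r k) x" "u x" 0] by auto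
    qed
  qed
  ultimately have u: "u \<in> ?V" using in_V[OF um] by blast
  have "(\<lambda>k. LINT x|lebesgue. ((v (r k) - u) x)\<^sup>2) \<longlonglongrightarrow> 0"
  proof (rule LIMSEQ_I)
    fix e :: real assume e: "e > 0"
    then obtain N where N: "\<And>k l. k \<ge> N \<Longrightarrow> l \<ge> N \<Longrightarrow> (\<integral>\<^sup>+ x. ennreal ((v k x - v l x)\<^sup>2) \<partial>lebesgue) \<le> ennreal (e / 2)"
      using cauchy_nn[of "e / 2"] by auto
    have "norm ((LINT x|lebesgue. ((v (r k) - u) x)\<^sup>2) - 0) < e" if k: "k \<ge> N" for k
    proof -
      have [measurable]: "v l \<in> borel_measurable lebesgue" for l using v meas by auto
      have rN: "r k \<ge> N" using seq_suble[OF r(1), of k] k by simp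
      \<comment> \<open>The index \<open>k\<close> is fixed and Fatou's lemma is applied in
        \<open>l\<close>.\<close>
      have "(\<integral>\<^sup>+ x. ennreal ((v (r k) x - u x)\<^sup>2) \<partial>lebesgue) =
          (\<integral>\<^sup>+ x. liminf (\<lambda>l. ennreal ((v (r k) x - v (r l) x)\<^sup>2)) \<partial>lebesgue)"
      proof (rule nn_integral_cong_AE)
        show "AE x in lebesgue. ennreal ((v (r k) x - u x)\<^sup>2) = liminf (\<lambda>l. ennreal ((v (r k) x - v (r l) x)\<^sup>2))"
          using lim
        proof eventually_elim
          case (elim x)
          then have "(\<lambda>l. ennreal ((v (r k) x - v (r l) x)\<^sup>2)) \<longlonglongrightarrow> ennreal ((v (r k) x - u x)\<^sup>2)"
            by (intro tendsto_intros)
          from lim_imp_Liminf[OF sequentially_bot this] show ?case by (rule sym)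
        qed
      qed
      also have "\<dots> \<le> liminf (\<lambda>l. \<integral>\<^sup>+ x. ennreal ((v (r k) x - v (r l) x)\<^sup>2) \<partial>lebesgue)"
        by (rule nn_integral_liminf) measurable
      also have "\<dots> \<le> ennreal (e / 2)"
      proof (rule Liminf_le)
        have "N \<le> r l" if "l \<ge> N" for l using seq_suble[OF r(1), of l] that by simp
        then show "\<forall>\<^sub>F l in sequentially. (\<integral>\<^sup>+ x. ennreal ((v (r k) x - v (r l) x)\<^sup>2) \<partial>lebesgue) \<le> ennreal (e / 2)"
          using N[OF rN] unfolding eventually_sequentially by blast
      qed simp
      finally have "ennreal (LINT x|lebesgue. ((v (r k) - u) x)\<^sup>2) \<le> ennreal (e / 2)"
        using nn[OF subspace_diff[OF subspace_frac_sobolev0 v(1)[of "r k"] u]] by (simp add: fun_diff_def)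
      then have "(LINT x|lebesgue. ((v (r k) - u) x)\<^sup>2) \<le> e / 2" using e by (simp add: ennreal_le_iff)
      moreover have "0 \<le> (LINT x|lebesgue. ((v (r k) - u) x)\<^sup>2)" by (intro integral_nonneg_AE) auto
      ultimately show ?thesis using e by simp
    qed
    then show "\<exists>N. \<forall>k\<ge>N. norm ((LINT x|lebesgue. ((v (r k) - u) x)\<^sup>2) - 0) < e" by blast
  qed
  then have "(\<lambda>k. LINT x|lebesgue. ((w ((diagseq \<circ> r) k) - u) x)\<^sup>2) \<longlonglongrightarrow> 0" by (simp add: v_def)
  with strict_mono_o[OF subseq_diagseq r(1)] u show ?thesis by (rule that)
qed

section \<open>Superposition operators\<close>

text \<open>For large arguments the surplus of the exponent \<open>\<beta>\<close> over
  \<open>\<alpha>\<close> makes \<open>\<bar>g t\<bar>\<close> at most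
  \<open>e * \<bar>t\<bar> powr \<beta>\<close>. On a compact interval nearby points are handled by
  uniform continuity, and for distant points the linear term dominates.\<close>

lemma continuous_growth_modulus:
  fixes g :: "real \<Rightarrow> real"
  assumes cont: "continuous_on UNIV g" and \<alpha>: "0 \<le> \<alpha>" "\<alpha> < \<beta>"
    and M: "0 < M" and growth: "\<And>t. \<bar>g t\<bar> \<le> M * (1 + \<bar>t\<bar> powr \<alpha>)" and e: "e > 0"
  obtains C where "0 \<le> C"
    "\<And>t \<tau>. \<bar>g t - g \<tau>\<bar> \<le> e * (1 + \<bar>t\<bar> powr \<beta> + \<bar>\<tau>\<bar> powr \<beta>) + C * \<bar>t - \<tau>\<bar>"
proof -
  \<comment> \<open>Beyond the second term, \<open>2 * M\<close> is at most
    \<open>e * \<bar>t\<bar> powr (\<beta> - \<alpha>)\<close>; the 1 allows the constant in the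
    growth bound to be absorbed into the power, which accounts for the factor 2.\<close>
  define T where "T = max 1 ((2 * M / e) powr (1 / (\<beta> - \<alpha>)))"
  have large: "\<bar>g t\<bar> \<le> e * \<bar>t\<bar> powr \<beta>" if t: "T \<le> \<bar>t\<bar>" for t
  proof -
    have t1: "1 \<le> \<bar>t\<bar>" using t by (simp add: T_def)
    have "2 * M / e = ((2 * M / e) powr (1 / (\<beta> - \<alpha>))) powr (\<beta> - \<alpha>)"
      using \<alpha> M e by (simp add: powr_powr)
    also have "\<dots> \<le> \<bar>t\<bar> powr (\<beta> - \<alpha>)"
      using t \<alpha> by (intro powr_mono2) (auto simp: T_def)
    finally have "2 * M \<le> e * \<bar>t\<bar> powr (\<beta> - \<alpha>)" using e by (simp add: field_simps)
    then have "2 * M * \<bar>t\<bar> powr \<alpha> \<le> e * \<bar>t\<bar> powr (\<beta> - \<alpha>) * \<bar>t\<bar> powr \<alpha>" by (rule mult_right_mono) simp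
    also have "\<dots> = e * \<bar>t\<bar> powr \<beta>" by (simp flip: powr_add)
    finally have "2 * M * \<bar>t\<bar> powr \<alpha> \<le> e * \<bar>t\<bar> powr \<beta>" .
    moreover have "M * 1 \<le> M * \<bar>t\<bar> powr \<alpha>"
      using M t1 \<alpha> by (intro mult_left_mono ge_one_powr_ge_zero) auto
    ultimately show ?thesis using growth[of t] by (simp add: distrib_left)
  qed
  have "compact (g ` {- (T + 1)..T + 1})"
    using cont by (intro compact_continuous_image) (auto intro: continuous_on_subset)
  then have "bounded (g ` {- (T + 1)..T + 1})" by (rule compact_imp_bounded)
  then obtain S where S': "\<forall>y\<in>g ` {- (T + 1)..T + 1}. norm y \<le> S" unfolding bounded_iff by blast
  have S: "\<bar>g t\<bar> \<le> S" if "\<bar>t\<bar> \<le> T + 1" for t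
    using S'[rule_format, OF imageI, of t] that by (auto simp: abs_le_iff)
  have S0: "0 \<le> S" using S[of 0] by (auto simp: T_def)
  have "uniformly_continuous_on {- (T + 1)..T + 1} g"
    using cont by (intro compact_uniformly_continuous) (auto intro: continuous_on_subset)
  then obtain d where d: "d > 0" "\<And>t \<tau>. \<bar>t\<bar> \<le> T + 1 \<Longrightarrow> \<bar>\<tau>\<bar> \<le> T + 1 \<Longrightarrow> \<bar>t - \<tau>\<bar> < d \<Longrightarrow> \<bar>g t - g \<tau>\<bar> < e"
    using e unfolding uniformly_continuous_on_def dist_real_def by (auto simp: abs_le_iff)
  \<comment> \<open>\<open>2 * S / d\<close> serves points of the compact interval at distance at
    least \<open>d\<close>. \<open>S\<close> serves the mixed case of one point inside
    \<open>T\<close> and one beyond \<open>T + 1\<close>, whose distance is at least 1.\<close>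
  define C where "C = max S (2 * S / d)"
  have half: "\<bar>g t - g \<tau>\<bar> \<le> e * (1 + \<bar>t\<bar> powr \<beta> + \<bar>\<tau>\<bar> powr \<beta>) + C * \<bar>t - \<tau>\<bar>" if t: "T + 1 < \<bar>t\<bar>" for t \<tau>
  proof (cases "T \<le> \<bar>\<tau>\<bar>")
    case True
    have "0 \<le> C * \<bar>t - \<tau>\<bar>" using S0 by (simp add: C_def le_max_iff_disj)
    then show ?thesis using large[of t] large[OF True] t e by (simp add: distrib_left) linarith
  next
    case False
    then have "1 \<le> \<bar>t - \<tau>\<bar>" using t by linarith
    then have "S * 1 \<le> C * \<bar>t - \<tau>\<bar>" using S0 by (intro mult_mono) (auto simp: C_def)
    moreover have "\<bar>g \<tau>\<bar> \<le> S" using False by (intro S) auto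
    moreover have "0 \<le> e * \<bar>\<tau>\<bar> powr \<beta>" using e by simp
    moreover have "\<bar>g t\<bar> \<le> e * \<bar>t\<bar> powr \<beta>" using t by (intro large) auto
    ultimately show ?thesis using e unfolding distrib_left mult_1_right by linarith
  qed
  have "\<bar>g t - g \<tau>\<bar> \<le> e * (1 + \<bar>t\<bar> powr \<beta> + \<bar>\<tau>\<bar> powr \<beta>) + C * \<bar>t - \<tau>\<bar>" for t \<tau>
  proof (cases "T + 1 < \<bar>t\<bar> \<or> T + 1 < \<bar>\<tau>\<bar>")
    case True
    then show ?thesis
    proof
      assume "T + 1 < \<bar>\<tau>\<bar>"
      from half[OF this, of t] show ?thesis by (simp add: abs_minus_commute add_ac)
    qed (rule half)
  next
    case False
    then have small: "\<bar>t\<bar> \<le> T + 1" "\<bar>\<tau>\<bar> \<le> T + 1" by auto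
    have "0 \<le> e * (\<bar>t\<bar> powr \<beta> + \<bar>\<tau>\<bar> powr \<beta>)" using e by simp
    moreover have "\<bar>g t - g \<tau>\<bar> \<le> e + C * \<bar>t - \<tau>\<bar>"
    proof (cases "\<bar>t - \<tau>\<bar> < d")
      case True
      have "0 \<le> C * \<bar>t - \<tau>\<bar>" using S0 by (simp add: C_def le_max_iff_disj)
      then show ?thesis using d(2)[OF small True] by simp
    next
      case False
      have "2 * S = 2 * S / d * d" using d(1) by simp
      also have "\<dots> \<le> C * \<bar>t - \<tau>\<bar>" using False d(1) S0 by (intro mult_mono) (auto simp: C_def)
      finally show ?thesis using S[OF small(1)] S[OF small(2)] e by linarith
    qed
    ultimately show ?thesis by (simp add: distrib_left)
  qed
  moreover have "0 \<le> C" using S0 by (simp add: C_def le_max_iff_disj)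
  ultimately show ?thesis by (rule that[rotated])
qed

lemma powr_mult_le_add:
  fixes t z :: real
  assumes "1 \<le> p"
  shows "\<bar>t\<bar> powr (p - 1) * \<bar>z\<bar> \<le> \<bar>t\<bar> powr p + \<bar>z\<bar> powr p"
proof -
  let ?m = "max \<bar>t\<bar> \<bar>z\<bar>"
  have "\<bar>t\<bar> powr (p - 1) * \<bar>z\<bar> \<le> ?m powr (p - 1) * ?m"
    using assms by (intro mult_mono powr_mono2) auto
  also have "\<dots> = ?m powr p"
    using powr_mult_base[of ?m "p - 1"] by (simp add: mult.commute le_max_iff_disj)
  also have "\<dots> \<le> \<bar>t\<bar> powr p + \<bar>z\<bar> powr p" by (simp add: max_def)
  finally show ?thesis .
qed

lemma powr_le_one_add_powr:
  fixes z :: real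
  assumes "0 \<le> a" "a \<le> p"
  shows "\<bar>z\<bar> powr a \<le> 1 + \<bar>z\<bar> powr p"
proof (cases "\<bar>z\<bar> \<le> 1")
  case True
  then have "\<bar>z\<bar> powr a \<le> 1" using assms by (intro powr_le1) auto
  then show ?thesis using powr_ge_zero[of "\<bar>z\<bar>" p] by linarith
next
  case False
  then have "\<bar>z\<bar> powr a \<le> \<bar>z\<bar> powr p" using assms by (intro powr_mono) auto
  then show ?thesis by simp
qed

lemma young_epsilon:
  fixes x y :: real
  assumes "e > 0"
  shows "C * x * y \<le> C\<^sup>2 / e * x\<^sup>2 + e * y\<^sup>2"
proof -
  have "0 \<le> (C * x / sqrt e - sqrt e * y)\<^sup>2" by simp
  also have "\<dots> = C\<^sup>2 / e * x\<^sup>2 + e * y\<^sup>2 - 2 * (C * x * y)"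
    using assms by (simp add: power2_diff power_divide power_mult_distrib)
  finally have "2 * (C * x * y) \<le> C\<^sup>2 / e * x\<^sup>2 + e * y\<^sup>2" by simp
  moreover have "0 \<le> C\<^sup>2 / e * x\<^sup>2 + e * y\<^sup>2" using assms by simp
  ultimately show ?thesis by linarith
qed

text \<open>The form is tailored to integration over \<Omega>: on bounded sets the p-th powers have
  bounded integrals by the Sobolev inequality, and the last term integrates to at most
  \<open>C * Q (u - v)\<close>. Young's inequality separates \<open>\<bar>t - \<tau>\<bar>\<close>
  from \<open>z\<close>.\<close>

lemma nemytskii_modulus:
  fixes g :: "real \<Rightarrow> real"
  assumes cont: "continuous_on UNIV g" and q: "1 \<le> q" "q < p" and p: "2 \<le> p"
    and M: "0 < M" and growth: "\<And>t. \<bar>g t\<bar> \<le> M * (1 + \<bar>t\<bar> powr (q - 1))" and e: "e > 0"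
  obtains C where "0 \<le> C"
    "\<And>t \<tau> z. \<bar>g t - g \<tau>\<bar> * \<bar>z\<bar> \<le> e * (1 + \<bar>t\<bar> powr p + \<bar>\<tau>\<bar> powr p + \<bar>z\<bar> powr p) + C * (t - \<tau>)\<^sup>2"
proof -
  \<comment> \<open>Four copies of \<open>\<bar>z\<bar> powr p\<close> arise below: one from
    \<open>\<bar>z\<bar>\<close>, two from the mixed products and one from Young's
    inequality.\<close>
  define e' where "e' = e / 4"
  have e': "e' > 0" using e by (simp add: e'_def)
  obtain C where C: "0 \<le> C"
    "\<And>t \<tau>. \<bar>g t - g \<tau>\<bar> \<le> e' * (1 + \<bar>t\<bar> powr (p - 1) + \<bar>\<tau>\<bar> powr (p - 1)) + C * \<bar>t - \<tau>\<bar>"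
    using continuous_growth_modulus[OF cont _ _ M growth e', of "p - 1"] q by auto
  have "\<bar>g t - g \<tau>\<bar> * \<bar>z\<bar> \<le> e * (1 + \<bar>t\<bar> powr p + \<bar>\<tau>\<bar> powr p + \<bar>z\<bar> powr p) + C\<^sup>2 / e' * (t - \<tau>)\<^sup>2" for t \<tau> z
  proof -
    have z1: "\<bar>z\<bar> \<le> 1 + \<bar>z\<bar> powr p" using powr_le_one_add_powr[of 1 p z] p by simp
    have z2: "z\<^sup>2 \<le> 1 + \<bar>z\<bar> powr p" using powr_le_one_add_powr[of 2 p z] p by simp
    have "\<bar>g t - g \<tau>\<bar> * \<bar>z\<bar> \<le> (e' * (1 + \<bar>t\<bar> powr (p - 1) + \<bar>\<tau>\<bar> powr (p - 1)) + C * \<bar>t - \<tau>\<bar>) * \<bar>z\<bar>"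
      by (rule mult_right_mono[OF C(2)]) simp
    also have "\<dots> = e' * (\<bar>z\<bar> + \<bar>t\<bar> powr (p - 1) * \<bar>z\<bar> + \<bar>\<tau>\<bar> powr (p - 1) * \<bar>z\<bar>) + C * \<bar>t - \<tau>\<bar> * \<bar>z\<bar>"
      by (simp add: algebra_simps)
    also have "\<dots> \<le> e' * ((1 + \<bar>z\<bar> powr p) + (\<bar>t\<bar> powr p + \<bar>z\<bar> powr p) + (\<bar>\<tau>\<bar> powr p + \<bar>z\<bar> powr p))
        + (C\<^sup>2 / e' * (t - \<tau>)\<^sup>2 + e' * (1 + \<bar>z\<bar> powr p))"
    proof (intro add_mono mult_left_mono)
      have "C * \<bar>t - \<tau>\<bar> * \<bar>z\<bar> \<le> C\<^sup>2 / e' * (t - \<tau>)\<^sup>2 + e' * z\<^sup>2"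
        using young_epsilon[OF e', of C "\<bar>t - \<tau>\<bar>" "\<bar>z\<bar>"] by simp
      also have "\<dots> \<le> C\<^sup>2 / e' * (t - \<tau>)\<^sup>2 + e' * (1 + \<bar>z\<bar> powr p)"
        using z2 e' by (intro add_left_mono mult_left_mono) auto
      finally show "C * \<bar>t - \<tau>\<bar> * \<bar>z\<bar> \<le> C\<^sup>2 / e' * (t - \<tau>)\<^sup>2 + e' * (1 + \<bar>z\<bar> powr p)" .
    qed (use z1 p e' in \<open>auto intro!: powr_mult_le_add\<close>)
    also have "\<dots> = e' * (2 + \<bar>t\<bar> powr p + \<bar>\<tau>\<bar> powr p + 4 * \<bar>z\<bar> powr p) + C\<^sup>2 / e' * (t - \<tau>)\<^sup>2"
      by (simp add: algebra_simps)
    also have "\<dots> \<le> e' * (4 * (1 + \<bar>t\<bar> powr p + \<bar>\<tau>\<bar> powr p + \<bar>z\<bar> powr p)) + C\<^sup>2 / e' * (t - \<tau>)\<^sup>2"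
      using e' by (intro add_right_mono mult_left_mono) auto
    also have "e' * (4 * (1 + \<bar>t\<bar> powr p + \<bar>\<tau>\<bar> powr p + \<bar>z\<bar> powr p)) = e * (1 + \<bar>t\<bar> powr p + \<bar>\<tau>\<bar> powr p + \<bar>z\<bar> powr p)"
      by (simp add: e'_def)
    finally show ?thesis .
  qed
  moreover have "0 \<le> C\<^sup>2 / e'" using e' by simp
  ultimately show ?thesis by (rule that[rotated])
qed

lemma primitive_has_derivative:
  assumes "continuous_on UNIV f"
  shows "(primitive f has_real_derivative f t) (at t)"
proof -
  let ?b = "\<bar>t\<bar> + 1"
  have "((\<lambda>u. LBINT y=ereal 0..ereal u. f y) has_vector_derivative (f t)) (at t within {- ?b..?b})"
    by (rule interval_integral_FTC2) (use assms in \<open>auto intro: continuous_on_subset\<close>)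
  then have "((\<lambda>u. LBINT y=ereal 0..ereal u. f y) has_vector_derivative (f t)) (at t)"
    by (subst (asm) at_within_interior) (auto simp: interior_atLeastAtMost_real)
  moreover have "(\<lambda>u. LBINT y=ereal 0..ereal u. f y) = primitive f"
    by (simp add: primitive_def fun_eq_iff)
  ultimately show ?thesis by (simp add: has_real_derivative_iff_has_vector_derivative)
qed

section \<open>The functional \<Psi> and its derivative on the Sobolev space\<close>

locale subcritical_problem =
  fixes s p q M P :: real and \<Omega> :: "(real ^ 'n) set" and f :: "real \<Rightarrow> real"
  assumes s: "0 < s" "2 * s < real CARD('n)"
    and \<Omega>: "open \<Omega>" "bounded \<Omega>"
    and p: "p = 2 * real CARD('n) / (real CARD('n) - 2 * s)" and q: "1 \<le> q" "q < p"
    and f_cont: "continuous_on UNIV f" and M: "0 < M"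
    and growth: "\<And>t. \<bar>f t\<bar> \<le> M * (1 + \<bar>t\<bar> powr (q - 1))"
    and P: "\<And>\<xi>. \<bar>primitive f \<xi>\<bar> \<le> P"
begin

abbreviation V :: "(real ^ 'n \<Rightarrow> real) set" where "V \<equiv> frac_sobolev0 s \<Omega>"

abbreviation Psi :: "(real ^ 'n \<Rightarrow> real) \<Rightarrow> real" where
  "Psi u \<equiv> LINT x:\<Omega>|lebesgue. primitive f (u x)"

abbreviation dPsi :: "(real ^ 'n \<Rightarrow> real) \<Rightarrow> (real ^ 'n \<Rightarrow> real) \<Rightarrow> real" where
  "dPsi u \<phi> \<equiv> LINT x:\<Omega>|lebesgue. f (u x) * \<phi> x"

abbreviation Q :: "(real ^ 'n \<Rightarrow> real) \<Rightarrow> real" where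
  "Q u \<equiv> LINT x|lebesgue. (u x)\<^sup>2"

lemma p_ge_2: "2 \<le> p"
  using s by (simp add: p field_simps)

lemma P_nonneg: "0 \<le> P"
  using P[of 0] by linarith

lemma V_measurable: "u \<in> V \<Longrightarrow> u \<in> borel_measurable lebesgue"
  and V_square: "u \<in> V \<Longrightarrow> integrable lebesgue (\<lambda>x. (u x)\<^sup>2)"
  by (auto simp: frac_sobolev0_def frac_sobolev_def)

lemma \<Omega>_sets [measurable]: "\<Omega> \<in> sets lebesgue"
  using \<Omega> by auto

lemma \<Omega>_integrable: "integrable lebesgue (indicator \<Omega> :: _ \<Rightarrow> real)"
proof -
  have "emeasure lebesgue \<Omega> < \<infinity>"
    using emeasure_bounded_finite[OF \<Omega>(2)] \<Omega>(1) by simp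
  then show ?thesis by (simp add: integrable_indicator_iff)
qed

lemma f_measurable [measurable]: "f \<in> borel_measurable borel"
  using f_cont by (rule borel_measurable_continuous_onI)

lemma primitive_deriv: "(primitive f has_real_derivative f t) (at t)"
  by (rule primitive_has_derivative[OF f_cont])

lemma primitive_cont: "continuous_on UNIV (primitive f)"
  using primitive_deriv by (auto intro!: continuous_at_imp_continuous_on DERIV_isCont)

lemma primitive_measurable [measurable]: "primitive f \<in> borel_measurable borel"
  using primitive_cont by (rule borel_measurable_continuous_onI)

lemma p_power_integrable: "u \<in> V \<Longrightarrow> integrable lebesgue (\<lambda>x. \<bar>u x\<bar> powr p)"
  using frac_sobolev0_sobolev[OF s \<Omega>(1) p] by blast

lemma p_power_bound:
  obtains S where "0 \<le> S" "\<And>u. u \<in> V \<Longrightarrow> gagliardo_sq s u \<le> R \<Longrightarrow> (LINT x|lebesgue. \<bar>u x\<bar> powr p) \<le> S"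
proof -
  obtain C where C: "C > 0" "\<And>u. u \<in> V \<Longrightarrow> (LINT x|lebesgue. \<bar>u x\<bar> powr p) \<le> (C * gagliardo_sq s u) powr (p / 2)"
    using frac_sobolev0_sobolev[OF s \<Omega>(1) p] by blast
  have "(LINT x|lebesgue. \<bar>u x\<bar> powr p) \<le> (C * R) powr (p / 2)" if "u \<in> V" "gagliardo_sq s u \<le> R" for u
  proof -
    have "(C * gagliardo_sq s u) powr (p / 2) \<le> (C * R) powr (p / 2)"
      using C(1) that p_ge_2 gagliardo_sq_nonneg[of s u] by (intro powr_mono2 mult_left_mono) auto
    then show ?thesis using C(2)[OF that(1)] by linarith
  qed
  then show ?thesis by (rule that[rotated]) simp_all
qed

text \<open>Common majorant of the superposition estimates, with integral bounded on bounded sets by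
  the Sobolev inequality. Where fewer than three functions occur, one of them is repeated.\<close>

definition weight :: "(real ^ 'n \<Rightarrow> real) \<Rightarrow> (real ^ 'n \<Rightarrow> real) \<Rightarrow> (real ^ 'n \<Rightarrow> real) \<Rightarrow> real ^ 'n \<Rightarrow> real" where
  "weight u v w x = indicator \<Omega> x * (1 + \<bar>u x\<bar> powr p + \<bar>v x\<bar> powr p + \<bar>w x\<bar> powr p)"

lemma weight_integrable:
  assumes "u \<in> V" "v \<in> V" "w \<in> V"
  shows "integrable lebesgue (weight u v w)"
proof (rule Bochner_Integration.integrable_bound)
  have [measurable]: "u \<in> borel_measurable lebesgue" "v \<in> borel_measurable lebesgue" "w \<in> borel_measurable lebesgue"
    using assms V_measurable by auto
  show "integrable lebesgue (\<lambda>x. indicator \<Omega> x + \<bar>u x\<bar> powr p + \<bar>v x\<bar> powr p + \<bar>w x\<bar> powr p)"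
    using assms by (intro Bochner_Integration.integrable_add \<Omega>_integrable p_power_integrable)
  show "weight u v w \<in> borel_measurable lebesgue" unfolding weight_def[abs_def] by measurable
qed (auto simp: weight_def indicator_def)

lemma weight_integral_le:
  assumes "u \<in> V" "v \<in> V" "w \<in> V"
  shows "integral\<^sup>L lebesgue (weight u v w) \<le>
    measure lebesgue \<Omega> + (LINT x|lebesgue. \<bar>u x\<bar> powr p) + (LINT x|lebesgue. \<bar>v x\<bar> powr p) + (LINT x|lebesgue. \<bar>w x\<bar> powr p)"
proof -
  have "integral\<^sup>L lebesgue (weight u v w) \<le> (LINT x|lebesgue. indicator \<Omega> x + \<bar>u x\<bar> powr p + \<bar>v x\<bar> powr p + \<bar>w x\<bar> powr p)"
    using assms by (intro Bochner_Integration.integral_mono weight_integrable Bochner_Integration.integrable_add \<Omega>_integrable p_power_integrable)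
      (auto simp: weight_def indicator_def)
  also have "\<dots> = measure lebesgue \<Omega> + (LINT x|lebesgue. \<bar>u x\<bar> powr p) + (LINT x|lebesgue. \<bar>v x\<bar> powr p) + (LINT x|lebesgue. \<bar>w x\<bar> powr p)"
    using assms p_power_integrable \<Omega>_integrable by simp
  finally show ?thesis .
qed

text \<open>Raising the growth exponent to \<open>p - 1\<close> makes the product with
  \<open>z\<close> controllable by p-th powers.\<close>

lemma f_mult_le:
  obtains C where "0 \<le> C" "\<And>t z. \<bar>f t\<bar> * \<bar>z\<bar> \<le> C * (1 + \<bar>t\<bar> powr p + \<bar>z\<bar> powr p)"
proof -
  have "\<bar>f t\<bar> * \<bar>z\<bar> \<le> (3 * M) * (1 + \<bar>t\<bar> powr p + \<bar>z\<bar> powr p)" for t z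
  proof -
    have z: "\<bar>z\<bar> \<le> 1 + \<bar>z\<bar> powr p" using powr_le_one_add_powr[of 1 p z] p_ge_2 by simp
    have t: "\<bar>t\<bar> powr (q - 1) \<le> 1 + \<bar>t\<bar> powr (p - 1)" using q by (intro powr_le_one_add_powr) auto
    have "\<bar>f t\<bar> * \<bar>z\<bar> \<le> (M * (1 + \<bar>t\<bar> powr (q - 1))) * \<bar>z\<bar>"
      by (rule mult_right_mono[OF growth]) simp
    also have "\<dots> \<le> (M * (1 + (1 + \<bar>t\<bar> powr (p - 1)))) * \<bar>z\<bar>"
      using t M by (intro mult_right_mono mult_left_mono add_left_mono) auto
    also have "\<dots> = M * (2 * \<bar>z\<bar> + \<bar>t\<bar> powr (p - 1) * \<bar>z\<bar>)" by (simp add: algebra_simps)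
    also have "\<dots> \<le> M * (2 * (1 + \<bar>z\<bar> powr p) + (\<bar>t\<bar> powr p + \<bar>z\<bar> powr p))"
      using z M p_ge_2 by (intro mult_left_mono add_mono powr_mult_le_add) auto
    also have "\<dots> \<le> M * (3 * (1 + \<bar>t\<bar> powr p + \<bar>z\<bar> powr p))"
      using M by (intro mult_left_mono) auto
    finally show ?thesis by (simp add: algebra_simps)
  qed
  then show ?thesis by (rule that[rotated]) (use M in simp)
qed

lemma dPsi_integrable:
  assumes "u \<in> V" "\<phi> \<in> V"
  shows "integrable lebesgue (\<lambda>x. indicator \<Omega> x *\<^sub>R (f (u x) * \<phi> x))"
proof -
  obtain C where C: "0 \<le> C" "\<And>t z. \<bar>f t\<bar> * \<bar>z\<bar> \<le> C * (1 + \<bar>t\<bar> powr p + \<bar>z\<bar> powr p)"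
    using f_mult_le by blast
  have [measurable]: "u \<in> borel_measurable lebesgue" "\<phi> \<in> borel_measurable lebesgue"
    using assms V_measurable by auto
  show ?thesis
  proof (rule Bochner_Integration.integrable_bound[OF integrable_mult_right[OF weight_integrable[OF assms(1,2) assms(1)], of C]])
    have "\<bar>f (u x) * \<phi> x\<bar> \<le> C * (1 + \<bar>u x\<bar> powr p + \<bar>\<phi> x\<bar> powr p + \<bar>u x\<bar> powr p)" for x
    proof -
      have "0 \<le> C * \<bar>u x\<bar> powr p" using C(1) by simp
      then show ?thesis using C(2)[of "u x" "\<phi> x"] by (simp add: abs_mult distrib_left)
    qed
    moreover have "0 \<le> C * (1 + \<bar>u x\<bar> powr p + \<bar>\<phi> x\<bar> powr p + \<bar>u x\<bar> powr p)" for x using C(1) by simp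
    ultimately show "AE x in lebesgue. norm (indicator \<Omega> x *\<^sub>R (f (u x) * \<phi> x)) \<le> norm (C * weight u \<phi> u x)"
      by (auto simp: weight_def indicator_def intro!: always_eventually)
  qed measurable
qed

lemma dPsi_bounded:
  "\<exists>C. \<forall>u\<in>V. gagliardo_sq s u \<le> R \<longrightarrow> (\<forall>\<phi>\<in>V. gagliardo_sq s \<phi> \<le> 1 \<longrightarrow> \<bar>dPsi u \<phi>\<bar> \<le> C)"
proof -
  obtain C where C: "0 \<le> C" "\<And>t z. \<bar>f t\<bar> * \<bar>z\<bar> \<le> C * (1 + \<bar>t\<bar> powr p + \<bar>z\<bar> powr p)"
    using f_mult_le by blast
  obtain S where S: "\<And>u. u \<in> V \<Longrightarrow> gagliardo_sq s u \<le> R \<Longrightarrow> (LINT x|lebesgue. \<bar>u x\<bar> powr p) \<le> S"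
    using p_power_bound[of R] by blast
  obtain S1 where S1: "\<And>u. u \<in> V \<Longrightarrow> gagliardo_sq s u \<le> 1 \<Longrightarrow> (LINT x|lebesgue. \<bar>u x\<bar> powr p) \<le> S1"
    using p_power_bound[of 1] by blast
  have "\<bar>dPsi u \<phi>\<bar> \<le> C * (measure lebesgue \<Omega> + S + S1 + S)"
    if u: "u \<in> V" "gagliardo_sq s u \<le> R" and \<phi>: "\<phi> \<in> V" "gagliardo_sq s \<phi> \<le> 1" for u \<phi>
  proof -
    have pt: "norm (indicator \<Omega> x *\<^sub>R (f (u x) * \<phi> x)) \<le> C * weight u \<phi> u x" for x
    proof -
      have "0 \<le> C * \<bar>u x\<bar> powr p" using C(1) by simp
      then show ?thesis using C(2)[of "u x" "\<phi> x"] by (simp add: abs_mult distrib_left weight_def indicator_def)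
    qed
    have "norm (dPsi u \<phi>) \<le> (LINT x|lebesgue. C * weight u \<phi> u x)"
      unfolding set_lebesgue_integral_def
      by (rule Bochner_Integration.integral_norm_bound_integral[OF dPsi_integrable[OF u(1) \<phi>(1)]
            integrable_mult_right[OF weight_integrable[OF u(1) \<phi>(1) u(1)]]]) (rule pt)
    also have "\<dots> = C * integral\<^sup>L lebesgue (weight u \<phi> u)" by simp
    also have "\<dots> \<le> C * (measure lebesgue \<Omega> + S + S1 + S)"
      using weight_integral_le[OF u(1) \<phi>(1) u(1)] S[OF u] S1[OF \<phi>] C(1)
      by (intro mult_left_mono) auto
    finally show ?thesis by simp
  qed
  then show ?thesis by blast
qed

text \<open>Subcriticality enters here, through \<open>nemytskii_modulus\<close>: the part of the
  difference that critical powers measure gets an arbitrarily small factor, and all the rest is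
  measured by \<open>Q\<close>.\<close>

lemma dPsi_uniformly_continuous:
  assumes e: "e > 0"
  shows "\<exists>d>0. \<forall>u\<in>V. \<forall>v\<in>V. gagliardo_sq s u \<le> R \<longrightarrow> gagliardo_sq s v \<le> R \<longrightarrow> Q (u - v) \<le> d
      \<longrightarrow> (\<forall>\<phi>\<in>V. gagliardo_sq s \<phi> \<le> 1 \<longrightarrow> \<bar>dPsi u \<phi> - dPsi v \<phi>\<bar> \<le> e)"
proof -
  obtain S where S: "0 \<le> S" "\<And>u. u \<in> V \<Longrightarrow> gagliardo_sq s u \<le> R \<Longrightarrow> (LINT x|lebesgue. \<bar>u x\<bar> powr p) \<le> S"
    using p_power_bound[of R] by blast
  obtain S1 where S1: "0 \<le> S1" "\<And>u. u \<in> V \<Longrightarrow> gagliardo_sq s u \<le> 1 \<Longrightarrow> (LINT x|lebesgue. \<bar>u x\<bar> powr p) \<le> S1"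
    using p_power_bound[of 1] by blast
  \<comment> \<open>Bounds the integral of the weight, and the added 1 makes it positive; the weight
    and the quadratic term then contribute at most \<open>e / 2\<close> each.\<close>
  define A where "A = measure lebesgue \<Omega> + S + S + S1 + 1"
  have A: "A > 0" using S(1) S1(1) by (simp add: A_def add_nonneg_pos)
  have e': "e / 2 / A > 0" using e A by simp
  obtain C where C: "0 \<le> C" "\<And>t \<tau> z. \<bar>f t - f \<tau>\<bar> * \<bar>z\<bar> \<le> e / 2 / A * (1 + \<bar>t\<bar> powr p + \<bar>\<tau>\<bar> powr p + \<bar>z\<bar> powr p) + C * (t - \<tau>)\<^sup>2"
    using nemytskii_modulus[OF f_cont q p_ge_2 M growth e'] by blast
  have "\<bar>dPsi u \<phi> - dPsi v \<phi>\<bar> \<le> e"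
    if u: "u \<in> V" "gagliardo_sq s u \<le> R" and v: "v \<in> V" "gagliardo_sq s v \<le> R" and uv: "Q (u - v) \<le> e / 2 / (C + 1)"
      and \<phi>: "\<phi> \<in> V" "gagliardo_sq s \<phi> \<le> 1" for u v \<phi>
  proof -
    have duv: "u - v \<in> V" by (intro subspace_diff[OF subspace_frac_sobolev0] u v)
    have pt: "norm (indicator \<Omega> x *\<^sub>R (f (u x) * \<phi> x) - indicator \<Omega> x *\<^sub>R (f (v x) * \<phi> x))
        \<le> e / 2 / A * weight u v \<phi> x + C * ((u - v) x)\<^sup>2" for x
      using C(1) C(2)[of "u x" "v x" "\<phi> x"]
      by (simp add: weight_def indicator_def abs_mult flip: left_diff_distrib)
    have "norm (dPsi u \<phi> - dPsi v \<phi>) = norm (LINT x|lebesgue. indicator \<Omega> x *\<^sub>R (f (u x) * \<phi> x) - indicator \<Omega> x *\<^sub>R (f (v x) * \<phi> x))"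
      unfolding set_lebesgue_integral_def
      by (subst Bochner_Integration.integral_diff[OF dPsi_integrable[OF u(1) \<phi>(1)] dPsi_integrable[OF v(1) \<phi>(1)]]) simp
    also have "\<dots> \<le> (LINT x|lebesgue. e / 2 / A * weight u v \<phi> x + C * ((u - v) x)\<^sup>2)"
      by (rule Bochner_Integration.integral_norm_bound_integral[OF
            Bochner_Integration.integrable_diff[OF dPsi_integrable[OF u(1) \<phi>(1)] dPsi_integrable[OF v(1) \<phi>(1)]]
            Bochner_Integration.integrable_add[OF integrable_mult_right[OF weight_integrable[OF u(1) v(1) \<phi>(1)]]
              integrable_mult_right[OF V_square[OF duv]]]]) (rule pt)
    also have "\<dots> = e / 2 / A * integral\<^sup>L lebesgue (weight u v \<phi>) + C * Q (u - v)"
      by (subst Bochner_Integration.integral_add[OF integrable_mult_right[OF weight_integrable[OF u(1) v(1) \<phi>(1)]]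
              integrable_mult_right[OF V_square[OF duv]]]) simp
    also have "\<dots> \<le> e / 2 / A * A + C * (e / 2 / (C + 1))"
    proof (intro add_mono mult_left_mono)
      show "integral\<^sup>L lebesgue (weight u v \<phi>) \<le> A"
        using weight_integral_le[OF u(1) v(1) \<phi>(1)] S(2)[OF u] S(2)[OF v] S1(2)[OF \<phi>] by (simp add: A_def)
    qed (use uv C(1) e' in auto)
    also have "\<dots> \<le> e / 2 + e / 2"
      using A C(1) e by (intro add_mono) (auto simp: divide_simps)
    finally show ?thesis by simp
  qed
  moreover have "e / 2 / (C + 1) > 0" using e C(1) by simp
  ultimately show ?thesis by blast
qed

lemma Psi_integrable: "u \<in> V \<Longrightarrow> integrable lebesgue (\<lambda>x. indicator \<Omega> x *\<^sub>R primitive f (u x))"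
proof -
  assume u: "u \<in> V"
  have [measurable]: "u \<in> borel_measurable lebesgue" by (rule V_measurable[OF u])
  show ?thesis
    by (rule Bochner_Integration.integrable_bound[OF integrable_mult_right[OF \<Omega>_integrable, of P]])
      (use P P_nonneg in \<open>auto simp: indicator_def\<close>)
qed

text \<open>As before, but without a test function the modulus leaves a linear term in the
  difference. Young's inequality against the constant 1 makes it quadratic; the constant is
  integrable because \<Omega> is bounded.\<close>

lemma Psi_uniformly_continuous:
  assumes e: "e > 0"
  shows "\<exists>d>0. \<forall>u\<in>V. \<forall>v\<in>V. gagliardo_sq s u \<le> R \<longrightarrow> gagliardo_sq s v \<le> R \<longrightarrow> Q (u - v) \<le> d
      \<longrightarrow> \<bar>Psi u - Psi v\<bar> \<le> e"
proof -
  obtain S where S: "0 \<le> S" "\<And>u. u \<in> V \<Longrightarrow> gagliardo_sq s u \<le> R \<Longrightarrow> (LINT x|lebesgue. \<bar>u x\<bar> powr p) \<le> S"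
    using p_power_bound[of R] by blast
  define A where "A = measure lebesgue \<Omega> + S + S + S + 1"
  have A: "A > 0" using S(1) by (simp add: A_def add_nonneg_pos)
  have e': "e / 4 / A > 0" using e A by simp
  \<comment> \<open>Boundedness is presented as growth with exponent 0; \<open>P + 1\<close> in
    place of \<open>P\<close> ensures a positive constant.\<close>
  have P1: "\<bar>primitive f t\<bar> \<le> (P + 1) * (1 + \<bar>t\<bar> powr 0)" for t
  proof -
    have "\<bar>primitive f t\<bar> \<le> (P + 1) * 1" using P[of t] by simp
    also have "\<dots> \<le> (P + 1) * (1 + \<bar>t\<bar> powr 0)" using P_nonneg by (intro mult_left_mono) auto
    finally show ?thesis .
  qed
  obtain C where C: "0 \<le> C" "\<And>t \<tau>. \<bar>primitive f t - primitive f \<tau>\<bar> \<le> e / 4 / A * (1 + \<bar>t\<bar> powr p + \<bar>\<tau>\<bar> powr p) + C * \<bar>t - \<tau>\<bar>"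
    using continuous_growth_modulus[OF primitive_cont _ _ _ P1 e', of p] p_ge_2 P_nonneg by auto
  define C' where "C' = C\<^sup>2 / (e / 4 / A)"
  have C'0: "0 \<le> C'" using e A by (simp add: C'_def)
  have "\<bar>Psi u - Psi v\<bar> \<le> e"
    if u: "u \<in> V" "gagliardo_sq s u \<le> R" and v: "v \<in> V" "gagliardo_sq s v \<le> R" and uv: "Q (u - v) \<le> e / 2 / (C' + 1)" for u v
  proof -
    have duv: "u - v \<in> V" by (intro subspace_diff[OF subspace_frac_sobolev0] u v)
    have pt: "norm (indicator \<Omega> x *\<^sub>R primitive f (u x) - indicator \<Omega> x *\<^sub>R primitive f (v x))
        \<le> 2 * (e / 4 / A) * weight u v u x + C' * ((u - v) x)\<^sup>2" for x
    proof (cases "x \<in> \<Omega>")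
      case True
      have "C * \<bar>u x - v x\<bar> \<le> C' * (u x - v x)\<^sup>2 + e / 4 / A"
        using young_epsilon[OF e', of C "\<bar>u x - v x\<bar>" 1] by (simp add: C'_def)
      moreover have "0 \<le> e / 4 / A * \<bar>u x\<bar> powr p" "0 \<le> e / 4 / A * \<bar>v x\<bar> powr p" using e A by auto
      ultimately have "\<bar>primitive f (u x) - primitive f (v x)\<bar> \<le>
          2 * (e / 4 / A) * (1 + \<bar>u x\<bar> powr p + \<bar>v x\<bar> powr p + \<bar>u x\<bar> powr p) + C' * (u x - v x)\<^sup>2"
        using C(2)[of "u x" "v x"] unfolding distrib_left mult.assoc by linarith
      then show ?thesis using True by (simp add: weight_def)
    qed (use C'0 in \<open>simp add: weight_def\<close>)
    have "norm (Psi u - Psi v) = norm (LINT x|lebesgue. indicator \<Omega> x *\<^sub>R primitive f (u x) - indicator \<Omega> x *\<^sub>R primitive f (v x))"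
      unfolding set_lebesgue_integral_def
      by (subst Bochner_Integration.integral_diff[OF Psi_integrable[OF u(1)] Psi_integrable[OF v(1)]]) simp
    also have "\<dots> \<le> (LINT x|lebesgue. 2 * (e / 4 / A) * weight u v u x + C' * ((u - v) x)\<^sup>2)"
      by (rule Bochner_Integration.integral_norm_bound_integral[OF
            Bochner_Integration.integrable_diff[OF Psi_integrable[OF u(1)] Psi_integrable[OF v(1)]]
            Bochner_Integration.integrable_add[OF integrable_mult_right[OF weight_integrable[OF u(1) v(1) u(1)]]
              integrable_mult_right[OF V_square[OF duv]]]]) (rule pt)
    also have "\<dots> = 2 * (e / 4 / A) * integral\<^sup>L lebesgue (weight u v u) + C' * Q (u - v)"
      by (subst Bochner_Integration.integral_add[OF integrable_mult_right[OF weight_integrable[OF u(1) v(1) u(1)]]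
              integrable_mult_right[OF V_square[OF duv]]]) simp
    also have "\<dots> \<le> 2 * (e / 4 / A) * A + C' * (e / 2 / (C' + 1))"
    proof (intro add_mono mult_left_mono)
      show "integral\<^sup>L lebesgue (weight u v u) \<le> A"
        using weight_integral_le[OF u(1) v(1) u(1)] S(2)[OF u] S(2)[OF v] by (simp add: A_def)
    qed (use uv C'0 e' in auto)
    also have "\<dots> \<le> e / 2 + e / 2"
      using A C'0 e by (intro add_mono) (auto simp: divide_simps)
    finally show ?thesis by simp
  qed
  moreover have "e / 2 / (C' + 1) > 0" using e C'0 by simp
  ultimately show ?thesis by blast
qed

text \<open>Dominated convergence of the difference quotients along arbitrary null sequences. The
  mean value theorem turns each quotient into \<open>f \<xi> * w x\<close> with \<open>\<xi>\<close>
  between \<open>u x\<close> and the shifted value, which provides the majorant.\<close>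

lemma Psi_has_derivative:
  assumes u: "u \<in> V" and w: "w \<in> V"
  shows "((\<lambda>t. Psi (u + t *\<^sub>R w)) has_real_derivative dPsi u w) (at 0)"
proof -
  have [measurable]: "u \<in> borel_measurable lebesgue" "w \<in> borel_measurable lebesgue"
    using u w V_measurable by auto
  have in_V: "u + t *\<^sub>R w \<in> V" for t
    by (intro subspace_add[OF subspace_frac_sobolev0] subspace_scale[OF subspace_frac_sobolev0] u w)
  obtain C where C: "0 \<le> C" "\<And>t z. \<bar>f t\<bar> * \<bar>z\<bar> \<le> C * (1 + \<bar>t\<bar> powr p + \<bar>z\<bar> powr p)"
    using f_mult_le by blast
  have "((\<lambda>h. (Psi (u + h *\<^sub>R w) - Psi u) / h) \<longlongrightarrow> dPsi u w) (at 0)"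
    unfolding tendsto_at_iff_sequentially
  proof (intro allI impI)
    fix X :: "nat \<Rightarrow> real" assume X: "\<forall>i. X i \<in> UNIV - {0}" and X0: "X \<longlonglongrightarrow> 0"
    then have Xnz: "X i \<noteq> 0" for i by auto
    obtain K where K: "\<And>i. \<bar>X i\<bar> \<le> K"
      using Bseq_def[of X] convergent_imp_Bseq[of X] X0 by (auto simp: convergent_def)
    define g where "g i x = indicator \<Omega> x *\<^sub>R ((primitive f (u x + X i * w x) - primitive f (u x)) / X i)" for i x
    \<comment> \<open>From \<open>\<bar>\<xi>\<bar> \<le> \<bar>u x\<bar> + K * \<bar>w
      x\<bar>\<close>, the p-th power of the sum being estimated by that of twice the
      maximum.\<close>
    define C1 where "C1 = C * (1 + 2 powr p * (1 + K powr p))"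
    have mv: "\<exists>\<xi>. \<bar>\<xi>\<bar> \<le> \<bar>u x\<bar> + K * \<bar>w x\<bar> \<and> (primitive f (u x + X i * w x) - primitive f (u x)) / X i = f \<xi> * w x" for i x
    proof -
      have d: "((\<lambda>t. primitive f (u x + t * w x)) has_real_derivative f (u x + t * w x) * w x) (at t)" for t
        by (rule DERIV_chain2[OF primitive_deriv]) (auto intro!: derivative_eq_intros)
      have "\<exists>t. \<bar>t\<bar> \<le> \<bar>X i\<bar> \<and> primitive f (u x + X i * w x) - primitive f (u x) = X i * (f (u x + t * w x) * w x)"
      proof (cases "0 < X i")
        case True
        obtain t where "0 < t" "t < X i" "primitive f (u x + X i * w x) - primitive f (u x + 0 * w x) = (X i - 0) * (f (u x + t * w x) * w x)"
          using MVT2[OF True, of "\<lambda>t. primitive f (u x + t * w x)" "\<lambda>t. f (u x + t * w x) * w x"] d by blast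
        then show ?thesis by (intro exI[of _ t]) auto
      next
        case False
        then have neg: "X i < 0" using Xnz[of i] by simp
        obtain t where "X i < t" "t < 0" "primitive f (u x + 0 * w x) - primitive f (u x + X i * w x) = (0 - X i) * (f (u x + t * w x) * w x)"
          using MVT2[OF neg, of "\<lambda>t. primitive f (u x + t * w x)" "\<lambda>t. f (u x + t * w x) * w x"] d by blast
        then show ?thesis by (intro exI[of _ t]) auto
      qed
      then obtain t where t: "\<bar>t\<bar> \<le> \<bar>X i\<bar>" "primitive f (u x + X i * w x) - primitive f (u x) = X i * (f (u x + t * w x) * w x)"
        by blast
      have "\<bar>t * w x\<bar> \<le> K * \<bar>w x\<bar>"
        unfolding abs_mult using t(1) K[of i] by (intro mult_right_mono) auto
      then have "\<bar>u x + t * w x\<bar> \<le> \<bar>u x\<bar> + K * \<bar>w x\<bar>" by linarith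
      then show ?thesis using t(2) Xnz[of i] by (intro exI[of _ "u x + t * w x"]) simp
    qed
    have gb: "norm (g i x) \<le> C1 * weight u w u x" for i x
    proof (cases "x \<in> \<Omega>")
      case True
      obtain \<xi> where \<xi>: "\<bar>\<xi>\<bar> \<le> \<bar>u x\<bar> + K * \<bar>w x\<bar>" "(primitive f (u x + X i * w x) - primitive f (u x)) / X i = f \<xi> * w x"
        using mv by blast
      let ?m = "max \<bar>u x\<bar> (K * \<bar>w x\<bar>)"
      have "\<bar>\<xi>\<bar> powr p \<le> (2 * ?m) powr p" using \<xi>(1) p_ge_2 by (intro powr_mono2) auto
      also have "\<dots> = 2 powr p * ?m powr p" by (rule powr_mult)
      also have "\<dots> \<le> 2 powr p * (\<bar>u x\<bar> powr p + (K * \<bar>w x\<bar>) powr p)"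
        by (intro mult_left_mono) (auto simp: max_def)
      also have "(K * \<bar>w x\<bar>) powr p = K powr p * \<bar>w x\<bar> powr p" by (rule powr_mult)
      finally have \<xi>p: "\<bar>\<xi>\<bar> powr p \<le> 2 powr p * (\<bar>u x\<bar> powr p + K powr p * \<bar>w x\<bar> powr p)" .
      let ?W = "1 + \<bar>u x\<bar> powr p + \<bar>w x\<bar> powr p + \<bar>u x\<bar> powr p"
      have W: "1 + \<bar>w x\<bar> powr p \<le> ?W" by simp
      have "\<bar>u x\<bar> powr p + K powr p * \<bar>w x\<bar> powr p \<le> (1 + K powr p) * ?W"
      proof -
        have "\<bar>u x\<bar> powr p \<le> 1 * ?W" by simp
        moreover have "K powr p * \<bar>w x\<bar> powr p \<le> K powr p * ?W" by (intro mult_left_mono) auto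
        ultimately show ?thesis unfolding distrib_right by linarith
      qed
      then have "2 powr p * (\<bar>u x\<bar> powr p + K powr p * \<bar>w x\<bar> powr p) \<le> 2 powr p * ((1 + K powr p) * ?W)"
        by (intro mult_left_mono) auto
      then have "1 + \<bar>\<xi>\<bar> powr p + \<bar>w x\<bar> powr p \<le> ?W + 2 powr p * ((1 + K powr p) * ?W)"
        using \<xi>p W by linarith
      also have "\<dots> = (1 + 2 powr p * (1 + K powr p)) * ?W" by (simp add: algebra_simps)
      finally have "C * (1 + \<bar>\<xi>\<bar> powr p + \<bar>w x\<bar> powr p) \<le> C * ((1 + 2 powr p * (1 + K powr p)) * ?W)"
        using C(1) by (rule mult_left_mono)
      then have "\<bar>f \<xi>\<bar> * \<bar>w x\<bar> \<le> C1 * ?W" using C(2)[of \<xi> "w x"] by (simp add: C1_def mult.assoc)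
      then show ?thesis using True \<xi>(2) by (simp add: g_def weight_def abs_mult)
    qed (simp add: g_def weight_def)
    have [measurable]: "g i \<in> borel_measurable lebesgue" for i unfolding g_def[abs_def] by measurable
    have "(\<lambda>i. integral\<^sup>L lebesgue (g i)) \<longlonglongrightarrow> (LINT x|lebesgue. indicator \<Omega> x *\<^sub>R (f (u x) * w x))"
    proof (rule integral_dominated_convergence[where w = "\<lambda>x. C1 * weight u w u x"])
      show "integrable lebesgue (\<lambda>x. C1 * weight u w u x)"
        by (intro integrable_mult_right weight_integrable u w)
      show "AE x in lebesgue. (\<lambda>i. g i x) \<longlonglongrightarrow> indicator \<Omega> x *\<^sub>R (f (u x) * w x)"
      proof (intro always_eventually allI)
        fix x
        have "((\<lambda>t. primitive f (u x + t * w x)) has_real_derivative f (u x + 0 * w x) * w x) (at 0)"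
          by (rule DERIV_chain2[OF primitive_deriv]) (auto intro!: derivative_eq_intros)
        then have "((\<lambda>h. (primitive f (u x + h * w x) - primitive f (u x)) / h) \<longlongrightarrow> f (u x) * w x) (at 0)"
          by (simp add: DERIV_def)
        then have "(\<lambda>i. (primitive f (u x + X i * w x) - primitive f (u x)) / X i) \<longlonglongrightarrow> f (u x) * w x"
          using X X0 unfolding tendsto_at_iff_sequentially by (auto simp: o_def)
        then show "(\<lambda>i. g i x) \<longlonglongrightarrow> indicator \<Omega> x *\<^sub>R (f (u x) * w x)"
          unfolding g_def by (intro tendsto_intros)
      qed
    qed (use gb in auto)
    moreover have "(Psi (u + X i *\<^sub>R w) - Psi u) / X i = integral\<^sup>L lebesgue (g i)" for i
    proof -
      have "Psi (u + X i *\<^sub>R w) - Psi u = (LINT x|lebesgue. indicator \<Omega> x *\<^sub>R primitive f ((u + X i *\<^sub>R w) x) - indicator \<Omega> x *\<^sub>R primitive f (u x))"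
        unfolding set_lebesgue_integral_def
        by (subst Bochner_Integration.integral_diff[OF Psi_integrable[OF in_V] Psi_integrable[OF u]]) simp
      also have "\<dots> = (LINT x|lebesgue. g i x * X i)"
        using Xnz[of i] by (intro Bochner_Integration.integral_cong) (auto simp: g_def fun_vector_simps right_diff_distrib)
      also have "\<dots> = integral\<^sup>L lebesgue (g i) * X i" by simp
      finally show ?thesis using Xnz[of i] by simp
    qed
    ultimately show "((\<lambda>h. (Psi (u + h *\<^sub>R w) - Psi u) / h) \<circ> X) \<longlonglongrightarrow> dPsi u w"
      by (simp add: o_def set_lebesgue_integral_def)
  qed
  moreover have "Psi (u + 0 *\<^sub>R w) = Psi u" by simp
  ultimately show ?thesis unfolding DERIV_def by simp
qed

lemma dPsi_add: "u \<in> V \<Longrightarrow> \<phi> \<in> V \<Longrightarrow> \<psi> \<in> V \<Longrightarrow> dPsi u (\<phi> + \<psi>) = dPsi u \<phi> + dPsi u \<psi>"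
  using Bochner_Integration.integral_add[OF dPsi_integrable[of u \<phi>] dPsi_integrable[of u \<psi>]]
  by (simp add: set_lebesgue_integral_def fun_vector_simps distrib_left)

lemma dPsi_scale: "dPsi u (c *\<^sub>R \<phi>) = c * dPsi u \<phi>"
proof -
  have "dPsi u (c *\<^sub>R \<phi>) = (LINT x|lebesgue. c * (indicator \<Omega> x *\<^sub>R (f (u x) * \<phi> x)))"
    unfolding set_lebesgue_integral_def by (intro Bochner_Integration.integral_cong) (auto simp: fun_vector_simps)
  then show ?thesis by (simp add: set_lebesgue_integral_def)
qed

sublocale energy_space V "gagliardo_form s" Q Psi dPsi
proof
  show "gagliardo_form s (u + v) w = gagliardo_form s u w + gagliardo_form s v w" if "u \<in> V" "v \<in> V" "w \<in> V" for u v w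
    using that by (intro gagliardo_form_add) (auto simp: frac_sobolev0_def)
  show "0 \<le> gagliardo_form s u u" for u :: "real ^ 'n \<Rightarrow> real"
    by (simp add: gagliardo_form_self gagliardo_sq_nonneg)
  show "\<exists>C. \<forall>u\<in>V. Q u \<le> C * gagliardo_form s u u"
    using frac_sobolev0_poincare[OF s(1) \<Omega>] by (auto simp: gagliardo_form_self)
next
  fix w :: "nat \<Rightarrow> real ^ 'n \<Rightarrow> real" and R
  assume "\<And>k. w k \<in> V" "\<And>k. gagliardo_form s (w k) (w k) \<le> R"
  then show "\<exists>r u. strict_mono r \<and> u \<in> V \<and> (\<lambda>k. Q (w (r k) - u)) \<longlonglongrightarrow> 0"
    using frac_sobolev0_compact[OF s(1) \<Omega>, of w R] unfolding gagliardo_form_self by blast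
next
  fix w :: "nat \<Rightarrow> real ^ 'n \<Rightarrow> real" and c u
  assume "\<And>k. w k \<in> V" "\<And>k. gagliardo_form s (w k) (w k) \<le> c" "u \<in> V" "(\<lambda>k. Q (w k - u)) \<longlonglongrightarrow> 0"
  then show "gagliardo_form s u u \<le> c"
    unfolding gagliardo_form_self by (rule frac_sobolev0_lsc)
next
  show "Q u \<ge> 0" for u :: "real ^ 'n \<Rightarrow> real" by (intro integral_nonneg_AE) auto
  show "gagliardo_form s u w = gagliardo_form s w u" for u w :: "real ^ 'n \<Rightarrow> real"
    by (rule gagliardo_form_commute)
  show "\<exists>C. \<forall>u\<in>V. gagliardo_form s u u \<le> R \<longrightarrow> (\<forall>\<phi>\<in>V. gagliardo_form s \<phi> \<phi> \<le> 1 \<longrightarrow> \<bar>dPsi u \<phi>\<bar> \<le> C)" for R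
    unfolding gagliardo_form_self by (rule dPsi_bounded)
  show "\<exists>d>0. \<forall>u\<in>V. \<forall>v\<in>V. gagliardo_form s u u \<le> R \<longrightarrow> gagliardo_form s v v \<le> R \<longrightarrow> Q (u - v) \<le> d
      \<longrightarrow> (\<forall>\<phi>\<in>V. gagliardo_form s \<phi> \<phi> \<le> 1 \<longrightarrow> \<bar>dPsi u \<phi> - dPsi v \<phi>\<bar> \<le> e)" if "e > 0" for e R
    unfolding gagliardo_form_self by (rule dPsi_uniformly_continuous[OF that])
  show "\<exists>d>0. \<forall>u\<in>V. \<forall>v\<in>V. gagliardo_form s u u \<le> R \<longrightarrow> gagliardo_form s v v \<le> R \<longrightarrow> Q (u - v) \<le> d
      \<longrightarrow> \<bar>Psi u - Psi v\<bar> \<le> e" if "e > 0" for e R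
    unfolding gagliardo_form_self by (rule Psi_uniformly_continuous[OF that])
qed (rule subspace_frac_sobolev0 gagliardo_form_scale dPsi_add dPsi_scale Psi_has_derivative; assumption)+

end

section \<open>Lipschitz test functions\<close>

lemma dyadic_bracket:
  fixes r :: real
  assumes "1 \<le> r"
  obtains j where "2 ^ j \<le> r" "r < 2 ^ Suc j"
proof -
  have "1 \<le> nat \<lfloor>r\<rfloor>" using assms by linarith
  then obtain j where j: "2 ^ j \<le> nat \<lfloor>r\<rfloor>" "nat \<lfloor>r\<rfloor> < 2 ^ (j + 1)"
    using ex_power_ivl1[of 2 "nat \<lfloor>r\<rfloor>"] by auto
  have "real (2 ^ j) \<le> real (nat \<lfloor>r\<rfloor>)" using j(1) by (rule of_nat_mono)
  also have "\<dots> \<le> r" using assms by linarith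
  finally have 1: "2 ^ j \<le> r" by simp
  have "nat \<lfloor>r\<rfloor> + 1 \<le> 2 ^ (j + 1)" using j(2) by simp
  then have "real (nat \<lfloor>r\<rfloor> + 1) \<le> real (2 ^ (j + 1))" by (rule of_nat_mono)
  moreover have "r < real (nat \<lfloor>r\<rfloor> + 1)" using assms by linarith
  ultimately have "r < 2 ^ Suc j" by simp
  with 1 show ?thesis by (rule that)
qed

text \<open>Dyadic shells stand in for polar coordinates. The shells near \<open>x\<close>
  contribute a geometric series with ratio \<open>2 powr (2 * s - 2)\<close>, the distant ones a
  series with ratio \<open>2 powr (- 2 * s)\<close>; both ratios are below 1 because
  \<open>0 < s\<close> and \<open>s < 1\<close>.\<close>

lemma truncated_kernel_integral_bounded:
  assumes s: "0 < s" "s < 1"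
  obtains \<kappa> where "0 \<le> \<kappa>"
    "\<And>x :: real ^ 'n. (\<integral>\<^sup>+ y. ennreal (min 1 ((norm (x - y))\<^sup>2) / gagliardo_kernel s x y) \<partial>lborel) \<le> ennreal \<kappa>"
proof -
  let ?n = "CARD('n)" and ?\<beta> = "real CARD('n) + 2 * s" and ?w = "unit_ball_vol (real CARD('n))"
  have w: "0 < ?w" by simp
  \<comment> \<open>\<open>a j\<close> bounds the integrand for distances in
    \<open>(1 / 2 ^ Suc j, 1 / 2 ^ j]\<close>, and \<open>b j\<close> for distances in
    \<open>[2 ^ j, 2 ^ Suc j)\<close>. Each shell is enlarged to an open ball, whose measure is
    explicit; hence the radius \<open>2 / 2 ^ j\<close> for the former.\<close>
  define a where "a j = (2 * 2 ^ j) powr ?\<beta> * (1 / 2 ^ j)\<^sup>2" for j :: nat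
  define b where "b j = 1 / (2 ^ j) powr ?\<beta>" for j :: nat
  have ab: "0 \<le> a j" "0 \<le> b j" for j by (auto simp: a_def b_def)
  have two: "(2::real) ^ j = 2 powr real j" for j by (simp add: powr_realpow)
  have aj: "a j * (?w * (2 / 2 ^ j) ^ ?n) = ?w * 2 ^ ?n * 2 powr ?\<beta> * (2 powr (2 * s - 2)) ^ j" for j
  proof -
    have "(2 * 2 ^ j) powr ?\<beta> = 2 powr ?\<beta> * 2 powr (real j * ?\<beta>)"
      by (simp add: powr_mult two powr_powr)
    moreover have "(1 / 2 ^ j)\<^sup>2 = (2::real) powr (- 2 * real j)"
      by (simp add: powr_minus two power2_eq_square powr_add[symmetric] field_simps)
    moreover have "(2 / 2 ^ j) ^ ?n = 2 ^ ?n * (2::real) powr (- real j * real ?n)"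
      by (simp add: power_divide two powr_powr powr_minus inverse_eq_divide flip: powr_realpow)
    moreover have "(2 powr (2 * s - 2)) ^ j = 2 powr (real j * ?\<beta>) * 2 powr (- 2 * real j) * (2::real) powr (- real j * real ?n)"
      by (simp add: powr_powr algebra_simps flip: powr_realpow powr_add)
    ultimately show ?thesis by (simp add: a_def)
  qed
  have bj: "b j * (?w * (2 ^ Suc j) ^ ?n) = ?w * 2 ^ ?n * (2 powr (- 2 * s)) ^ j" for j
  proof -
    have "b j = 2 powr (- real j * ?\<beta>)" by (simp add: b_def two powr_powr powr_minus inverse_eq_divide)
    moreover have "(2 ^ Suc j) ^ ?n = 2 ^ ?n * (2::real) powr (real j * real ?n)"
      by (simp add: power_mult_distrib two powr_powr flip: powr_realpow)
    moreover have "(2 powr (- 2 * s)) ^ j = 2 powr (- real j * ?\<beta>) * (2::real) powr (real j * real ?n)"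
      by (simp add: powr_powr algebra_simps flip: powr_realpow powr_add)
    ultimately show ?thesis by simp
  qed
  have sa: "summable (\<lambda>j. a j * (?w * (2 / 2 ^ j) ^ ?n))"
    unfolding aj using s by (intro summable_mult summable_geometric) (simp add: powr_less_one)
  have sb: "summable (\<lambda>j. b j * (?w * (2 ^ Suc j) ^ ?n))"
    unfolding bj using s by (intro summable_mult summable_geometric) (simp add: powr_less_one)
  define \<kappa> where "\<kappa> = (\<Sum>j. a j * (?w * (2 / 2 ^ j) ^ ?n)) + (\<Sum>j. b j * (?w * (2 ^ Suc j) ^ ?n))"
  have nonneg: "0 \<le> a j * (?w * (2 / 2 ^ j) ^ ?n)" "0 \<le> b j * (?w * (2 ^ Suc j) ^ ?n)" for j
    using ab w by (auto intro!: mult_nonneg_nonneg)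
  have \<kappa>: "0 \<le> \<kappa>" unfolding \<kappa>_def using nonneg by (intro add_nonneg_nonneg suminf_nonneg sa sb)
  have "(\<integral>\<^sup>+ y. ennreal (min 1 ((norm (x - y))\<^sup>2) / gagliardo_kernel s x y) \<partial>lborel) \<le> ennreal \<kappa>" for x :: "real ^ 'n"
  proof -
    have [measurable]: "ball x r \<in> sets borel" for r by simp
    have pt: "ennreal (min 1 ((norm (x - y))\<^sup>2) / gagliardo_kernel s x y) \<le>
        (\<Sum>j. ennreal (a j) * indicator (ball x (2 / 2 ^ j)) y) + (\<Sum>j. ennreal (b j) * indicator (ball x (2 ^ Suc j)) y)"
      (is "?l \<le> (\<Sum>j. ?a j) + (\<Sum>j. ?b j)") for y
    proof -
      let ?t = "norm (x - y)"
      have dist: "dist x y = ?t" by (simp add: dist_norm)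
      have le_suminf: "g j \<le> suminf g" for g :: "nat \<Rightarrow> ennreal" and j
        using sum_le_suminf[of g "{j}"] by auto
      have term_a: "?a j \<le> (\<Sum>j. ?a j)" and term_b: "?b j \<le> (\<Sum>j. ?b j)" for j
        by (rule le_suminf[of ?a], rule le_suminf[of ?b])
      consider "?t = 0" | "0 < ?t" "?t < 1" | "1 \<le> ?t" by (metis norm_ge_zero not_le order_le_less)
      then show ?thesis
      proof cases
        case 2
        then obtain j where j: "2 ^ j \<le> 1 / ?t" "1 / ?t < 2 ^ Suc j"
          using dyadic_bracket[of "1 / ?t"] by (metis less_imp_le le_divide_eq_1_pos)
        have t_le: "?t \<le> 1 / 2 ^ j" using j(1) 2 by (simp add: field_simps)
        have "1 / gagliardo_kernel s x y = (1 / ?t) powr ?\<beta>"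
          by (simp add: gagliardo_kernel_def powr_divide)
        also have "\<dots> \<le> (2 * 2 ^ j) powr ?\<beta>" using j s 2 by (intro powr_mono2) auto
        finally have "?t\<^sup>2 * (1 / gagliardo_kernel s x y) \<le> (1 / 2 ^ j)\<^sup>2 * (2 * 2 ^ j) powr ?\<beta>"
          using t_le by (intro mult_mono power_mono) auto
        moreover have "min 1 (?t\<^sup>2) / gagliardo_kernel s x y \<le> ?t\<^sup>2 * (1 / gagliardo_kernel s x y)"
          by (simp add: divide_right_mono)
        ultimately have "?l \<le> ennreal (a j)" by (intro ennreal_leI) (simp add: a_def mult.commute)
        moreover have "?t < 2 / 2 ^ j" using t_le by (rule le_less_trans) (simp add: field_simps)
        ultimately have "?l \<le> ?a j" by (simp add: dist)
        also have "\<dots> \<le> (\<Sum>j. ?a j) + (\<Sum>j. ?b j)" using term_a by (rule order_trans) simp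
        finally show ?thesis .
      next
        case 3
        then obtain j where j: "2 ^ j \<le> ?t" "?t < 2 ^ Suc j" by (rule dyadic_bracket)
        have "(2 ^ j) powr ?\<beta> \<le> gagliardo_kernel s x y"
          unfolding gagliardo_kernel_def using j s by (intro powr_mono2) auto
        then have "min 1 (?t\<^sup>2) / gagliardo_kernel s x y \<le> b j"
          unfolding b_def by (intro frac_le) auto
        then have "?l \<le> ennreal (b j)" by (rule ennreal_leI)
        also have "\<dots> = ?b j" using j by (simp add: dist)
        also have "\<dots> \<le> (\<Sum>j. ?a j) + (\<Sum>j. ?b j)" using term_b by (rule order_trans) simp
        finally show ?thesis .
      qed simp
    qed
    have "(\<integral>\<^sup>+ y. ennreal (min 1 ((norm (x - y))\<^sup>2) / gagliardo_kernel s x y) \<partial>lborel) \<le>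
        (\<integral>\<^sup>+ y. (\<Sum>j. ennreal (a j) * indicator (ball x (2 / 2 ^ j)) y) + (\<Sum>j. ennreal (b j) * indicator (ball x (2 ^ Suc j)) y) \<partial>lborel)"
      by (intro nn_integral_mono pt)
    also have "\<dots> = (\<integral>\<^sup>+ y. (\<Sum>j. ennreal (a j) * indicator (ball x (2 / 2 ^ j)) y) \<partial>lborel) +
        (\<integral>\<^sup>+ y. (\<Sum>j. ennreal (b j) * indicator (ball x (2 ^ Suc j)) y) \<partial>lborel)"
      by (rule nn_integral_add) measurable
    also have "(\<integral>\<^sup>+ y. (\<Sum>j. ennreal (a j) * indicator (ball x (2 / 2 ^ j)) y) \<partial>lborel) =
        (\<Sum>j. \<integral>\<^sup>+ y. ennreal (a j) * indicator (ball x (2 / 2 ^ j)) y \<partial>lborel)"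
      by (rule nn_integral_suminf) measurable
    also have "\<dots> = (\<Sum>j. ennreal (a j * (?w * (2 / 2 ^ j) ^ ?n)))"
    proof (rule arg_cong[where f = suminf], rule ext)
      fix j
      show "(\<integral>\<^sup>+ y. ennreal (a j) * indicator (ball x (2 / 2 ^ j)) y \<partial>lborel) = ennreal (a j * (?w * (2 / 2 ^ j) ^ ?n))"
        using ab w by (subst nn_integral_cmult_indicator) (auto simp: emeasure_ball ennreal_mult)
    qed
    also have "\<dots> = ennreal (\<Sum>j. a j * (?w * (2 / 2 ^ j) ^ ?n))"
      by (rule suminf_ennreal2[OF nonneg(1) sa])
    also have "(\<integral>\<^sup>+ y. (\<Sum>j. ennreal (b j) * indicator (ball x (2 ^ Suc j)) y) \<partial>lborel) =
        (\<Sum>j. \<integral>\<^sup>+ y. ennreal (b j) * indicator (ball x (2 ^ Suc j)) y \<partial>lborel)"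
      by (rule nn_integral_suminf) measurable
    also have "\<dots> = (\<Sum>j. ennreal (b j * (?w * (2 ^ Suc j) ^ ?n)))"
    proof (rule arg_cong[where f = suminf], rule ext)
      fix j
      show "(\<integral>\<^sup>+ y. ennreal (b j) * indicator (ball x (2 ^ Suc j)) y \<partial>lborel) = ennreal (b j * (?w * (2 ^ Suc j) ^ ?n))"
        using ab w by (subst nn_integral_cmult_indicator) (auto simp: emeasure_ball ennreal_mult)
    qed
    also have "\<dots> = ennreal (\<Sum>j. b j * (?w * (2 ^ Suc j) ^ ?n))"
      by (rule suminf_ennreal2[OF nonneg(2) sb])
    also have "ennreal (\<Sum>j. a j * (?w * (2 / 2 ^ j) ^ ?n)) + ennreal (\<Sum>j. b j * (?w * (2 ^ Suc j) ^ ?n)) = ennreal \<kappa>"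
      unfolding \<kappa>_def by (intro ennreal_plus[symmetric] suminf_nonneg sa sb nonneg)
    finally show ?thesis .
  qed
  with \<kappa> show ?thesis by (rule that)
qed

text \<open>The integrand vanishes unless \<open>x\<close> or \<open>y\<close> lies in \<Omega>. By
  symmetry it is enough to integrate the truncated kernel in \<open>y\<close> for \<open>x\<close>
  in \<Omega>, and \<Omega> has finite measure.\<close>

lemma lipschitz_in_frac_sobolev0:
  fixes \<Omega> :: "(real ^ 'n) set"
  assumes s: "0 < s" "s < 1" and \<Omega>: "open \<Omega>" "bounded \<Omega>"
    and lip: "\<And>x y. \<bar>u x - u y\<bar> \<le> L * norm (x - y)" and bdd: "\<And>x. \<bar>u x\<bar> \<le> K"
    and zero: "\<And>x. x \<notin> \<Omega> \<Longrightarrow> u x = 0"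
  shows "u \<in> frac_sobolev0 s \<Omega>"
proof -
  have "\<bar>L\<bar>-lipschitz_on UNIV u"
  proof (rule lipschitz_onI)
    fix x y :: "real ^ 'n"
    have "L * norm (x - y) \<le> \<bar>L\<bar> * norm (x - y)" by (intro mult_right_mono) auto
    then show "dist (u x) (u y) \<le> \<bar>L\<bar> * dist x y"
      using lip[of x y] by (simp add: dist_real_def dist_norm)
  qed simp
  then have "continuous_on UNIV u" by (rule lipschitz_on_continuous_on)
  then have um [measurable]: "u \<in> borel_measurable borel" by (rule borel_measurable_continuous_onI)
  have [measurable]: "\<Omega> \<in> sets borel" using \<Omega> by simp
  obtain \<kappa> where \<kappa>: "0 \<le> \<kappa>" "\<And>x :: real ^ 'n. (\<integral>\<^sup>+ y. ennreal (min 1 ((norm (x - y))\<^sup>2) / gagliardo_kernel s x y) \<partial>lborel) \<le> ennreal \<kappa>"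
    using truncated_kernel_integral_bounded[OF s] by blast
  \<comment> \<open>The Lipschitz constant governs distances below 1, the bound \<open>2 * K\<close>
    for differences of values all others.\<close>
  define D where "D = max (L\<^sup>2) (4 * K\<^sup>2)"
  have D0: "0 \<le> D" by (simp add: D_def le_max_iff_disj)
  define k where "k x y = ennreal (D * (min 1 ((norm (x - y))\<^sup>2) / gagliardo_kernel s x y))" for x y :: "real ^ 'n"
  have km [measurable]: "(\<lambda>(x, y). k x y) \<in> borel_measurable (lborel \<Otimes>\<^sub>M lborel)"
    unfolding k_def by measurable
  have k_int: "(\<integral>\<^sup>+ y. k x y \<partial>lborel) \<le> ennreal (D * \<kappa>)" for x
  proof -
    have "(\<integral>\<^sup>+ y. k x y \<partial>lborel) = (\<integral>\<^sup>+ y. ennreal D * ennreal (min 1 ((norm (x - y))\<^sup>2) / gagliardo_kernel s x y) \<partial>lborel)"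
      unfolding k_def using D0 by (intro nn_integral_cong ennreal_mult) auto
    also have "\<dots> = ennreal D * (\<integral>\<^sup>+ y. ennreal (min 1 ((norm (x - y))\<^sup>2) / gagliardo_kernel s x y) \<partial>lborel)"
      by (rule nn_integral_cmult) measurable
    also have "\<dots> \<le> ennreal D * ennreal \<kappa>" by (intro mult_left_mono \<kappa>) auto
    also have "\<dots> = ennreal (D * \<kappa>)" using D0 \<kappa>(1) by (simp add: ennreal_mult)
    finally show ?thesis .
  qed
  have k_sym: "k x y = k y x" for x y
    by (simp add: k_def gagliardo_kernel_def norm_minus_commute)
  have pt: "ennreal (\<bar>u x - u y\<bar>\<^sup>2 / gagliardo_kernel s x y) \<le> indicator \<Omega> x * k x y + indicator \<Omega> y * k x y" for x y
  proof (cases "x \<in> \<Omega> \<or> y \<in> \<Omega>")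
    case True
    have "\<bar>u x - u y\<bar>\<^sup>2 \<le> D * min 1 ((norm (x - y))\<^sup>2)"
    proof (cases "1 \<le> (norm (x - y))\<^sup>2")
      case True
      have "\<bar>u x - u y\<bar> \<le> 2 * K" using bdd[of x] bdd[of y] by linarith
      then have "\<bar>u x - u y\<bar>\<^sup>2 \<le> (2 * K)\<^sup>2" by (intro power_mono) auto
      then show ?thesis using True by (simp add: D_def power_mult_distrib le_max_iff_disj)
    next
      case False
      have "\<bar>u x - u y\<bar>\<^sup>2 \<le> (L * norm (x - y))\<^sup>2" using lip[of x y] by (intro power_mono) auto
      also have "\<dots> \<le> D * (norm (x - y))\<^sup>2"
        unfolding power_mult_distrib by (intro mult_right_mono) (auto simp: D_def)
      finally show ?thesis using False by simp
    qed
    from divide_right_mono[OF this gagliardo_kernel_nonneg[of s x y]]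
    have "ennreal (\<bar>u x - u y\<bar>\<^sup>2 / gagliardo_kernel s x y) \<le> k x y"
      unfolding k_def by (intro ennreal_leI) simp
    also have "\<dots> \<le> indicator \<Omega> x * k x y + indicator \<Omega> y * k x y"
      using True by (auto simp: indicator_def)
    finally show ?thesis .
  qed (simp add: zero)
  have "gagliardo_nn s u \<le> (\<integral>\<^sup>+ x. \<integral>\<^sup>+ y. indicator \<Omega> x * k x y + indicator \<Omega> y * k x y \<partial>lborel \<partial>lborel)"
    unfolding gagliardo_nn_borel[OF um] gagliardo_density_def by (intro nn_integral_mono pt)
  also have "\<dots> = (\<integral>\<^sup>+ x. (\<integral>\<^sup>+ y. indicator \<Omega> x * k x y \<partial>lborel) + (\<integral>\<^sup>+ y. indicator \<Omega> y * k x y \<partial>lborel) \<partial>lborel)"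
    by (intro nn_integral_cong nn_integral_add) measurable
  also have "\<dots> = (\<integral>\<^sup>+ x. \<integral>\<^sup>+ y. indicator \<Omega> x * k x y \<partial>lborel \<partial>lborel) + (\<integral>\<^sup>+ x. \<integral>\<^sup>+ y. indicator \<Omega> y * k x y \<partial>lborel \<partial>lborel)"
    by (rule nn_integral_add) measurable
  also have "(\<integral>\<^sup>+ x. \<integral>\<^sup>+ y. indicator \<Omega> y * k x y \<partial>lborel \<partial>lborel) = (\<integral>\<^sup>+ y. \<integral>\<^sup>+ x. indicator \<Omega> y * k x y \<partial>lborel \<partial>lborel)"
    by (rule lborel_pair.Fubini'[symmetric]) measurable
  also have "\<dots> = (\<integral>\<^sup>+ x. \<integral>\<^sup>+ y. indicator \<Omega> x * k x y \<partial>lborel \<partial>lborel)"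
    by (subst k_sym) (rule refl)
  also have "(\<integral>\<^sup>+ x. \<integral>\<^sup>+ y. indicator \<Omega> x * k x y \<partial>lborel \<partial>lborel) \<le> (\<integral>\<^sup>+ x. ennreal (D * \<kappa>) * indicator \<Omega> x \<partial>lborel)"
  proof (intro nn_integral_mono)
    fix x
    have "(\<integral>\<^sup>+ y. indicator \<Omega> x * k x y \<partial>lborel) = indicator \<Omega> x * (\<integral>\<^sup>+ y. k x y \<partial>lborel)"
      by (rule nn_integral_cmult) measurable
    also have "\<dots> \<le> indicator \<Omega> x * ennreal (D * \<kappa>)" by (intro mult_left_mono k_int) auto
    finally show "(\<integral>\<^sup>+ y. indicator \<Omega> x * k x y \<partial>lborel) \<le> ennreal (D * \<kappa>) * indicator \<Omega> x" by (simp add: mult.commute)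
  qed
  also have "\<dots> = ennreal (D * \<kappa>) * emeasure lborel \<Omega>"
    by (rule nn_integral_cmult_indicator) simp
  finally have "gagliardo_nn s u \<le> ennreal (D * \<kappa>) * emeasure lborel \<Omega> + ennreal (D * \<kappa>) * emeasure lborel \<Omega>"
    by (simp add: add_mono)
  also have "\<dots> < \<infinity>"
    using emeasure_bounded_finite[OF \<Omega>(2)] by (simp add: ennreal_mult_less_top)
  finally have fin: "gagliardo_nn s u < \<infinity>" .
  have "u \<in> borel_measurable lebesgue" by (rule measurable_completion) simp
  then show ?thesis
    using frac_sobolev0_poincare[OF s(1) \<Omega>] fin zero by auto
qed

section \<open>Primitives of sign-changing functions and test functions with nonzero \<Psi>\<close>

lemma primitive_zero [simp]: "primitive f 0 = 0"
  by (simp add: primitive_def)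

text \<open>By the mean value theorem the primitive strictly decreases up to 0 and strictly
  increases afterwards. The comparisons with \<open>d\<close> and \<open>- d\<close> later bound the
  energies from above uniformly in the level.\<close>

lemma primitive_of_sign_function:
  fixes k :: "real \<Rightarrow> real"
  assumes cont: "continuous_on UNIV k" and pos: "\<forall>t>0. 0 < k t" and neg: "\<forall>t<0. k t < 0"
  shows "0 \<le> primitive k t"
    and "0 < d \<Longrightarrow> 0 < primitive k d" "0 < d \<Longrightarrow> d \<le> t \<Longrightarrow> primitive k d \<le> primitive k t"
    and "0 < d \<Longrightarrow> 0 < primitive k (- d)" "0 < d \<Longrightarrow> t \<le> - d \<Longrightarrow> primitive k (- d) \<le> primitive k t"
proof -
  note D = primitive_has_derivative[OF cont]
  have up: "\<exists>z. a < z \<and> z < b \<and> primitive k b - primitive k a = (b - a) * k z" if "a < b" for a b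
    using MVT2[OF that, of "primitive k" k] D by blast
  have mono_pos: "primitive k a < primitive k b" if ab: "0 \<le> a" "a < b" for a b
  proof -
    obtain z where "a < z" "primitive k b - primitive k a = (b - a) * k z" using up[OF ab(2)] by blast
    moreover from this have "0 < (b - a) * k z" using pos ab by (intro mult_pos_pos) auto
    ultimately show ?thesis by simp
  qed
  have mono_neg: "primitive k b < primitive k a" if ab: "b \<le> 0" "a < b" for a b
  proof -
    obtain z where "z < b" "primitive k b - primitive k a = (b - a) * k z" using up[OF ab(2)] by blast
    moreover from this have "(b - a) * k z < 0" using neg ab by (intro mult_pos_neg) auto
    ultimately show ?thesis by simp
  qed
  show "0 \<le> primitive k t"
    using mono_pos[of 0 t] mono_neg[of 0 t] by (cases t "0::real" rule: linorder_cases) auto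
  show "0 < d \<Longrightarrow> 0 < primitive k d" using mono_pos[of 0 d] by simp
  show "0 < d \<Longrightarrow> 0 < primitive k (- d)" using mono_neg[of 0 "- d"] by simp
  show "0 < d \<Longrightarrow> d \<le> t \<Longrightarrow> primitive k d \<le> primitive k t"
    using mono_pos[of d t] by (cases "d = t") auto
  show "0 < d \<Longrightarrow> t \<le> - d \<Longrightarrow> primitive k (- d) \<le> primitive k t"
    using mono_neg[of "- d" t] by (cases "- d = t") auto
qed

context subcritical_problem
begin

lemma Psi_zero [simp]: "Psi 0 = 0"
  by (simp add: set_lebesgue_integral_def zero_fun_def)

lemma Psi_cong_AE:
  assumes "u \<in> V" "v \<in> V" "AE x in lebesgue. u x = v x"
  shows "Psi u = Psi v"
  unfolding set_lebesgue_integral_def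
  by (rule integral_cong_AE)
    (use assms Psi_integrable[of u] Psi_integrable[of v] in \<open>auto intro: borel_measurable_integrable elim: eventually_mono\<close>)

lemma gagliardo_sq_cong_AE:
  assumes "u \<in> V" "v \<in> V" "AE x in lebesgue. u x = v x"
  shows "gagliardo_sq s u = gagliardo_sq s v"
proof -
  have "u \<in> frac_sobolev s" "v \<in> frac_sobolev s" using assms by (auto simp: frac_sobolev0_def)
  then show ?thesis
    using gagliardo_nn_cong_AE[OF assms(3), of s] gagliardo_sq_nonneg[of s u] gagliardo_sq_nonneg[of s v]
    by (simp add: gagliardo_nn_eq)
qed

lemma Psi_bounds:
  assumes "u \<in> V"
  shows "measure lebesgue \<Omega> * (INF \<xi>. primitive f \<xi>) \<le> Psi u" "Psi u \<le> measure lebesgue \<Omega> * (SUP \<xi>. primitive f \<xi>)"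
proof -
  have P': "primitive f \<xi> \<le> P" "- P \<le> primitive f \<xi>" for \<xi> using P[of \<xi>] by auto
  then have bdd: "bdd_above (range (primitive f))" "bdd_below (range (primitive f))"
    by (auto simp: bdd_above_def bdd_below_def)
  have const: "(LINT x|lebesgue. indicator \<Omega> x *\<^sub>R c) = measure lebesgue \<Omega> * c" for c :: real by simp
  have int: "integrable lebesgue (\<lambda>x. indicator \<Omega> x *\<^sub>R c)" for c :: real
    using \<Omega>_integrable by simp
  show "measure lebesgue \<Omega> * (INF \<xi>. primitive f \<xi>) \<le> Psi u"
    unfolding const[symmetric] set_lebesgue_integral_def
    using bdd by (intro Bochner_Integration.integral_mono int Psi_integrable assms) (auto simp: indicator_def intro: cINF_lower)
  show "Psi u \<le> measure lebesgue \<Omega> * (SUP \<xi>. primitive f \<xi>)"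
    unfolding const[symmetric] set_lebesgue_integral_def
    using bdd by (intro Bochner_Integration.integral_mono int Psi_integrable assms) (auto simp: indicator_def intro: cSUP_upper)
qed

text \<open>A constant \<open>c\<close> with \<open>primitive f c \<noteq> 0\<close> is not
  admissible, as it does not vanish outside \<Omega>. It is cut off by Lipschitz functions that
  increase to 1 on \<Omega>, and \<open>Psi\<close> then tends to the measure of \<Omega> times
  \<open>primitive f c\<close>.\<close>

lemma exists_Psi_nonzero:
  assumes s1: "s < 1" and f: "f t0 \<noteq> 0" and meas: "measure lebesgue \<Omega> \<noteq> 0"
  obtains u where "u \<in> V" "Psi u \<noteq> 0"
proof -
  have "\<exists>c. primitive f c \<noteq> 0"
  proof (rule ccontr)
    assume "\<not> (\<exists>c. primitive f c \<noteq> 0)"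
    then have "primitive f = (\<lambda>_. 0)" by auto
    then have "((\<lambda>_. 0) has_real_derivative f t0) (at t0)" using primitive_deriv[of t0] by simp
    then show False using f DERIV_unique[OF _ DERIV_const[of 0]] by blast
  qed
  then obtain c where c: "primitive f c \<noteq> 0" by blast
  define \<eta> where "\<eta> k x = min 1 (real k * infdist x (- \<Omega>))" for k :: nat and x
  \<comment> \<open>The complement must be nonempty, because \<open>infdist\<close> to the empty set
    is 0 by convention.\<close>
  have "\<Omega> \<noteq> UNIV" using \<Omega>(2) not_bounded_UNIV by blast
  then have ne: "- \<Omega> \<noteq> {}" by auto
  have \<eta>01: "0 \<le> \<eta> k x" "\<eta> k x \<le> 1" for k x by (auto simp: \<eta>_def infdist_nonneg)
  have in_V: "(\<lambda>x. c * \<eta> k x) \<in> V" for k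
  proof (rule lipschitz_in_frac_sobolev0[OF s(1) s1 \<Omega>, where L = "\<bar>c\<bar> * real k" and K = "\<bar>c\<bar>"])
    fix x y
    have "\<bar>\<eta> k x - \<eta> k y\<bar> \<le> \<bar>real k * infdist x (- \<Omega>) - real k * infdist y (- \<Omega>)\<bar>"
      by (auto simp: \<eta>_def)
    also have "\<dots> = real k * \<bar>infdist x (- \<Omega>) - infdist y (- \<Omega>)\<bar>" by (simp add: abs_mult flip: right_diff_distrib)
    also have "\<dots> \<le> real k * norm (x - y)"
      using infdist_triangle_abs[of x "- \<Omega>" y] by (intro mult_left_mono) (auto simp: dist_norm)
    finally have "\<bar>c\<bar> * \<bar>\<eta> k x - \<eta> k y\<bar> \<le> \<bar>c\<bar> * (real k * norm (x - y))" by (rule mult_left_mono) simp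
    then show "\<bar>c * \<eta> k x - c * \<eta> k y\<bar> \<le> \<bar>c\<bar> * real k * norm (x - y)"
      by (simp add: abs_mult flip: right_diff_distrib)
  next
    fix x show "\<bar>c * \<eta> k x\<bar> \<le> \<bar>c\<bar>" using \<eta>01[of k x] by (simp add: abs_mult mult_left_le)
  next
    fix x assume "x \<notin> \<Omega>"
    then show "c * \<eta> k x = 0" by (simp add: \<eta>_def)
  qed
  have "(\<lambda>k. Psi (\<lambda>x. c * \<eta> k x)) \<longlonglongrightarrow> (LINT x|lebesgue. indicator \<Omega> x *\<^sub>R primitive f c)"
    unfolding set_lebesgue_integral_def
  proof (rule integral_dominated_convergence[where w = "\<lambda>x. P * indicator \<Omega> x"])
    show "integrable lebesgue (\<lambda>x. P * indicator \<Omega> x)" using \<Omega>_integrable by simp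
    show "AE x in lebesgue. (\<lambda>k. indicator \<Omega> x *\<^sub>R primitive f (c * \<eta> k x)) \<longlonglongrightarrow> indicator \<Omega> x *\<^sub>R primitive f c"
    proof (intro always_eventually allI)
      fix x
      show "(\<lambda>k. indicator \<Omega> x *\<^sub>R primitive f (c * \<eta> k x)) \<longlonglongrightarrow> indicator \<Omega> x *\<^sub>R primitive f c"
      proof (cases "x \<in> \<Omega>")
        case True
        have "infdist x (- \<Omega>) \<noteq> 0"
          using in_closed_iff_infdist_zero[of "- \<Omega>" x] \<Omega>(1) ne True by auto
        then have pos: "infdist x (- \<Omega>) > 0" using infdist_nonneg[of x "- \<Omega>"] by linarith
        obtain k0 where k0: "1 / infdist x (- \<Omega>) \<le> real k0" using real_arch_simple by blast
        have "\<forall>\<^sub>F k in sequentially. indicator \<Omega> x *\<^sub>R primitive f (c * \<eta> k x) = indicator \<Omega> x *\<^sub>R primitive f c"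
          using eventually_ge_at_top[of k0]
        proof eventually_elim
          case (elim k)
          then have "1 / infdist x (- \<Omega>) \<le> real k" using k0 by linarith
          then have "\<eta> k x = 1" using pos by (simp add: \<eta>_def field_simps)
          then show ?case by simp
        qed
        then show ?thesis by (rule tendsto_eventually)
      qed simp
    qed
    show "(\<lambda>x. indicator \<Omega> x *\<^sub>R primitive f (c * \<eta> k x)) \<in> borel_measurable lebesgue" for k
      by (rule borel_measurable_integrable[OF Psi_integrable[OF in_V]])
  qed (use P P_nonneg in \<open>auto simp: indicator_def\<close>)
  moreover have "(LINT x|lebesgue. indicator \<Omega> x *\<^sub>R primitive f c) \<noteq> 0" using c meas by simp
  ultimately have "\<forall>\<^sub>F k in sequentially. Psi (\<lambda>x. c * \<eta> k x) \<noteq> 0" by (rule tendsto_imp_eventually_ne)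
  then obtain k where "Psi (\<lambda>x. c * \<eta> k x) \<noteq> 0" by (meson eventually_happens trivial_limit_sequentially)
  with in_V[of k] show ?thesis by (rule that)
qed

end

section \<open>The theorem\<close>

theorem theorem1p1:
  fixes s a b :: real and \<Omega> :: "(real ^ 'n) set" and f h F :: "real \<Rightarrow> real"
  assumes "0 < s" "s < 1" "2 * s < real CARD('n)"
    and "open \<Omega>" "bounded \<Omega>" "lipschitz_boundary \<Omega>"
    and "continuous_on UNIV f" "\<exists>t. f t \<noteq> 0"
    and "\<exists>q. 1 \<le> q \<and> q < 2 * real CARD('n) / (real CARD('n) - 2 * s) \<and>
           bdd_above (range (\<lambda>t. \<bar>f t\<bar> / (1 + \<bar>t\<bar> powr (q - 1))))"
    and F_def: "F = primitive f"
    and "bdd_above (range (\<lambda>\<xi>. \<bar>F \<xi>\<bar>))"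
    and I_def: "I = {- (measure lebesgue \<Omega> * osc F) <..< measure lebesgue \<Omega> * osc F}"
    and "continuous_on I h" "mono_on I h" "{t \<in> I. h t = 0} = {0}"
    and "0 < a" "0 < b"
  shows "\<exists>\<mu>0. \<forall>\<mu>>\<mu>0. \<exists>\<Lambda> \<rho>.
           \<Lambda> \<noteq> {} \<and> open \<Lambda> \<and> is_interval \<Lambda> \<and>
           \<Lambda> \<subseteq> {measure lebesgue \<Omega> * (INF \<xi>. F \<xi>) <..< measure lebesgue \<Omega> * (SUP \<xi>. F \<xi>)} \<and>
           0 < \<rho> \<and>
           (\<forall>lam \<in> \<Lambda>. \<exists>u1 u2 u3.
              \<not> (AE x in lebesgue. u1 x = u2 x) \<and>
              \<not> (AE x in lebesgue. u1 x = u3 x) \<and>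
              \<not> (AE x in lebesgue. u2 x = u3 x) \<and>
              (\<forall>u \<in> {u1, u2, u3}.
                 u \<in> frac_sobolev0 s \<Omega> \<and>
                 gagliardo_sq s u < \<rho>\<^sup>2 \<and>
                 kirchhoff_weak_solution s \<Omega> f h a b \<mu> lam u))"
proof -
  obtain q where q: "1 \<le> q" "q < 2 * real CARD('n) / (real CARD('n) - 2 * s)"
    "bdd_above (range (\<lambda>t. \<bar>f t\<bar> / (1 + \<bar>t\<bar> powr (q - 1))))" using assms(9) by blast
  obtain M0 where M0: "\<And>t. \<bar>f t\<bar> / (1 + \<bar>t\<bar> powr (q - 1)) \<le> M0"
    using q(3) by (auto simp: bdd_above_def)
  define M where "M = max 1 M0"
  have growth: "\<bar>f t\<bar> \<le> M * (1 + \<bar>t\<bar> powr (q - 1))" for t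
  proof -
    have "0 < 1 + \<bar>t\<bar> powr (q - 1)" by (simp add: add_pos_nonneg)
    moreover have "\<bar>f t\<bar> / (1 + \<bar>t\<bar> powr (q - 1)) \<le> M" using M0[of t] by (simp add: M_def)
    ultimately show ?thesis by (simp add: pos_divide_le_eq)
  qed
  obtain P where P: "\<And>\<xi>. \<bar>primitive f \<xi>\<bar> \<le> P"
    using assms(11) unfolding F_def by (auto simp: bdd_above_def)
  interpret subcritical_problem s "2 * real CARD('n) / (real CARD('n) - 2 * s)" q M P \<Omega> f
    by standard (use assms(1-7) q growth P in \<open>auto simp: M_def\<close>)
  define L where "L = measure lebesgue \<Omega> * osc F"
  have I: "I = {- L <..< L}" by (simp add: I_def L_def)
  have h0: "0 \<in> I" "h 0 = 0" and h_ne: "\<And>t. t \<in> I \<Longrightarrow> h t = 0 \<Longrightarrow> t = 0" using assms(15) by auto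
  \<comment> \<open>That \<open>I\<close> contains 0 is part of the assumption on the zeros of
    \<open>h\<close>; it forces \<open>I\<close> to be nonempty, hence both the measure of \<Omega>
    and the oscillation to be nonzero.\<close>
  then have L0: "0 < L" by (simp add: I)
  then have meas: "measure lebesgue \<Omega> \<noteq> 0" by (auto simp: L_def)
  obtain t0 where "f t0 \<noteq> 0" using assms(8) by blast
  then obtain u0 where u0: "u0 \<in> V" "Psi u0 \<noteq> 0" using exists_Psi_nonzero[OF assms(2) _ meas] by blast
  \<comment> \<open>These are 0 and \<open>u0\<close>, ordered by the value of
    \<open>Psi\<close>.\<close>
  obtain v1 v2 where v: "v1 \<in> V" "v2 \<in> V" "Psi v1 < Psi v2"
  proof (cases "0 < Psi u0")
    case True
    show ?thesis by (rule that[of 0 u0]) (use True u0 in simp_all)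
  next
    case False
    show ?thesis by (rule that[of u0 0]) (use False u0 in simp_all)
  qed
  define d where "d = (Psi v2 - Psi v1) / 3"
  have d: "0 < d" "Psi v2 = Psi v1 + 3 * d" using v(3) by (simp_all add: d_def field_simps)
  define lo where "lo = measure lebesgue \<Omega> * (INF \<xi>. F \<xi>)"
  define hi where "hi = measure lebesgue \<Omega> * (SUP \<xi>. F \<xi>)"
  have L: "L = hi - lo" by (simp add: L_def lo_def hi_def osc_def right_diff_distrib)
  have lo: "lo \<le> Psi u" and hi: "Psi u \<le> hi" if "u \<in> V" for u
    using Psi_bounds[OF that] by (auto simp: lo_def hi_def F_def)
  have dL: "d < L" "3 * d \<le> L" using lo[OF v(1)] hi[OF v(2)] d by (auto simp: L)
  \<comment> \<open>All values of \<open>Psi u - lam\<close> lie in \<open>{- (L - d)..L - d}\<close>; freezing \<open>h\<close> outside this interval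
    makes it uniformly continuous on the whole line.\<close>
  define k where "k t = h (max (- (L - d)) (min (L - d) t))" for t
  have clamp: "max (- (L - d)) (min (L - d) t) \<in> {- (L - d)..L - d}" for t using dL by auto
  have sub: "{- (L - d)..L - d} \<subseteq> I" using d by (auto simp: I)
  have k_eq: "k t = h t" if "\<bar>t\<bar> \<le> L - d" for t
  proof -
    have "max (- (L - d)) (min (L - d) t) = t" using that by auto
    then show ?thesis by (simp add: k_def)
  qed
  have "uniformly_continuous_on {- (L - d)..L - d} h"
    using assms(13) sub by (intro compact_uniformly_continuous) (auto intro: continuous_on_subset)
  then have k_uc: "uniformly_continuous_on UNIV k"
    unfolding uniformly_continuous_on_def
  proof (intro allI impI)
    fix e :: real
    assume h: "\<forall>e>0. \<exists>\<delta>>0. \<forall>x\<in>{- (L - d)..L - d}. \<forall>x'\<in>{- (L - d)..L - d}. dist x' x < \<delta> \<longrightarrow> dist (h x') (h x) < e"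
      and "0 < e"
    then obtain \<delta> where \<delta>: "\<delta> > 0" "\<And>x x'. x \<in> {- (L - d)..L - d} \<Longrightarrow> x' \<in> {- (L - d)..L - d} \<Longrightarrow> dist x' x < \<delta> \<Longrightarrow> dist (h x') (h x) < e"
      by blast
    have "dist (k x') (k x) < e" if "dist x' x < \<delta>" for x x'
      unfolding k_def
    proof (rule \<delta>(2)[OF clamp clamp])
      have "\<bar>max (- (L - d)) (min (L - d) x') - max (- (L - d)) (min (L - d) x)\<bar> \<le> \<bar>x' - x\<bar>" by linarith
      then show "dist (max (- (L - d)) (min (L - d) x')) (max (- (L - d)) (min (L - d) x)) < \<delta>"
        using that by (simp add: dist_real_def)
    qed
    then show "\<exists>\<delta>>0. \<forall>x\<in>UNIV. \<forall>x'\<in>UNIV. dist x' x < \<delta> \<longrightarrow> dist (k x') (k x) < e" using \<delta>(1) by blast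
  qed
  then have k_cont: "continuous_on UNIV k" by (rule uniformly_continuous_imp_continuous)
  have "compact (h ` {- (L - d)..L - d})"
    using assms(13) sub by (intro compact_continuous_image) (auto intro: continuous_on_subset)
  then have "bounded (h ` {- (L - d)..L - d})" by (rule compact_imp_bounded)
  then obtain K where "\<forall>y\<in>h ` {- (L - d)..L - d}. norm y \<le> K" unfolding bounded_iff by blast
  then have k_bdd: "\<exists>C. \<forall>t. \<bar>k t\<bar> \<le> C"
    unfolding k_def using clamp by (intro exI[of _ K] allI) (metis imageI real_norm_def)
  have k_pos: "\<forall>t>0. 0 < k t"
  proof (intro allI impI)
    fix t :: real assume that: "0 < t"
    let ?c = "max (- (L - d)) (min (L - d) t)"
    have c: "?c \<in> I" "0 < ?c" using clamp[of t] sub that dL by auto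
    then have "h 0 \<le> h ?c" using h0(1) by (intro mono_onD[OF assms(14)]) auto
    moreover have "h ?c \<noteq> 0" using h_ne[OF c(1)] c(2) by auto
    ultimately show "0 < k t" using h0(2) by (simp add: k_def)
  qed
  have k_neg: "\<forall>t<0. k t < 0"
  proof (intro allI impI)
    fix t :: real assume that: "t < 0"
    let ?c = "max (- (L - d)) (min (L - d) t)"
    have c: "?c \<in> I" "?c < 0" using clamp[of t] sub that dL by auto
    then have "h ?c \<le> h 0" using h0(1) by (intro mono_onD[OF assms(14)]) auto
    moreover have "h ?c \<noteq> 0" using h_ne[OF c(1)] c(2) by auto
    ultimately show "k t < 0" using h0(2) by (simp add: k_def)
  qed
  define H where "H = primitive k"
  note H_props = primitive_of_sign_function[OF k_cont k_pos k_neg, folded H_def]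
  have H_deriv: "(H has_real_derivative k t) (at t)" for t
    unfolding H_def by (rule primitive_has_derivative[OF k_cont])
  have "continuous_on {- L..L} H"
    using H_deriv by (auto intro!: continuous_at_imp_continuous_on DERIV_isCont)
  then have "bounded (H ` {- L..L})"
    by (intro compact_imp_bounded compact_continuous_image) auto
  \<comment> \<open>The interval contains \<open>Psi u - lam\<close> for all \<open>u\<close> in the
    space and all \<open>lam\<close> in \<open>\<Lambda>\<close>, so \<open>c\<^sub>H\<close> does
    not depend on \<open>lam\<close>.\<close>
  then obtain c\<^sub>H where c\<^sub>H: "\<forall>y\<in>H ` {- L..L}. norm y \<le> c\<^sub>H" unfolding bounded_iff by blast
  have cH0: "0 \<le> c\<^sub>H"
  proof -
    have "norm (H 0) \<le> c\<^sub>H" using c\<^sub>H L0 by auto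
    then show ?thesis using norm_ge_zero order_trans by blast
  qed
  define \<Lambda> where "\<Lambda> = {Psi v1 + d <..< Psi v2 - d}"
  define A where "A u = a / 2 * gagliardo_form s u u + b / 4 * (gagliardo_form s u u)\<^sup>2" for u :: "real ^ 'n \<Rightarrow> real"
  \<comment> \<open>For \<open>lam\<close> in \<open>\<Lambda>\<close> both \<open>Psi v1\<close>
    and \<open>Psi v2\<close> are more than \<open>d\<close> away from \<open>lam\<close>, so
    \<open>H\<close> there is at least \<open>H (- d)\<close> or \<open>H d\<close>. Comparing these
    with the remaining part \<open>A\<close> of the energy makes both energies negative, uniformly
    in \<open>lam\<close>.\<close>
  define \<mu>0 where "\<mu>0 = max 0 (max (A v1 / H (- d)) (A v2 / H d))"
  show ?thesis
  proof (intro exI[of _ \<mu>0] allI impI)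
    fix \<mu> assume \<mu>: "\<mu>0 < \<mu>"
    then have mu: "0 < \<mu>" "A v1 < \<mu> * H (- d)" "A v2 < \<mu> * H d"
      using H_props(2,4)[OF d(1)] by (auto simp: \<mu>0_def pos_divide_less_eq)
    define R where "R = nm v1 + nm (v2 - v1)"
    \<comment> \<open>The a priori bound of \<open>three_critical_points\<close> solved for the
      squared seminorm; the added 1 makes the inequality strict.\<close>
    define \<rho>2 where "\<rho>2 = 2 / a * (a / 2 * R\<^sup>2 + b / 4 * R^4 + \<mu> * c\<^sub>H) + 1"
    have \<rho>2: "0 < \<rho>2" using assms(16,17) mu(1) cH0
      unfolding \<rho>2_def by (intro add_nonneg_pos mult_nonneg_nonneg add_nonneg_nonneg) auto
    have lam_props: "lam - Psi v1 > d" "Psi v2 - lam > d" if "lam \<in> \<Lambda>" for lam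
      using that by (auto simp: \<Lambda>_def)
    have range: "\<bar>Psi u - lam\<bar> \<le> L - d" if "u \<in> V" "lam \<in> \<Lambda>" for u lam
      using lo[OF that(1)] hi[OF that(1)] lo[OF v(1)] hi[OF v(2)] lam_props[OF that(2)] by (auto simp: L abs_le_iff)
    have "\<exists>u1 u2 u3.
              \<not> (AE x in lebesgue. u1 x = u2 x) \<and>
              \<not> (AE x in lebesgue. u1 x = u3 x) \<and>
              \<not> (AE x in lebesgue. u2 x = u3 x) \<and>
              (\<forall>u \<in> {u1, u2, u3}.
                 u \<in> frac_sobolev0 s \<Omega> \<and>
                 gagliardo_sq s u < (sqrt \<rho>2)\<^sup>2 \<and>
                 kirchhoff_weak_solution s \<Omega> f h a b \<mu> lam u)" if lam: "lam \<in> \<Lambda>" for lam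
    proof -
      interpret K: kirchhoff_energy V "gagliardo_form s" Q Psi dPsi k H a b \<mu> lam c\<^sub>H
      proof
        show "H (Psi u - lam) \<le> c\<^sub>H" if u: "u \<in> V" for u
        proof -
          have "Psi u - lam \<in> {- L..L}" using range[OF u lam] d(1) by auto
          then have "norm (H (Psi u - lam)) \<le> c\<^sub>H" using c\<^sub>H by blast
          then show ?thesis by simp
        qed
        show "H 0 = 0" by (simp add: H_def)
      qed (use k_uc k_bdd H_deriv H_props(1) assms(16,17) mu(1) in auto)
      have E1: "K.E v1 < 0"
      proof -
        have "Psi v1 - lam \<le> - d" using lam_props[OF lam] by linarith
        then have "\<mu> * H (- d) \<le> \<mu> * H (Psi v1 - lam)"
          using mu(1) H_props(5)[OF d(1)] by (intro mult_left_mono) auto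
        then show ?thesis using mu(2) by (simp add: K.E_def A_def)
      qed
      have E2: "K.E v2 < 0"
      proof -
        have "d \<le> Psi v2 - lam" using lam_props[OF lam] by linarith
        then have "\<mu> * H d \<le> \<mu> * H (Psi v2 - lam)"
          using mu(1) H_props(3)[OF d(1)] by (intro mult_left_mono) auto
        then show ?thesis using mu(3) by (simp add: K.E_def A_def)
      qed
      have order: "Psi v1 < lam" "lam < Psi v2" using lam_props[OF lam] d(1) by auto
      obtain u1 u2 u3 where
        crit: "\<And>u \<phi>. u \<in> {u1, u2, u3} \<Longrightarrow> \<phi> \<in> V \<Longrightarrow> gagliardo_form s (K.G u) \<phi> = 0"
        and bound: "\<And>u. u \<in> {u1, u2, u3} \<Longrightarrow> u \<in> V \<and> a / 2 * gagliardo_form s u u \<le> a / 2 * R\<^sup>2 + b / 4 * R^4 + \<mu> * c\<^sub>H"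
        and levels: "Psi u1 < lam" "lam < Psi u2" "K.E u1 < 0" "K.E u2 < 0" "0 \<le> K.E u3"
        using K.three_critical_points[OF v(1) order(1) E1 v(2) order(2) E2, of R] unfolding R_def by blast
      \<comment> \<open>Both quantities that separate the three solutions, \<open>Psi\<close> and
        the energy, depend only on the a.e. class of a function.\<close>
      have E_cong: "K.E u = K.E w" if "u \<in> V" "w \<in> V" "AE x in lebesgue. u x = w x" for u w
        using Psi_cong_AE[OF that] gagliardo_sq_cong_AE[OF that] by (simp add: K.E_def gagliardo_form_self)
      have in_V: "u1 \<in> V" "u2 \<in> V" "u3 \<in> V" using bound by auto
      have "\<not> (AE x in lebesgue. u1 x = u2 x)" using Psi_cong_AE[OF in_V(1,2)] levels by auto
      moreover have "\<not> (AE x in lebesgue. u1 x = u3 x)" using E_cong[OF in_V(1,3)] levels by auto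
      moreover have "\<not> (AE x in lebesgue. u2 x = u3 x)" using E_cong[OF in_V(2,3)] levels by auto
      moreover have "u \<in> V \<and> gagliardo_sq s u < (sqrt \<rho>2)\<^sup>2 \<and> kirchhoff_weak_solution s \<Omega> f h a b \<mu> lam u"
        if u: "u \<in> {u1, u2, u3}" for u
      proof (intro conjI)
        show uV: "u \<in> V" using bound[OF u] by simp
        have "gagliardo_sq s u \<le> 2 / a * (a / 2 * R\<^sup>2 + b / 4 * R^4 + \<mu> * c\<^sub>H)"
          using bound[OF u] assms(16) by (simp add: gagliardo_form_self field_simps)
        then show "gagliardo_sq s u < (sqrt \<rho>2)\<^sup>2" using \<rho>2 by (simp add: \<rho>2_def)
        show "kirchhoff_weak_solution s \<Omega> f h a b \<mu> lam u"
          unfolding kirchhoff_weak_solution_def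
        proof
          fix \<phi> assume \<phi>: "\<phi> \<in> V"
          show "(a + b * gagliardo_sq s u) * gagliardo_form s u \<phi> = \<mu> * h (Psi u - lam) * dPsi u \<phi>"
            using crit[OF u \<phi>] K.B_G[OF uV \<phi>] k_eq[OF range[OF uV lam]] by (simp add: gagliardo_form_self)
        qed
      qed
      ultimately show ?thesis by blast
    qed
    moreover have "\<Lambda> \<noteq> {}" using d by (simp add: \<Lambda>_def)
    moreover have "open \<Lambda>" "is_interval \<Lambda>" by (simp_all add: \<Lambda>_def is_interval_oo)
    moreover have "\<Lambda> \<subseteq> {lo <..< hi}" using lo[OF v(1)] hi[OF v(2)] d(1) by (auto simp: \<Lambda>_def)
    moreover have "0 < sqrt \<rho>2" using \<rho>2 by simp
    ultimately show "\<exists>\<Lambda> \<rho>.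
           \<Lambda> \<noteq> {} \<and> open \<Lambda> \<and> is_interval \<Lambda> \<and>
           \<Lambda> \<subseteq> {measure lebesgue \<Omega> * (INF \<xi>. F \<xi>) <..< measure lebesgue \<Omega> * (SUP \<xi>. F \<xi>)} \<and>
           0 < \<rho> \<and>
           (\<forall>lam \<in> \<Lambda>. \<exists>u1 u2 u3.
              \<not> (AE x in lebesgue. u1 x = u2 x) \<and>
              \<not> (AE x in lebesgue. u1 x = u3 x) \<and>
              \<not> (AE x in lebesgue. u2 x = u3 x) \<and>
              (\<forall>u \<in> {u1, u2, u3}.
                 u \<in> frac_sobolev0 s \<Omega> \<and>
                 gagliardo_sq s u < \<rho>\<^sup>2 \<and>
                 kirchhoff_weak_solution s \<Omega> f h a b \<mu> lam u))"
      unfolding lo_def hi_def by (intro exI[of _ \<Lambda>] exI[of _ "sqrt \<rho>2"]) blast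
  qed
qed

end
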